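(* Let $Z$ be a closed subset of a Riemannian manifold $\Omega$ and let $m<\dim(\Omega)$. Suppose that $Z$ is not an $(m,h)$ set. Then there is a closed region $N\subset\Omega$ containing $Z$ and a point $p\in Z\cap\partial N$ such that $\partial N$ is smooth and such that $$H_m(\partial N,p)>h,$$ where $H_m(\partial N,p)$ is the sum of the smallest $m$ principal curvatures of $\partial N$ at $p$ with respect to the unit normal that points into $N$.
   Context: Definition of $(m,h)$ set: let $\Omega$ be a smooth manifold without boundary with a $C^1$ Riemannian metric $g$. A closed subset $Z\subset\Omega$ is an $(m,h)$ subset (or $(m,h)$ set) if, whenever $f:\Omega\to\mathbf{R}$ is a $C^2$ function such that $f|Z$ has a local maximum at $p\in Z$, we have $\operatorname{Trace}_m(\mathrm{D}^2f(p))\le h\,|\mathrm{D}f(p)|$. Here $\mathrm{D}^2f$ is the Hessian of $f$ with respect to $g$, $|\mathrm{D}f|$ is the norm of the derivative with respect to $g$, and $\operatorname{Trace}_m$ denotes the sum of the $m$ lowest eigenvalues (with respect to $g$, counted with multiplicity). Principal curvatures are signed so that the unit ball in Euclidean space has positive principal curvatures with respect to the inward normal. *)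

theory Defs
  imports "HOL-Analysis.Analysis" "HOL-Library.Multiset"
begin

section \<open>Differentiability classes on open subsets of a Euclidean space\<close>

fun Ck_on :: "nat \<Rightarrow> ('e::euclidean_space \<Rightarrow> 'f::real_normed_vector) \<Rightarrow> 'e set \<Rightarrow> bool" where
  "Ck_on 0 F S \<longleftrightarrow> continuous_on S F"
| "Ck_on (Suc k) F S \<longleftrightarrow> (\<forall>x\<in>S. F differentiable (at x)) \<and>
     (\<forall>v. Ck_on k (\<lambda>x. frechet_derivative F (at x) v) S)"

definition smooth_on :: "('e::euclidean_space \<Rightarrow> 'f::real_normed_vector) \<Rightarrow> 'e set \<Rightarrow> bool" where
  "smooth_on F S \<longleftrightarrow> (\<forall>k. Ck_on k F S)"

section \<open>Smooth manifolds and Riemannian metrics\<close>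

text \<open>The manifold is the whole type \<open>'a\<close> with its topology; its dimension is \<open>DIM('e)\<close>.
  A chart is a pair of a domain and a coordinate map, which is relevant only on that domain.\<close>

type_synonym ('a, 'e) chart = "'a set \<times> ('a \<Rightarrow> 'e)"

abbreviation chart_dom :: "('a, 'e) chart \<Rightarrow> 'a set" where
  "chart_dom c \<equiv> fst c"

abbreviation coord :: "('a, 'e) chart \<Rightarrow> 'a \<Rightarrow> 'e" where
  "coord c \<equiv> snd c"

abbreviation chart_ran :: "('a, 'e) chart \<Rightarrow> 'e set" where
  "chart_ran c \<equiv> coord c ` chart_dom c"

abbreviation param :: "('a, 'e) chart \<Rightarrow> 'e \<Rightarrow> 'a" where
  "param c \<equiv> inv_into (chart_dom c) (coord c)"

definition smooth_atlas ::
    "('a::{t2_space,second_countable_topology}, 'e::euclidean_space) chart set \<Rightarrow> bool" where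
  "smooth_atlas A \<longleftrightarrow>
     (\<Union>c\<in>A. chart_dom c) = UNIV \<and>
     (\<forall>c\<in>A. open (chart_dom c) \<and> open (chart_ran c) \<and>
        homeomorphism (chart_dom c) (chart_ran c) (coord c) (param c)) \<and>
     (\<forall>c\<in>A. \<forall>d\<in>A. smooth_on (coord d \<circ> param c) (coord c ` (chart_dom c \<inter> chart_dom d)))"

text \<open>A metric is given by its coordinate expressions: \<open>g c x v w\<close> is the inner product, at the
  point with coordinates \<open>x\<close> in the chart \<open>c\<close>, of the tangent vectors whose components
  in \<open>c\<close> are \<open>v\<close> and \<open>w\<close>.  The last conjunct is the transformation law of a covariant 2-tensor.\<close>

type_synonym 'e metric_field = "'e \<Rightarrow> 'e \<Rightarrow> 'e \<Rightarrow> real"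

definition C1_riemannian_metric ::
    "('a::{t2_space,second_countable_topology}, 'e::euclidean_space) chart set \<Rightarrow>
     (('a, 'e) chart \<Rightarrow> 'e metric_field) \<Rightarrow> bool" where
  "C1_riemannian_metric A g \<longleftrightarrow>
     (\<forall>c\<in>A. \<forall>x\<in>chart_ran c.
        bilinear (g c x) \<and> (\<forall>v w. g c x v w = g c x w v) \<and> (\<forall>v. v \<noteq> 0 \<longrightarrow> g c x v v > 0)) \<and>
     (\<forall>c\<in>A. \<forall>v w. Ck_on 1 (\<lambda>x. g c x v w) (chart_ran c)) \<and>
     (\<forall>c\<in>A. \<forall>d\<in>A. \<forall>p\<in>chart_dom c \<inter> chart_dom d. \<forall>v w.
        g c (coord c p) v w =
        g d (coord d p) (frechet_derivative (coord d \<circ> param c) (at (coord c p)) v)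
                        (frechet_derivative (coord d \<circ> param c) (at (coord c p)) w))"

definition C2_function ::
    "('a::{t2_space,second_countable_topology}, 'e::euclidean_space) chart set \<Rightarrow>
     ('a \<Rightarrow> real) \<Rightarrow> bool" where
  "C2_function A f \<longleftrightarrow> (\<forall>c\<in>A. Ck_on 2 (f \<circ> param c) (chart_ran c))"

section \<open>Eigenvalues of a symmetric form with respect to an inner product\<close>

text \<open>Here \<open>b\<close> is an inner product, \<open>V\<close> a subspace and \<open>B\<close> a symmetric bilinear form on \<open>V\<close>;
  the eigenvalues are those of the self-adjoint endomorphism of \<open>V\<close> associated with \<open>B\<close> by \<open>b\<close>.\<close>

definition eigenspace ::
    "('e::euclidean_space \<Rightarrow> 'e \<Rightarrow> real) \<Rightarrow> 'e set \<Rightarrow> ('e \<Rightarrow> 'e \<Rightarrow> real) \<Rightarrow> real \<Rightarrow> 'e set" where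
  "eigenspace b V B l = {v\<in>V. \<forall>w\<in>V. B v w = l * b v w}"

definition eigenvalues ::
    "('e::euclidean_space \<Rightarrow> 'e \<Rightarrow> real) \<Rightarrow> 'e set \<Rightarrow> ('e \<Rightarrow> 'e \<Rightarrow> real) \<Rightarrow> real multiset" where
  "eigenvalues b V B =
     (\<Sum>l\<in>{l. \<exists>v\<in>eigenspace b V B l. v \<noteq> 0}. replicate_mset (dim (eigenspace b V B l)) l)"

definition sum_lowest_eigenvalues ::
    "nat \<Rightarrow> ('e::euclidean_space \<Rightarrow> 'e \<Rightarrow> real) \<Rightarrow> 'e set \<Rightarrow> ('e \<Rightarrow> 'e \<Rightarrow> real) \<Rightarrow> real" where
  "sum_lowest_eigenvalues m b V B =
     sum_list (take m (sorted_list_of_multiset (eigenvalues b V B)))"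

section \<open>Gradient, Levi-Civita connection and Hessian in coordinates\<close>

text \<open>\<open>G\<close> is the coordinate expression of the metric in one chart and \<open>F\<close> that of a function.
  \<open>sharp\<close> raises an index: it turns a covector into the vector representing it.\<close>

definition sharp :: "('e::euclidean_space \<Rightarrow> 'e \<Rightarrow> real) \<Rightarrow> ('e \<Rightarrow> real) \<Rightarrow> 'e" where
  "sharp b L = (THE u. \<forall>z. b u z = L z)"

definition deriv_norm :: "'e::euclidean_space metric_field \<Rightarrow> ('e \<Rightarrow> real) \<Rightarrow> 'e \<Rightarrow> real" where
  "deriv_norm G F x =
     (let L = frechet_derivative F (at x); u = sharp (G x) L in sqrt (G x u u))"

text \<open>\<open>christoffel G x v w\<close> is the vector with components
  \<open>\<Gamma>\<^sup>k\<^sub>i\<^sub>j v\<^sup>i w\<^sup>j\<close>.\<close>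

definition christoffel :: "'e::euclidean_space metric_field \<Rightarrow> 'e \<Rightarrow> 'e \<Rightarrow> 'e \<Rightarrow> 'e" where
  "christoffel G x v w =
     sharp (G x) (\<lambda>z. (frechet_derivative (\<lambda>y. G y w z) (at x) v
                     + frechet_derivative (\<lambda>y. G y v z) (at x) w
                     - frechet_derivative (\<lambda>y. G y v w) (at x) z) / 2)"

definition hessian ::
    "'e::euclidean_space metric_field \<Rightarrow> ('e \<Rightarrow> real) \<Rightarrow> 'e \<Rightarrow> 'e \<Rightarrow> 'e \<Rightarrow> real" where
  "hessian G F x v w =
     frechet_derivative (\<lambda>y. frechet_derivative F (at y) w) (at x) v
     - frechet_derivative F (at x) (christoffel G x v w)"

section \<open>Sets of type \<open>(m, h)\<close>\<close>

definition local_max_on :: "('a::topological_space \<Rightarrow> real) \<Rightarrow> 'a set \<Rightarrow> 'a \<Rightarrow> bool" where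
  "local_max_on f Z p \<longleftrightarrow> p \<in> Z \<and> (\<exists>W. open W \<and> p \<in> W \<and> (\<forall>q\<in>Z \<inter> W. f q \<le> f p))"

text \<open>The two sides of the inequality do not depend on the chart around \<open>p\<close>.\<close>

definition mh_set ::
    "('a::{t2_space,second_countable_topology}, 'e::euclidean_space) chart set \<Rightarrow>
     (('a, 'e) chart \<Rightarrow> 'e metric_field) \<Rightarrow> nat \<Rightarrow> real \<Rightarrow> 'a set \<Rightarrow> bool" where
  "mh_set A g m h Z \<longleftrightarrow> closed Z \<and>
     (\<forall>f p. C2_function A f \<and> local_max_on f Z p \<longrightarrow>
       (\<forall>c\<in>A. p \<in> chart_dom c \<longrightarrow>
          sum_lowest_eigenvalues m (g c (coord c p)) UNIV (hessian (g c) (f \<circ> param c) (coord c p))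
          \<le> h * deriv_norm (g c) (f \<circ> param c) (coord c p)))"

section \<open>Closed regions with smooth boundary and their principal curvatures\<close>

text \<open>Near each boundary point, the region is a sublevel set of a smooth function without
  critical point there; so the boundary is a smooth embedded hypersurface and the region lies
  on exactly one side of it.  No connectedness is required.\<close>

definition smooth_closed_region ::
    "('a::{t2_space,second_countable_topology}, 'e::euclidean_space) chart set \<Rightarrow>
     'a set \<Rightarrow> bool" where
  "smooth_closed_region A N \<longleftrightarrow> closed N \<and>
     (\<forall>q\<in>frontier N. \<exists>c\<in>A. q \<in> chart_dom c \<and>
       (\<exists>W (u :: 'e \<Rightarrow> real). open W \<and> coord c q \<in> W \<and> W \<subseteq> chart_ran c \<and> smooth_on u W \<and>
          (\<forall>y\<in>W. \<exists>v. frechet_derivative u (at y) v \<noteq> 0) \<and>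
          coord c ` (N \<inter> chart_dom c) \<inter> W = {y\<in>W. u y \<le> 0}))"

definition tangent_vectors :: "'e::euclidean_space set \<Rightarrow> 'e \<Rightarrow> 'e set" where
  "tangent_vectors S y = {v. \<exists>\<gamma> :: real \<Rightarrow> 'e. \<gamma> 0 = y \<and>
     (\<exists>\<epsilon>>0. \<forall>t. \<bar>t\<bar> < \<epsilon> \<longrightarrow> \<gamma> t \<in> S) \<and> (\<gamma> has_vector_derivative v) (at 0)}"

text \<open>In the next two definitions \<open>R\<close> and \<open>S\<close> are the coordinate images of the region and of its
  boundary.\<close>

definition inward_normal ::
    "'e::euclidean_space metric_field \<Rightarrow> 'e set \<Rightarrow> 'e set \<Rightarrow> 'e \<Rightarrow> 'e" where
  "inward_normal G R S y = (THE \<nu>. G y \<nu> \<nu> = 1 \<and> (\<forall>w\<in>tangent_vectors S y. G y \<nu> w = 0) \<and>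
     (\<exists>\<epsilon>>0. \<forall>t\<in>{0<..<\<epsilon>}. y + t *\<^sub>R \<nu> \<in> R))"

text \<open>\<open>second_fund_form\<close> is the form \<open>(v, w) \<mapsto> - g(\<nabla>\<^sub>v \<nu>, w)\<close> with \<open>\<nu>\<close> the inward
  unit normal; it is positive for the Euclidean ball.  The field \<open>\<nu>\<close> lives on \<open>S\<close> only, and its
  derivative within \<open>S\<close> is determined on tangent vectors of \<open>S\<close>, the only arguments used.\<close>

definition second_fund_form ::
    "'e::euclidean_space metric_field \<Rightarrow> 'e set \<Rightarrow> 'e set \<Rightarrow> 'e \<Rightarrow> 'e \<Rightarrow> 'e \<Rightarrow> real" where
  "second_fund_form G R S x v w =
     - G x (frechet_derivative (inward_normal G R S) (at x within S) v
            + christoffel G x v (inward_normal G R S x)) w"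

text \<open>\<open>boundary_curvature_sum c G m N p\<close> is \<open>H\<^sub>m(\<partial>N, p)\<close> computed in the chart \<open>c\<close> around \<open>p\<close>,
  in which the metric is \<open>G\<close>; its value does not depend on the chart.\<close>

definition boundary_curvature_sum ::
    "('a::topological_space, 'e::euclidean_space) chart \<Rightarrow> 'e metric_field \<Rightarrow> nat \<Rightarrow>
     'a set \<Rightarrow> 'a \<Rightarrow> real" where
  "boundary_curvature_sum c G m N p =
     (let R = coord c ` (N \<inter> chart_dom c); S = coord c ` (frontier N \<inter> chart_dom c); x = coord c p
      in sum_lowest_eigenvalues m (G x) (tangent_vectors S x) (second_fund_form G R S x))"

end

theory Submission
  imports Defs
begin

text \<open>If \<open>Z\<close> violates the \<open>(m, h)\<close> condition at \<open>p\<close> with test function \<open>f\<close>, then in a chart \<open>f\<close> may be replaced by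
  its second order Taylor polynomial minus a small multiple of \<open>\<bar>x - p\<bar>\<^sup>2\<close>, which is smooth and still has a local
  maximum on \<open>Z\<close> at \<open>p\<close>.  If it is critical at \<open>p\<close>, a small linear tilt moves the maximum to a nearby noncritical
  point of \<open>Z\<close>, where the \<open>m\<close>-trace still beats \<open>h\<close> times the small gradient.  Subtracting \<open>K \<bar>x - p\<bar>\<^sup>4\<close> with
  \<open>K\<close> large changes no derivative up to order two at \<open>p\<close> but makes the positivity set a smoothly bounded open set inside
  a small ball; its complement is \<open>N\<close>.  On the tangent space of \<open>\<partial>N\<close> the second fundamental form is the Hessian
  divided by the norm of the gradient, and by Ky Fan's principle restricting a form to a subspace can only
  increase the sum of its \<open>m\<close> lowest eigenvalues.\<close>

section \<open>Sums of lowest eigenvalues\<close>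

text \<open>Failure of the condition is witnessed in a single chart and only to second order: the
  test function is a \<open>C2_function\<close> and the metric is C^1. The boundary must
  nevertheless be smooth, so the region is built from a polynomial in that chart; and its curvature
  must be computed in every chart around \<open>p\<close>, so Hessian and gradient norm have to be
  shown invariant under transition maps. A critical point is excluded because the level set through
  it need not be a hypersurface, and because the curvature bound arises on division by the gradient
  norm. The trace inequality is carried as a statement about all orthonormal
  \<open>m\<close>-tuples: in this form it survives small changes of the base point and applies at
  once to tuples tangent to the boundary; tangent tuples of length \<open>m\<close> exist because
  the tangent space has dimension \<open>DIM('e) - 1\<close>. As for signs: with \<open>N\<close>
  given locally by \<open>U \<le> 0\<close>, the inward normal is minus the normalised gradient of
  \<open>U\<close>, and \<open>second_fund_form\<close> carries another minus, so curvature and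
  Hessian of \<open>U\<close> have the same sign.\<close>

definition inner_form :: "('e::euclidean_space \<Rightarrow> 'e \<Rightarrow> real) \<Rightarrow> bool" where
  "inner_form b \<longleftrightarrow> bilinear b \<and> (\<forall>v w. b v w = b w v) \<and> (\<forall>v. v \<noteq> 0 \<longrightarrow> b v v > 0)"

text \<open>Traces over \<open>m\<close>-planes are handled through tuples, so that restriction to a
  subspace is mere inclusion and limits can be taken vector by vector. Only the indices below
  \<open>m\<close> matter.\<close>

definition orthonormal_tuple ::
    "('e::euclidean_space \<Rightarrow> 'e \<Rightarrow> real) \<Rightarrow> 'e set \<Rightarrow> nat \<Rightarrow> (nat \<Rightarrow> 'e) \<Rightarrow> bool" where
  "orthonormal_tuple b V m v \<longleftrightarrow>
     (\<forall>i<m. v i \<in> V) \<and> (\<forall>i<m. \<forall>j<m. b (v i) (v j) = (if i = j then 1 else 0))"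

lemma bilinear_continuous_diag:
  fixes B :: "'e::euclidean_space \<Rightarrow> 'e \<Rightarrow> real"
  assumes "bilinear B"
  shows "continuous_on S (\<lambda>v. B v v)"
  using bilinear_continuous_on_compose[OF continuous_on_id continuous_on_id assms] .

lemma bilinear_combination:
  fixes b B :: "'e::real_vector \<Rightarrow> 'e \<Rightarrow> real"
  assumes "bilinear b" "bilinear B"
  shows "bilinear (\<lambda>v w. p * B v w + q * b v w)"
  using assms unfolding bilinear_def linear_iff by (auto simp: algebra_simps)

lemma bilinear_sum_left:
  fixes b :: "'e::real_vector \<Rightarrow> 'e \<Rightarrow> real"
  assumes "bilinear b"
  shows "b (\<Sum>i\<in>I. f i *\<^sub>R v i) y = (\<Sum>i\<in>I. f i * b (v i) y)"
proof -
  interpret linear "\<lambda>x. b x y" using assms by (simp add: bilinear_def)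
  show ?thesis by (simp add: sum scale)
qed

lemma bilinear_sum_right:
  fixes b :: "'e::real_vector \<Rightarrow> 'e \<Rightarrow> real"
  assumes "bilinear b"
  shows "b y (\<Sum>i\<in>I. f i *\<^sub>R v i) = (\<Sum>i\<in>I. f i * b y (v i))"
proof -
  interpret linear "b y" using assms by (simp add: bilinear_def)
  show ?thesis by (simp add: sum scale)
qed

text \<open>The minimum over the compact Euclidean unit sphere is positive; homogeneity extends the
  bound to all vectors.\<close>

lemma inner_form_lower_bound:
  fixes b :: "'e::euclidean_space \<Rightarrow> 'e \<Rightarrow> real"
  assumes "inner_form b"
  obtains c where "c > 0" "\<And>v. c * (norm v)\<^sup>2 \<le> b v v"
proof -
  have bl: "bilinear b" and pos: "\<And>v. v \<noteq> 0 \<Longrightarrow> b v v > 0"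
    using assms by (auto simp: inner_form_def)
  obtain e :: 'e where e: "e \<in> Basis" using nonempty_Basis by blast
  then have ne: "sphere (0::'e) 1 \<noteq> {}" by (auto intro!: exI[of _ e])
  obtain x where x: "x \<in> sphere 0 1" "\<And>y. y \<in> sphere 0 1 \<Longrightarrow> b x x \<le> b y y"
    using continuous_attains_inf[OF compact_sphere ne bilinear_continuous_diag[OF bl]] by blast
  have "b v v \<ge> b x x * (norm v)\<^sup>2" for v
  proof (cases "v = 0")
    case True then show ?thesis by (simp add: bilinear_lzero[OF bl])
  next
    case False
    define u where "u = (1 / norm v) *\<^sub>R v"
    have "b x x \<le> b u u" using False by (intro x) (simp add: u_def)
    also have "b u u = b v v / (norm v)\<^sup>2"
      by (simp add: u_def bilinear_lmul[OF bl] bilinear_rmul[OF bl] power2_eq_square)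
    finally show ?thesis using False by (simp add: field_simps)
  qed
  moreover have "b x x > 0" using x(1) by (intro pos) auto
  ultimately show thesis using that by blast
qed

text \<open>The exact minimiser \<open>- q / r\<close> breaks down at \<open>r = 0\<close>; with
  \<open>r + 1\<close> in its place the value is still negative for \<open>q \<noteq> 0\<close> and
  \<open>r \<ge> 0\<close>, which avoids a case distinction.\<close>

lemma quadratic_at_vertex:
  fixes q r :: real
  assumes "r + 1 \<noteq> 0"
  shows "2 * (- q / (r + 1)) * q + (- q / (r + 1))\<^sup>2 * r = - (q\<^sup>2 * (r + 2)) / (r + 1)\<^sup>2"
proof -
  define s where "s = r + 1"
  have r: "r = s - 1" and "s \<noteq> 0" using assms by (auto simp: s_def)
  show ?thesis unfolding r using \<open>s \<noteq> 0\<close> by (simp add: field_simps power2_eq_square)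
qed

lemma linear_term_zero_if_quadratic_nonneg:
  fixes q r :: real
  assumes "\<And>t. 0 \<le> 2 * t * q + t\<^sup>2 * r" "r \<ge> 0"
  shows "q = 0"
proof (rule ccontr)
  assume "q \<noteq> 0"
  have "0 \<le> 2 * (- q / (r + 1)) * q + (- q / (r + 1))\<^sup>2 * r" by (rule assms(1))
  also have "\<dots> = - (q\<^sup>2 * (r + 2)) / (r + 1)\<^sup>2"
    by (rule quadratic_at_vertex) (use assms(2) in simp)
  also have "\<dots> < 0" using \<open>q \<noteq> 0\<close> assms(2) by (intro divide_neg_pos) auto
  finally show False by simp
qed

text \<open>Rayleigh quotient: \<open>e\<close> minimises \<open>B v v\<close> on the compact
  \<open>b\<close>-unit sphere of \<open>V\<close>, and the eigenvector equation is the first-order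
  condition at the minimum.\<close>

lemma lowest_eigenvector:
  fixes b B :: "'e::euclidean_space \<Rightarrow> 'e \<Rightarrow> real"
  assumes b: "inner_form b" and B: "bilinear B" "\<And>v w. B v w = B w v"
    and V: "subspace V" "V \<noteq> {0}"
  obtains e l where "e \<in> V" "b e e = 1" "\<And>w. w \<in> V \<Longrightarrow> B e w = l * b e w"
    "\<And>w. w \<in> V \<Longrightarrow> l * b w w \<le> B w w"
proof -
  have bl: "bilinear b" and pos: "\<And>v. v \<noteq> 0 \<Longrightarrow> b v v > 0" and sym: "\<And>v w. b v w = b w v"
    using b by (auto simp: inner_form_def)
  obtain c where c: "c > 0" "\<And>v. c * (norm v)\<^sup>2 \<le> b v v" using inner_form_lower_bound[OF b] by metis
  define K where "K = V \<inter> {v. b v v = 1}"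
  have "closed {v. b v v = 1}"
    using continuous_closed_preimage_constant[OF bilinear_continuous_diag[OF bl, of UNIV]] by simp
  then have "closed K" unfolding K_def using closed_subspace[OF V(1)] by auto
  moreover have "bounded K"
  proof (rule boundedI)
    fix x assume "x \<in> K"
    then have "c * (norm x)\<^sup>2 \<le> 1" using c(2)[of x] by (auto simp: K_def)
    then have "(norm x)\<^sup>2 \<le> 1 / c" using c(1) by (simp add: field_simps)
    then show "norm x \<le> sqrt (1 / c)" by (simp add: real_le_rsqrt)
  qed
  ultimately have "compact K" by (simp add: compact_eq_bounded_closed)
  have scale: "(1 / sqrt (b x x)) *\<^sub>R x \<in> K" if "x \<in> V" "x \<noteq> 0" for x
    using that pos[OF that(2)]
    by (auto simp: K_def subspace_scale[OF V(1)] bilinear_lmul[OF bl] bilinear_rmul[OF bl])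
  have "\<exists>x\<in>V. x \<noteq> 0" using V subspace_0 by blast
  then have "K \<noteq> {}" using scale by blast
  then obtain e where e: "e \<in> K" "\<And>y. y \<in> K \<Longrightarrow> B e e \<le> B y y"
    using continuous_attains_inf[OF \<open>compact K\<close> _ bilinear_continuous_diag[OF B(1)]] by blast
  define l where "l = B e e"
  have eV: "e \<in> V" "b e e = 1" using e by (auto simp: K_def)
  have low: "l * b w w \<le> B w w" if "w \<in> V" for w
  proof (cases "w = 0")
    case True then show ?thesis by (simp add: bilinear_lzero[OF bl] bilinear_lzero[OF B(1)])
  next
    case False
    from e(2)[OF scale[OF that False]] have "l \<le> B w w / b w w"
      using pos[OF False]
      by (auto simp: l_def bilinear_lmul[OF B(1)] bilinear_rmul[OF B(1)])
    then show ?thesis using pos[OF False] by (simp add: field_simps)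
  qed
  have "B e w = l * b e w" if w: "w \<in> V" for w
  proof -
    \<comment> \<open>The form \<open>B - l * b\<close> is nonnegative on \<open>V\<close> and
      vanishes at \<open>e\<close>, so along \<open>e + t *\<^sub>R w\<close> its linear term in
      \<open>t\<close> must vanish.\<close>
    have "B e w - l * b e w = 0"
    proof (rule linear_term_zero_if_quadratic_nonneg)
      show "0 \<le> B w w - l * b w w" using low[OF w] by simp
      fix t :: real
      have "e + t *\<^sub>R w \<in> V" using eV w V(1) by (simp add: subspace_add subspace_scale)
      from low[OF this] show "0 \<le> 2 * t * (B e w - l * b e w) + t\<^sup>2 * (B w w - l * b w w)"
        using B(2)[of w e] sym[of w e] eV(2)
        by (simp add: bilinear_ladd[OF bl] bilinear_radd[OF bl] bilinear_ladd[OF B(1)]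
            bilinear_radd[OF B(1)] bilinear_lmul[OF B(1)] bilinear_rmul[OF B(1)]
            bilinear_lmul[OF bl] bilinear_rmul[OF bl] algebra_simps power2_eq_square
            flip: l_def)
    qed
    then show ?thesis by simp
  qed
  with eV low that show thesis by blast
qed

text \<open>Monotonicity makes the first \<open>m\<close> values the lowest ones. Completeness is
  stated as the Fourier expansion, the form in which it is always used.\<close>

definition eigenbasis ::
    "('e::euclidean_space \<Rightarrow> 'e \<Rightarrow> real) \<Rightarrow> 'e set \<Rightarrow> ('e \<Rightarrow> 'e \<Rightarrow> real) \<Rightarrow> nat \<Rightarrow>
     (nat \<Rightarrow> 'e) \<Rightarrow> (nat \<Rightarrow> real) \<Rightarrow> bool" where
  "eigenbasis b V B n e l \<longleftrightarrow> orthonormal_tuple b V n e \<and>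
     (\<forall>i<n. \<forall>w\<in>V. B (e i) w = l i * b (e i) w) \<and>
     (\<forall>i j. i \<le> j \<longrightarrow> j < n \<longrightarrow> l i \<le> l j) \<and> (\<forall>v\<in>V. v = (\<Sum>j<n. b v (e j) *\<^sub>R e j))"

lemma eigenbasisD:
  assumes "eigenbasis b V B n e l"
  shows "orthonormal_tuple b V n e"
    and "\<And>i w. i < n \<Longrightarrow> w \<in> V \<Longrightarrow> B (e i) w = l i * b (e i) w"
    and "\<And>i j. i \<le> j \<Longrightarrow> j < n \<Longrightarrow> l i \<le> l j"
    and "\<And>v. v \<in> V \<Longrightarrow> v = (\<Sum>j<n. b v (e j) *\<^sub>R e j)"
  using assms unfolding eigenbasis_def by simp_all

text \<open>Induction on the dimension: a lowest eigenvector \<open>e0\<close> is split off and put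
  in front of an eigenbasis of its \<open>b\<close>-orthogonal complement \<open>W\<close>.\<close>

lemma spectral_theorem:
  fixes b B :: "'e::euclidean_space \<Rightarrow> 'e \<Rightarrow> real"
  assumes b: "inner_form b" and B: "bilinear B" "\<And>v w. B v w = B w v"
    and "subspace V" "dim V = n"
  shows "\<exists>e l. eigenbasis b V B n e l"
  using assms(4,5)
proof (induction n arbitrary: V)
  case 0
  then have "V \<subseteq> {0}" by simp
  then show ?case by (auto simp: eigenbasis_def orthonormal_tuple_def)
next
  case (Suc n)
  have bl: "bilinear b" and sym: "\<And>v w. b v w = b w v" using b by (auto simp: inner_form_def)
  have "V \<noteq> {0}" using Suc.prems by auto
  then obtain e0 l0 where e0: "e0 \<in> V" "b e0 e0 = 1" "\<And>w. w \<in> V \<Longrightarrow> B e0 w = l0 * b e0 w"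
    and low: "\<And>w. w \<in> V \<Longrightarrow> l0 * b w w \<le> B w w"
    using lowest_eigenvector[OF b B Suc.prems(1)] by metis
  define W where "W = {v\<in>V. b e0 v = 0}"
  have W: "subspace W" unfolding W_def using Suc.prems(1)
    by (auto simp: subspace_def bilinear_rzero[OF bl] bilinear_radd[OF bl] bilinear_rmul[OF bl])
  have "e0 \<notin> W" using e0 by (auto simp: W_def)
  have proj: "v - b v e0 *\<^sub>R e0 \<in> W" if "v \<in> V" for v
    using that e0(1,2) Suc.prems(1)
    by (auto simp: W_def subspace_diff subspace_scale bilinear_rsub[OF bl] bilinear_rmul[OF bl] sym)
  have "span (insert e0 W) = V"
  proof
    show "span (insert e0 W) \<subseteq> V" using e0(1) Suc.prems(1) by (intro span_minimal) (auto simp: W_def)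
    show "V \<subseteq> span (insert e0 W)"
    proof
      fix v assume "v \<in> V"
      then have "(v - b v e0 *\<^sub>R e0) + b v e0 *\<^sub>R e0 \<in> span (insert e0 W)"
        by (intro span_add span_scale span_base insertI1 insertI2 proj)
      then show "v \<in> span (insert e0 W)" by simp
    qed
  qed
  then have "dim (insert e0 W) = Suc n" using Suc.prems(2) by (metis dim_span)
  then have "dim W = n"
    using \<open>e0 \<notin> W\<close> W by (auto simp: dim_insert span_eq_iff[THEN iffD2] split: if_splits)
  from Suc.IH[OF W this] obtain e l where "eigenbasis b W B n e l" by blast
  note e = eigenbasisD(1)[OF this] and l = eigenbasisD(2)[OF this]
    and mono = eigenbasisD(3)[OF this] and ex = eigenbasisD(4)[OF this]
  have eW: "e i \<in> W" "e i \<in> V" "b e0 (e i) = 0" "b (e i) e0 = 0" if "i < n" for i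
    using e that sym[of "e i" e0] by (auto simp: orthonormal_tuple_def W_def)
  define e' where "e' = case_nat e0 e"
  define l' where "l' = case_nat l0 l"
  have "eigenbasis b V B (Suc n) e' l'"
    unfolding eigenbasis_def
  proof (intro conjI allI impI ballI)
    show "orthonormal_tuple b V (Suc n) e'"
      using e e0 eW unfolding orthonormal_tuple_def e'_def
      by (auto split: nat.split simp: less_Suc_eq_0_disj)
  next
    fix i w assume iw: "i < Suc n" "w \<in> V"
    show "B (e' i) w = l' i * b (e' i) w"
    proof (cases i)
      case 0 then show ?thesis using e0 iw by (simp add: e'_def l'_def)
    next
      case (Suc k)
      then have k: "k < n" using iw by simp
      \<comment> \<open>\<open>e k\<close> is known to be an eigenvector only when tested against
        \<open>W\<close>. The component of \<open>w\<close> along \<open>e0\<close> adds nothing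
        because \<open>e0\<close> is an eigenvector orthogonal to \<open>e k\<close>.\<close>
      have "B (e k) w = B (e k) (w - b w e0 *\<^sub>R e0) + b w e0 * B e0 (e k)"
        using B(2)[of "e k" e0] by (simp add: bilinear_rsub[OF B(1)] bilinear_rmul[OF B(1)])
      also have "B e0 (e k) = 0" using e0(3) eW[OF k] by simp
      also have "B (e k) (w - b w e0 *\<^sub>R e0) = l k * b (e k) (w - b w e0 *\<^sub>R e0)"
        by (rule l[OF k proj[OF iw(2)]])
      also have "b (e k) (w - b w e0 *\<^sub>R e0) = b (e k) w"
        using eW[OF k] by (simp add: bilinear_rsub[OF bl] bilinear_rmul[OF bl])
      finally show ?thesis using Suc by (simp add: e'_def l'_def)
    qed
  next
    fix i j :: nat assume ij: "i \<le> j" "j < Suc n"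
    \<comment> \<open>\<open>l0\<close> bounds the Rayleigh quotient on all of \<open>V\<close>, so
      putting it in front keeps the eigenvalues sorted.\<close>
    have "l0 \<le> l k" if "k < n" for k
      using low[OF eW(2)[OF that]] l[OF that eW(1)[OF that]] e that
      by (simp add: orthonormal_tuple_def)
    then show "l' i \<le> l' j" using ij mono by (auto simp: l'_def split: nat.split)
  next
    fix v assume v: "v \<in> V"
    have "v - b v e0 *\<^sub>R e0 = (\<Sum>j<n. b (v - b v e0 *\<^sub>R e0) (e j) *\<^sub>R e j)" by (rule ex[OF proj[OF v]])
    also have "\<dots> = (\<Sum>j<n. b v (e j) *\<^sub>R e j)"
      by (intro sum.cong) (auto simp: bilinear_lsub[OF bl] bilinear_lmul[OF bl] eW)
    finally show "v = (\<Sum>j<Suc n. b v (e' j) *\<^sub>R e' j)"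
      unfolding sum.lessThan_Suc_shift by (simp add: e'_def algebra_simps)
  qed
  then show ?case by blast
qed

lemma orthonormal_tuple_independent:
  assumes b: "inner_form b" and e: "orthonormal_tuple b V n e" and I: "I \<subseteq> {..<n}"
  shows "inj_on e I" "independent (e ` I)"
proof -
  have bl: "bilinear b" using b by (auto simp: inner_form_def)
  have on: "b (e i) (e j) = (if i = j then 1 else 0)" if "i \<in> I" "j \<in> I" for i j
    using e that(1)[THEN subsetD[OF I]] that(2)[THEN subsetD[OF I]]
    unfolding orthonormal_tuple_def by simp
  show inj: "inj_on e I"
  proof (rule inj_onI)
    fix i j assume "i \<in> I" "j \<in> I" "e i = e j"
    then show "i = j" using on[of i j] on[of i i] by (auto split: if_splits)
  qed
  have fin: "finite I" using finite_subset[OF I] by simp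
  show "independent (e ` I)"
  proof (rule ccontr)
    assume "\<not> independent (e ` I)"
    then obtain u where u: "\<exists>v\<in>e ` I. u v \<noteq> 0" "(\<Sum>v\<in>e ` I. u v *\<^sub>R v) = 0"
      using dependent_finite[of "e ` I"] fin by auto
    have "u (e k) = 0" if k: "k \<in> I" for k
    proof -
      have "0 = b (\<Sum>i\<in>I. u (e i) *\<^sub>R e i) (e k)"
        using u(2) by (simp add: sum.reindex[OF inj] bilinear_lzero[OF bl])
      also have "\<dots> = (\<Sum>i\<in>I. u (e i) * b (e i) (e k))"
        by (rule bilinear_sum_left[OF bl])
      also have "\<dots> = (\<Sum>i\<in>I. if i = k then u (e i) else 0)"
        using k by (intro sum.cong) (auto simp: on)
      also have "\<dots> = u (e k)" using k fin by simp
      finally show ?thesis by simp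
    qed
    then show False using u(1) by auto
  qed
qed

text \<open>An eigenvector to \<open>x\<close> is \<open>b\<close>-orthogonal to every
  \<open>e j\<close> with \<open>l j \<noteq> x\<close>, so its expansion involves only the basis
  vectors with eigenvalue \<open>x\<close>.\<close>

lemma dim_eigenspace:
  assumes b: "inner_form b" and B: "bilinear B" "\<And>v w. B v w = B w v"
    and V: "subspace V" and basis: "eigenbasis b V B n e l"
  shows "eigenspace b V B x = span (e ` {i. i < n \<and> l i = x})"
    and "dim (eigenspace b V B x) = card {i. i < n \<and> l i = x}"
proof -
  let ?I = "{i. i < n \<and> l i = x}"
  note e = eigenbasisD(1)[OF basis] and l = eigenbasisD(2)[OF basis] and ex = eigenbasisD(4)[OF basis]
  have bl: "bilinear b" and sym: "\<And>v w. b v w = b w v" using b by (auto simp: inner_form_def)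
  have eV: "e i \<in> V" if "i < n" for i using e that by (auto simp: orthonormal_tuple_def)
  show eq: "eigenspace b V B x = span (e ` ?I)"
  proof
    have "subspace (eigenspace b V B x)"
      using V unfolding subspace_def eigenspace_def
      by (auto simp: bilinear_lzero[OF B(1)] bilinear_lzero[OF bl] bilinear_ladd[OF B(1)]
          bilinear_ladd[OF bl] bilinear_lmul[OF B(1)] bilinear_lmul[OF bl] algebra_simps)
    then show "span (e ` ?I) \<subseteq> eigenspace b V B x"
      by (intro span_minimal) (auto simp: eigenspace_def eV l)
    show "eigenspace b V B x \<subseteq> span (e ` ?I)"
    proof
      fix v assume v: "v \<in> eigenspace b V B x"
      then have vV: "v \<in> V" by (simp add: eigenspace_def)
      have z: "b v (e j) = 0" if "j < n" "l j \<noteq> x" for j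
      proof -
        have "x * b v (e j) = l j * b v (e j)"
          using v l[OF that(1) vV] B(2)[of v "e j"] sym[of v "e j"] eV[OF that(1)]
          by (auto simp: eigenspace_def)
        then show ?thesis using that by simp
      qed
      have "v = (\<Sum>j<n. b v (e j) *\<^sub>R e j)" by (rule ex[OF vV])
      also have "\<dots> = (\<Sum>j\<in>?I. b v (e j) *\<^sub>R e j)"
        by (rule sum.mono_neutral_right) (use z in auto)
      also have "\<dots> \<in> span (e ` ?I)" by (intro span_sum span_scale span_base) auto
      finally show "v \<in> span (e ` ?I)" .
    qed
  qed
  have I: "?I \<subseteq> {..<n}" by auto
  show "dim (eigenspace b V B x) = card ?I"
    unfolding eq dim_span using orthonormal_tuple_independent[OF b e I]
    by (simp add: dim_eq_card_independent card_image)
qed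

text \<open>Links the multiset definition to a concrete sorted list: both count \<open>x\<close>
  with the dimension of its eigenspace, so sorting the multiset returns
  \<open>map l [0..<n]\<close>.\<close>

lemma sum_lowest_eigenvalues_eq:
  assumes b: "inner_form b" and B: "bilinear B" "\<And>v w. B v w = B w v"
    and V: "subspace V" and basis: "eigenbasis b V B n e l" and "m \<le> n"
  shows "sum_lowest_eigenvalues m b V B = (\<Sum>i<m. l i)"
proof -
  note e = eigenbasisD(1)[OF basis] and mono = eigenbasisD(3)[OF basis]
  note es = dim_eigenspace[OF b B V basis]
  have nz: "e i \<noteq> 0" if "i < n" for i
  proof
    assume "e i = 0"
    then have "b (e i) (e i) = 0" using b bilinear_lzero[of b "e i"] by (simp add: inner_form_def)
    moreover have "b (e i) (e i) = 1" using e that unfolding orthonormal_tuple_def by simp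
    ultimately show False by simp
  qed
  \<comment> \<open>This also shows that the index set of the sum in \<open>eigenvalues\<close> is
    finite; over an infinite set that sum would take the default value, the empty multiset.\<close>
  have E: "{x. \<exists>v\<in>eigenspace b V B x. v \<noteq> 0} = l ` {..<n}" (is "?E = _")
  proof (intro equalityI subsetI)
    fix x assume "x \<in> ?E"
    then have "\<exists>v\<in>span (e ` {i. i < n \<and> l i = x}). v \<noteq> 0" by (simp add: es(1))
    then have "{i. i < n \<and> l i = x} \<noteq> {}" by fastforce
    then show "x \<in> l ` {..<n}" by auto
  next
    fix x assume "x \<in> l ` {..<n}"
    then obtain i where i: "i < n" "x = l i" by auto
    then have "e i \<in> eigenspace b V B x" by (auto simp: es(1) intro!: span_base)
    then show "x \<in> ?E" using nz i by auto
  qed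
  have "eigenvalues b V B = mset (map l [0..<n])"
  proof (rule multiset_eqI)
    fix x
    have "count (eigenvalues b V B) x = (\<Sum>y\<in>?E. if y = x then card {i. i < n \<and> l i = y} else 0)"
      unfolding eigenvalues_def count_sum by (intro sum.cong) (auto simp: es(2))
    also have "\<dots> = card {i. i < n \<and> l i = x}"
      unfolding E by (auto simp: sum.delta)
    also have "\<dots> = length (filter ((=) x) (map l [0..<n]))"
      unfolding length_filter_conv_card by (intro arg_cong[where f = card]) auto
    finally show "count (eigenvalues b V B) x = count (mset (map l [0..<n])) x"
      by (simp only: count_mset count_list_eq_length_filter)
  qed
  moreover have "sorted (map l [0..<n])"
    unfolding sorted_iff_nth_mono by (auto intro: mono)
  ultimately have "sorted_list_of_multiset (eigenvalues b V B) = map l [0..<n]"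
    by (simp only: sorted_list_of_multiset_mset sorted_sort_id)
  then show ?thesis using \<open>m \<le> n\<close>
    by (simp add: sum_lowest_eigenvalues_def take_map sum_list_map_eq_sum_count lessThan_atLeast0
        interv_sum_list_conv_sum_set_nat)
qed

lemma sum_lowest_eigenvalues_attained:
  fixes b B :: "'e::euclidean_space \<Rightarrow> 'e \<Rightarrow> real"
  assumes b: "inner_form b" and B: "bilinear B" "\<And>v w. B v w = B w v"
    and V: "subspace V" and m: "m \<le> dim V"
  obtains v where "orthonormal_tuple b V m v"
    "sum_lowest_eigenvalues m b V B = (\<Sum>i<m. B (v i) (v i))"
proof -
  from spectral_theorem[OF b B V refl] obtain e l where basis: "eigenbasis b V B (dim V) e l" by blast
  note e = eigenbasisD(1)[OF basis] and l = eigenbasisD(2)[OF basis]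
  show thesis
  proof (rule that)
    show "orthonormal_tuple b V m e" using e m by (auto simp: orthonormal_tuple_def)
    have "sum_lowest_eigenvalues m b V B = (\<Sum>i<m. l i)"
      by (rule sum_lowest_eigenvalues_eq[OF b B V basis m])
    also have "\<dots> = (\<Sum>i<m. B (e i) (e i))"
      using e l m by (intro sum.cong) (auto simp: orthonormal_tuple_def)
    finally show "sum_lowest_eigenvalues m b V B = (\<Sum>i<m. B (e i) (e i))" .
  qed
qed

section \<open>Bessel's inequality and Ky Fan's principle\<close>

lemma Bessel_inequality:
  assumes b: "inner_form b" and v: "orthonormal_tuple b V m v"
  shows "(\<Sum>i<m. (b (v i) x)\<^sup>2) \<le> b x x"
proof -
  have bl: "bilinear b" and sym: "\<And>v w. b v w = b w v" and pos: "\<And>v. v \<noteq> 0 \<Longrightarrow> b v v > 0"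
    using b by (auto simp: inner_form_def)
  define s where "s = (\<Sum>i<m. b (v i) x *\<^sub>R v i)"
  have vs: "b (v i) s = b (v i) x" if "i < m" for i
  proof -
    have "b (v i) s = (\<Sum>j<m. b (v j) x * b (v i) (v j))"
      unfolding s_def by (rule bilinear_sum_right[OF bl])
    also have "\<dots> = (\<Sum>j<m. if j = i then b (v j) x else 0)"
      using that v by (intro sum.cong) (auto simp: orthonormal_tuple_def)
    finally show ?thesis using that by simp
  qed
  have sy: "b s y = (\<Sum>i<m. b (v i) x * b (v i) y)" for y
    unfolding s_def by (rule bilinear_sum_left[OF bl])
  have ss: "b s s = (\<Sum>i<m. (b (v i) x)\<^sup>2)" "b s x = (\<Sum>i<m. (b (v i) x)\<^sup>2)"
    unfolding sy by (auto simp: vs power2_eq_square intro!: sum.cong)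
  have "0 \<le> b (x - s) (x - s)"
    using pos[of "x - s"] bilinear_lzero[OF bl] by (cases "x - s = 0") auto
  also have "\<dots> = b x x - (\<Sum>i<m. (b (v i) x)\<^sup>2)"
    using ss sym[of x s] by (simp add: bilinear_lsub[OF bl] bilinear_rsub[OF bl])
  finally show ?thesis by simp
qed

text \<open>The trace over the tuple is a weighted sum of the eigenvalues. The weights
  \<open>c j\<close> lie between 0 and 1 by Bessel's inequality and add up to \<open>m\<close>, so
  the sum is smallest when all the weight sits on the first \<open>m\<close> eigenvalues.\<close>

lemma Ky_Fan_minimum_principle:
  fixes b B :: "'e::euclidean_space \<Rightarrow> 'e \<Rightarrow> real"
  assumes b: "inner_form b" and B: "bilinear B" "\<And>v w. B v w = B w v"
    and V: "subspace V" and v: "orthonormal_tuple b V m v"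
  shows "sum_lowest_eigenvalues m b V B \<le> (\<Sum>i<m. B (v i) (v i))"
proof -
  let ?n = "dim V"
  have bl: "bilinear b" and sym: "\<And>v w. b v w = b w v" using b by (auto simp: inner_form_def)
  from spectral_theorem[OF b B V refl] obtain e l where basis: "eigenbasis b V B ?n e l" by blast
  note e = eigenbasisD(1)[OF basis] and l = eigenbasisD(2)[OF basis]
    and mono = eigenbasisD(3)[OF basis] and ex = eigenbasisD(4)[OF basis]
  define c where "c j = (\<Sum>i<m. (b (v i) (e j))\<^sup>2)" for j
  have eV: "e j \<in> V" "b (e j) (e j) = 1" if "j < ?n" for j
    using e that by (auto simp: orthonormal_tuple_def)
  have c01: "0 \<le> c j" "c j \<le> 1" if "j < ?n" for j
    using Bessel_inequality[OF b v, of "e j"] eV[OF that] by (auto simp: c_def sum_nonneg)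
  have vV: "v i \<in> V" "b (v i) (v i) = 1" if "i < m" for i
    using v that by (auto simp: orthonormal_tuple_def)
  have expand: "b w (v i) = (\<Sum>j<?n. b (v i) (e j) * b w (e j))" if "i < m" for i w
  proof -
    have "b w (v i) = b w (\<Sum>j<?n. b (v i) (e j) *\<^sub>R e j)" using ex[OF vV(1)[OF that]] by simp
    also have "\<dots> = (\<Sum>j<?n. b (v i) (e j) * b w (e j))"
      by (rule bilinear_sum_right[OF bl])
    finally show ?thesis .
  qed
  have expandB: "B (v i) (v i) = (\<Sum>j<?n. l j * (b (v i) (e j))\<^sup>2)" if "i < m" for i
  proof -
    have "B (v i) (v i) = B (v i) (\<Sum>j<?n. b (v i) (e j) *\<^sub>R e j)" using ex[OF vV(1)[OF that]] by simp
    also have "\<dots> = (\<Sum>j<?n. b (v i) (e j) * B (v i) (e j))"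
      by (rule bilinear_sum_right[OF B(1)])
    also have "\<dots> = (\<Sum>j<?n. l j * (b (v i) (e j))\<^sup>2)"
      by (intro sum.cong) (auto simp: B(2)[of "v i"] sym[of "v i"] l vV(1)[OF that] power2_eq_square)
    finally show ?thesis .
  qed
  have csum: "(\<Sum>j<?n. c j) = m"
  proof -
    have "(\<Sum>j<?n. c j) = (\<Sum>i<m. \<Sum>j<?n. (b (v i) (e j))\<^sup>2)" unfolding c_def by (rule sum.swap)
    also have "\<dots> = (\<Sum>i<m. b (v i) (v i))" by (intro sum.cong) (auto simp: expand power2_eq_square)
    also have "\<dots> = m" by (simp add: vV)
    finally show ?thesis .
  qed
  have "real m \<le> (\<Sum>j<?n. 1)" unfolding csum[symmetric] using c01 by (intro sum_mono) auto
  then have mn: "m \<le> ?n" by simp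
  have "(\<Sum>i<m. B (v i) (v i)) = (\<Sum>i<m. \<Sum>j<?n. l j * (b (v i) (e j))\<^sup>2)"
    by (intro sum.cong) (auto simp: expandB)
  also have "\<dots> = (\<Sum>j<?n. l j * c j)" unfolding c_def sum_distrib_left by (rule sum.swap)
  finally have *: "(\<Sum>i<m. B (v i) (v i)) = (\<Sum>j<?n. l j * c j)" .
  have low: "sum_lowest_eigenvalues m b V B = (\<Sum>j<m. l j)"
    by (rule sum_lowest_eigenvalues_eq[OF b B V basis mn])
  define d where "d j = (if j < m then 1 else 0 :: real)" for j
  have dsum: "(\<Sum>j<?n. x j * d j) = (\<Sum>j<m. x j)" for x :: "nat \<Rightarrow> real"
    by (rule sum.mono_neutral_cong_right) (use mn in \<open>auto simp: d_def\<close>)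
  \<comment> \<open>\<open>l (m - 1)\<close> is the threshold: below \<open>m\<close> both factors
    are nonpositive, from \<open>m\<close> on both are nonnegative. As \<open>c\<close> and
    \<open>d\<close> have the same total, the threshold drops out of the sum. For
    \<open>m = 0\<close> it reads \<open>l 0\<close> and only the second case occurs.\<close>
  have "0 \<le> (\<Sum>j<?n. (l j - l (m - 1)) * (c j - d j))"
  proof (intro sum_nonneg)
    fix j assume "j \<in> {..<?n}"
    then have j: "j < ?n" by simp
    show "0 \<le> (l j - l (m - 1)) * (c j - d j)"
    proof (cases "j < m")
      case True
      then have "l j \<le> l (m - 1)" using mn by (intro mono) auto
      then show ?thesis using c01[OF j] True by (intro mult_nonpos_nonpos) (auto simp: d_def)
    next
      case False
      then have "l (m - 1) \<le> l j" using j by (intro mono) auto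
      then show ?thesis using c01[OF j] False by (intro mult_nonneg_nonneg) (auto simp: d_def)
    qed
  qed
  also have "\<dots> = (\<Sum>j<?n. l j * c j) - (\<Sum>j<?n. l j * d j) - l (m - 1) * ((\<Sum>j<?n. c j) - (\<Sum>j<?n. 1 * d j))"
    by (simp only: left_diff_distrib right_diff_distrib sum_subtractf sum_distrib_left mult_1_left)
  also have "\<dots> = (\<Sum>j<?n. l j * c j) - (\<Sum>j<m. l j)"
    unfolding dsum csum by simp
  finally show ?thesis unfolding * low by simp
qed

text \<open>The second fundamental form is identified on tangent vectors only; this suffices to
  replace it.\<close>

lemma sum_lowest_eigenvalues_cong:
  assumes "\<And>v w. v \<in> V \<Longrightarrow> w \<in> V \<Longrightarrow> B v w = B' v w"
  shows "sum_lowest_eigenvalues m b V B = sum_lowest_eigenvalues m b V B'"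
proof -
  have "eigenspace b V B = eigenspace b V B'"
    using assms by (intro ext) (auto simp: eigenspace_def)
  then show ?thesis by (simp add: sum_lowest_eigenvalues_def eigenvalues_def)
qed

section \<open>Second derivatives\<close>

text \<open>A pointwise notion that serves test functions, transition maps and polynomials alike.
  The derivative must exist near \<open>x\<close> for its own derivative to make sense;
  differentiability of the latter is asked direction by direction, which in finite dimension is made
  uniform below.\<close>

definition twice_diff :: "('e::euclidean_space \<Rightarrow> 'f::real_normed_vector) \<Rightarrow> 'e \<Rightarrow> bool" where
  "twice_diff F x \<longleftrightarrow> (\<forall>\<^sub>F y in nhds x. F differentiable (at y)) \<and>
     (\<forall>w. (\<lambda>y. frechet_derivative F (at y) w) differentiable (at x))"

definition D2 :: "('e::euclidean_space \<Rightarrow> 'f::real_normed_vector) \<Rightarrow> 'e \<Rightarrow> 'e \<Rightarrow> 'e \<Rightarrow> 'f" where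
  "D2 F x v w = frechet_derivative (\<lambda>y. frechet_derivative F (at y) w) (at x) v"

lemma twice_diff_differentiable: "twice_diff F x \<Longrightarrow> F differentiable (at x)"
  unfolding twice_diff_def using eventually_nhds_x_imp_x by blast

lemma twice_diff_has_derivative:
  "twice_diff F x \<Longrightarrow> ((\<lambda>y. frechet_derivative F (at y) w) has_derivative (\<lambda>v. D2 F x v w)) (at x)"
  unfolding D2_def twice_diff_def by (metis frechet_derivative_works)

lemma has_derivative_transform_nhds:
  assumes "(f has_derivative f') (at x)" "\<forall>\<^sub>F y in nhds x. f y = g y"
  shows "(g has_derivative f') (at x)"
proof -
  have "\<forall>\<^sub>F y in at x. f y = g y" using assms(2) by (simp add: eventually_nhds_conv_at)
  moreover have "f x = g x" using eventually_nhds_x_imp_x[OF assms(2)] .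
  ultimately show ?thesis using has_derivative_transform_eventually[OF assms(1)] by simp
qed

lemma frechet_derivative_eqI: "(f has_derivative f') (at x) \<Longrightarrow> frechet_derivative f (at x) = f'"
  using frechet_derivative_at by metis

text \<open>Linearity in \<open>v\<close> is that of a derivative. Linearity in \<open>w\<close>
  comes from differentiating, at \<open>x\<close>, the identities that express linearity of the
  first derivative at all nearby points.\<close>

lemma D2_linear:
  assumes "twice_diff F x"
  shows "linear (\<lambda>v. D2 F x v w)" "linear (\<lambda>w. D2 F x v w)"
proof -
  note h = twice_diff_has_derivative[OF assms]
  show "linear (\<lambda>v. D2 F x v w)" using h[of w] has_derivative_linear by blast
  have ev: "\<forall>\<^sub>F y in nhds x. linear (frechet_derivative F (at y))"
    using assms unfolding twice_diff_def by (auto elim: eventually_mono intro: linear_frechet_derivative)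
  have "D2 F x v (p + q) = D2 F x v p + D2 F x v q" for v p q
  proof -
    have "((\<lambda>y. frechet_derivative F (at y) (p + q)) has_derivative (\<lambda>v. D2 F x v p + D2 F x v q)) (at x)"
      by (rule has_derivative_transform_nhds[OF has_derivative_add[OF h[of p] h[of q]]])
        (use ev in \<open>auto elim!: eventually_mono simp: linear_add\<close>)
    from has_derivative_unique[OF this h[of "p + q"]] show ?thesis by metis
  qed
  moreover have "D2 F x v (r *\<^sub>R p) = r *\<^sub>R D2 F x v p" for v p r
  proof -
    have "((\<lambda>y. frechet_derivative F (at y) (r *\<^sub>R p)) has_derivative (\<lambda>v. r *\<^sub>R D2 F x v p)) (at x)"
      by (rule has_derivative_transform_nhds[OF has_derivative_scaleR_right[OF h[of p]]])
        (use ev in \<open>auto elim!: eventually_mono simp: linear_cmul\<close>)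
    from has_derivative_unique[OF this h[of "r *\<^sub>R p"]] show ?thesis by metis
  qed
  ultimately show "linear (\<lambda>w. D2 F x v w)" by (intro linearI) auto
qed

lemma D2_bilinear: "twice_diff F x \<Longrightarrow> bilinear (D2 F x)"
  by (simp add: bilinear_def D2_linear)

text \<open>For each fixed \<open>w\<close> this is differentiability. Applying it to the finitely
  many basis vectors, with the tolerance divided by the dimension, and using linearity in
  \<open>w\<close> makes the neighbourhood independent of \<open>w\<close>.\<close>

lemma derivative_first_order_expansion:
  fixes F :: "'e::euclidean_space \<Rightarrow> 'f::real_normed_vector"
  assumes F: "twice_diff F x" and "\<epsilon> > 0"
  shows "\<forall>\<^sub>F y in nhds x. \<forall>w. norm (frechet_derivative F (at y) w - frechet_derivative F (at x) w
            - D2 F x (y - x) w) \<le> \<epsilon> * norm (y - x) * norm w"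
proof -
  define \<eta> where "\<eta> = \<epsilon> / DIM('e)"
  have "\<eta> > 0" using assms by (simp add: \<eta>_def)
  define R where "R y w = frechet_derivative F (at y) w - frechet_derivative F (at x) w
            - D2 F x (y - x) w" for y w
  have "\<forall>\<^sub>F y in nhds x. norm (R y i) \<le> \<eta> * norm (y - x)" for i
    using twice_diff_has_derivative[OF F, of i] \<open>\<eta> > 0\<close>
    unfolding has_derivative_at_alt eventually_nhds_metric dist_norm R_def by blast
  then have ev: "\<forall>\<^sub>F y in nhds x. \<forall>i\<in>Basis. norm (R y i) \<le> \<eta> * norm (y - x)"
    by (simp add: eventually_ball_finite_distrib)
  moreover have ev2: "\<forall>\<^sub>F y in nhds x. F differentiable (at y)" using F by (simp add: twice_diff_def)
  ultimately show ?thesis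
  proof eventually_elim
    case (elim y)
    have "linear (R y)" unfolding R_def
      using elim(2) twice_diff_differentiable[OF F] D2_linear(2)[OF F]
      by (intro linear_compose_sub) (auto intro: linear_frechet_derivative)
    have "norm (R y w) \<le> \<epsilon> * norm (y - x) * norm w" for w
    proof -
      have "R y w = R y (\<Sum>i\<in>Basis. (w \<bullet> i) *\<^sub>R i)" by (simp add: euclidean_representation)
      also have "\<dots> = (\<Sum>i\<in>Basis. (w \<bullet> i) *\<^sub>R R y i)"
        using \<open>linear (R y)\<close> by (simp add: linear_sum linear_cmul)
      also have "norm \<dots> \<le> (\<Sum>i\<in>(Basis::'e set). norm w * (\<eta> * norm (y - x)))"
      proof (rule sum_norm_le)
        fix i :: 'e assume i: "i \<in> Basis"
        show "norm ((w \<bullet> i) *\<^sub>R R y i) \<le> norm w * (\<eta> * norm (y - x))"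
          unfolding norm_scaleR using i elim(1) Basis_le_norm[OF i, of w] by (intro mult_mono) auto
      qed
      also have "\<dots> = \<epsilon> * norm (y - x) * norm w" by (simp add: \<eta>_def)
      finally show ?thesis .
    qed
    then show ?case by (simp add: R_def)
  qed
qed

lemma has_derivative_along_line:
  fixes F :: "'e::euclidean_space \<Rightarrow> real"
  assumes "F differentiable (at (x + t *\<^sub>R v))"
  shows "((\<lambda>t. F (x + t *\<^sub>R v)) has_real_derivative frechet_derivative F (at (x + t *\<^sub>R v)) v) (at t)"
proof -
  have 1: "((\<lambda>t. x + t *\<^sub>R v) has_derivative (\<lambda>s. s *\<^sub>R v)) (at t)"
    by (auto intro!: derivative_eq_intros)
  have 2: "(F has_derivative frechet_derivative F (at (x + t *\<^sub>R v))) (at (x + t *\<^sub>R v))"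
    using assms frechet_derivative_works by blast
  have "linear (frechet_derivative F (at (x + t *\<^sub>R v)))" using assms linear_frechet_derivative by blast
  then have "(\<lambda>s. frechet_derivative F (at (x + t *\<^sub>R v)) (s *\<^sub>R v)) =
      (*) (frechet_derivative F (at (x + t *\<^sub>R v)) v)"
    by (auto simp: linear_cmul)
  with has_derivative_compose[OF 1 2] show ?thesis by (simp add: has_field_derivative_def)
qed

text \<open>The second difference is the increment over \<open>[0, s]\<close> of \<open>F (x + s
  *\<^sub>R w + t *\<^sub>R v) - F (x + t *\<^sub>R v)\<close> as a function of \<open>t\<close>.
  The mean value theorem turns it into a difference of two first derivatives, and each is replaced
  by its first-order expansion at \<open>x\<close>.\<close>

lemma second_difference_estimate:
  fixes F :: "'e::euclidean_space \<Rightarrow> real"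
  assumes F: "twice_diff F x" and "s > 0" "\<epsilon> > 0"
    and close: "s * (norm v + norm w) < r"
    and r: "\<And>y. norm (y - x) < r \<Longrightarrow> F differentiable (at y) \<and> (\<forall>w. \<bar>frechet_derivative F (at y) w -
        frechet_derivative F (at x) w - D2 F x (y - x) w\<bar> \<le> \<epsilon> * norm (y - x) * norm w)"
  shows "\<bar>F (x + s *\<^sub>R v + s *\<^sub>R w) - F (x + s *\<^sub>R v) - F (x + s *\<^sub>R w) + F x - s\<^sup>2 * D2 F x w v\<bar>
     \<le> s\<^sup>2 * (2 * \<epsilon> * (norm v + norm w)\<^sup>2)"
proof -
  define k where "k t = F ((x + s *\<^sub>R w) + t *\<^sub>R v) - F (x + t *\<^sub>R v)" for t
  define k' where "k' t = frechet_derivative F (at ((x + s *\<^sub>R w) + t *\<^sub>R v)) v -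
      frechet_derivative F (at (x + t *\<^sub>R v)) v" for t
  have bnd: "norm (s *\<^sub>R w + t *\<^sub>R v) \<le> s * (norm v + norm w)" "norm (t *\<^sub>R v) \<le> s * (norm v + norm w)"
    if "0 \<le> t" "t \<le> s" for t
  proof -
    have *: "t * norm v \<le> s * norm v" "0 \<le> s * norm w" using that \<open>s > 0\<close> by (auto intro: mult_right_mono)
    have "norm (s *\<^sub>R w + t *\<^sub>R v) \<le> s * norm w + t * norm v"
      using norm_triangle_ineq[of "s *\<^sub>R w" "t *\<^sub>R v"] that \<open>s > 0\<close> by simp
    then show "norm (s *\<^sub>R w + t *\<^sub>R v) \<le> s * (norm v + norm w)" using * by (simp add: algebra_simps)
    show "norm (t *\<^sub>R v) \<le> s * (norm v + norm w)"
      using * that(1) unfolding distrib_left norm_scaleR by linarith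
  qed
  have *: "norm ((x + s *\<^sub>R w) + t *\<^sub>R v - x) < r" "norm (x + t *\<^sub>R v - x) < r" if "0 \<le> t" "t \<le> s" for t
    using bnd[OF that] close by (auto simp: algebra_simps)
  have der: "(k has_real_derivative k' t) (at t)" if "0 \<le> t" "t \<le> s" for t
    unfolding k_def k'_def using r[OF *(1)[OF that]] r[OF *(2)[OF that]]
    by (intro DERIV_diff has_derivative_along_line) auto
  obtain \<xi> where \<xi>: "0 < \<xi>" "\<xi> < s" "k s - k 0 = (s - 0) * k' \<xi>"
    using MVT2[OF \<open>s > 0\<close>, of k k'] der by auto
  note \<xi>le = less_imp_le[OF \<xi>(1)] less_imp_le[OF \<xi>(2)]
  let ?R = "\<lambda>y. frechet_derivative F (at y) v - frechet_derivative F (at x) v - D2 F x (y - x) v"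
  have "\<bar>?R (x + s *\<^sub>R w + \<xi> *\<^sub>R v)\<bar> \<le> \<epsilon> * norm (x + s *\<^sub>R w + \<xi> *\<^sub>R v - x) * norm v"
    using r[OF *(1)[OF \<xi>le]] by blast
  also have "\<dots> \<le> \<epsilon> * (s * (norm v + norm w)) * (norm v + norm w)"
    using bnd(1)[OF \<xi>le] assms(2,3) by (intro mult_mono) (auto simp: algebra_simps)
  finally have 1: "\<bar>?R (x + s *\<^sub>R w + \<xi> *\<^sub>R v)\<bar> \<le> \<epsilon> * (s * (norm v + norm w)) * (norm v + norm w)" .
  have "\<bar>?R (x + \<xi> *\<^sub>R v)\<bar> \<le> \<epsilon> * norm (x + \<xi> *\<^sub>R v - x) * norm v"
    using r[OF *(2)[OF \<xi>le]] by blast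
  also have "\<dots> \<le> \<epsilon> * (s * (norm v + norm w)) * (norm v + norm w)"
    using bnd(2)[OF \<xi>le] assms(2,3) by (intro mult_mono) (auto simp: algebra_simps)
  finally have 2: "\<bar>?R (x + \<xi> *\<^sub>R v)\<bar> \<le> \<epsilon> * (s * (norm v + norm w)) * (norm v + norm w)" .
  have "D2 F x (x + s *\<^sub>R w + \<xi> *\<^sub>R v - x) v - D2 F x (x + \<xi> *\<^sub>R v - x) v = s * D2 F x w v"
    using D2_linear(1)[OF F, of v] by (simp add: linear_diff[symmetric] linear_cmul[where f = "\<lambda>w. D2 F x w v"] add.assoc
        linear_add[where f = "\<lambda>w. D2 F x w v"])
  then have "\<bar>k' \<xi> - s * D2 F x w v\<bar> \<le> 2 * (\<epsilon> * (s * (norm v + norm w)) * (norm v + norm w))"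
    using 1 2 unfolding k'_def by linarith
  then have "s * \<bar>k' \<xi> - s * D2 F x w v\<bar> \<le> s * (2 * (\<epsilon> * (s * (norm v + norm w)) * (norm v + norm w)))"
    using \<open>s > 0\<close> by simp
  also have "s * \<bar>k' \<xi> - s * D2 F x w v\<bar> = \<bar>k s - k 0 - s\<^sup>2 * D2 F x w v\<bar>"
  proof -
    have "k s - k 0 - s\<^sup>2 * D2 F x w v = s * (k' \<xi> - s * D2 F x w v)"
      by (simp add: \<xi>(3) algebra_simps power2_eq_square)
    then show ?thesis using \<open>s > 0\<close> by (simp add: abs_mult)
  qed
  finally show ?thesis by (simp add: k_def algebra_simps power2_eq_square)
qed

text \<open>The second difference is symmetric in \<open>v\<close> and \<open>w\<close>, and to
  leading order it equals \<open>s\<^sup>2\<close> times \<open>D2\<close> in either order of the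
  arguments.\<close>

lemma D2_symmetric_real:
  fixes F :: "'e::euclidean_space \<Rightarrow> real"
  assumes F: "twice_diff F x"
  shows "D2 F x v w = D2 F x w v"
proof (rule ccontr)
  assume ne: "D2 F x v w \<noteq> D2 F x w v"
  define M where "M = (norm v + norm w)\<^sup>2"
  define \<delta> where "\<delta> = \<bar>D2 F x v w - D2 F x w v\<bar>"
  have "M \<ge> 0" "\<delta> > 0" using ne by (auto simp: M_def \<delta>_def)
  \<comment> \<open>The two estimates together cost \<open>4 * \<epsilon> * M\<close>, which this
    choice keeps below \<open>\<delta>\<close>; the added 1 covers \<open>M = 0\<close>.\<close>
  define \<epsilon> where "\<epsilon> = \<delta> / (8 * (M + 1))"
  have "\<epsilon> > 0" using \<open>\<delta> > 0\<close> \<open>M \<ge> 0\<close> by (simp add: \<epsilon>_def)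
  have "\<forall>\<^sub>F y in nhds x. F differentiable (at y) \<and> (\<forall>w. \<bar>frechet_derivative F (at y) w -
        frechet_derivative F (at x) w - D2 F x (y - x) w\<bar> \<le> \<epsilon> * norm (y - x) * norm w)"
    using derivative_first_order_expansion[OF F \<open>\<epsilon> > 0\<close>] F
    by (auto simp: twice_diff_def eventually_conj_iff)
  then obtain r where "r > 0" and r: "\<And>y. norm (y - x) < r \<Longrightarrow> F differentiable (at y) \<and> (\<forall>w. \<bar>frechet_derivative F (at y) w -
        frechet_derivative F (at x) w - D2 F x (y - x) w\<bar> \<le> \<epsilon> * norm (y - x) * norm w)"
    unfolding eventually_nhds_metric dist_norm by blast
  define s where "s = r / (2 * (norm v + norm w + 1))"
  have "s > 0" using \<open>r > 0\<close> by (simp add: s_def add_nonneg_pos)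
  have "s * (norm v + norm w) < s * (2 * (norm v + norm w + 1))"
  proof (rule mult_strict_left_mono[OF _ \<open>s > 0\<close>])
    show "norm v + norm w < 2 * (norm v + norm w + 1)"
      using norm_ge_zero[of v] norm_ge_zero[of w] unfolding distrib_left by linarith
  qed
  also have "2 * (norm v + norm w + 1) > 0"
    using norm_ge_zero[of v] norm_ge_zero[of w] unfolding distrib_left by linarith
  then have "s * (2 * (norm v + norm w + 1)) = r" by (simp add: s_def)
  finally have close: "s * (norm v + norm w) < r" "s * (norm w + norm v) < r" by (auto simp: add.commute)
  let ?\<Delta> = "F (x + s *\<^sub>R v + s *\<^sub>R w) - F (x + s *\<^sub>R v) - F (x + s *\<^sub>R w) + F x"
  have 1: "\<bar>?\<Delta> - s\<^sup>2 * D2 F x w v\<bar> \<le> s\<^sup>2 * (2 * \<epsilon> * M)"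
    unfolding M_def by (rule second_difference_estimate[OF F \<open>s > 0\<close> \<open>\<epsilon> > 0\<close> close(1) r])
  have "\<bar>F (x + s *\<^sub>R w + s *\<^sub>R v) - F (x + s *\<^sub>R w) - F (x + s *\<^sub>R v) + F x - s\<^sup>2 * D2 F x v w\<bar>
     \<le> s\<^sup>2 * (2 * \<epsilon> * (norm w + norm v)\<^sup>2)"
    by (rule second_difference_estimate[OF F \<open>s > 0\<close> \<open>\<epsilon> > 0\<close> close(2) r])
  then have 2: "\<bar>?\<Delta> - s\<^sup>2 * D2 F x v w\<bar> \<le> s\<^sup>2 * (2 * \<epsilon> * M)"
    unfolding M_def by (simp add: algebra_simps)
  have "s\<^sup>2 * \<delta> = \<bar>s\<^sup>2 * D2 F x v w - s\<^sup>2 * D2 F x w v\<bar>"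
    using \<open>s > 0\<close> unfolding \<delta>_def right_diff_distrib[symmetric] by (simp add: abs_mult)
  also have "\<dots> \<le> s\<^sup>2 * (4 * \<epsilon> * M)" using 1 2 by (simp add: algebra_simps abs_le_iff)
  finally have "\<delta> \<le> 4 * \<epsilon> * M" using \<open>s > 0\<close> by simp
  also have "\<dots> < \<delta>"
  proof -
    have "\<delta> * M * 4 < \<delta> * (8 * (M + 1))" unfolding mult.assoc using \<open>\<delta> > 0\<close> \<open>M \<ge> 0\<close>
      by (intro mult_strict_left_mono) auto
    then show ?thesis using \<open>M \<ge> 0\<close> by (simp add: \<epsilon>_def field_simps)
  qed
  finally show False by simp
qed

text \<open>Mean value theorem on the segment from \<open>x\<close>, applied to \<open>F\<close>
  minus its quadratic polynomial; the derivative of that remainder is controlled by the first-order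
  expansion of the derivative.\<close>

lemma second_order_Taylor:
  fixes F :: "'e::euclidean_space \<Rightarrow> real"
  assumes F: "twice_diff F x" and "\<epsilon> > 0"
  shows "\<forall>\<^sub>F y in nhds x. \<bar>F y - F x - frechet_derivative F (at x) (y - x) - D2 F x (y - x) (y - x) / 2\<bar>
     \<le> \<epsilon> * (norm (y - x))\<^sup>2"
proof -
  have "\<forall>\<^sub>F y in nhds x. F differentiable (at y) \<and> (\<forall>w. \<bar>frechet_derivative F (at y) w -
        frechet_derivative F (at x) w - D2 F x (y - x) w\<bar> \<le> \<epsilon> * norm (y - x) * norm w)"
    using derivative_first_order_expansion[OF F \<open>\<epsilon> > 0\<close>] F
    by (auto simp: twice_diff_def eventually_conj_iff)
  then obtain r where "r > 0" and r: "\<And>y. norm (y - x) < r \<Longrightarrow> F differentiable (at y) \<and> (\<forall>w. \<bar>frechet_derivative F (at y) w -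
        frechet_derivative F (at x) w - D2 F x (y - x) w\<bar> \<le> \<epsilon> * norm (y - x) * norm w)"
    unfolding eventually_nhds_metric dist_norm by blast
  show ?thesis
    unfolding eventually_nhds_metric dist_norm
  proof (intro exI[of _ r] conjI allI impI \<open>r > 0\<close>)
    fix z assume z: "norm (z - x) < r"
    define y where "y = z - x"
    define k where "k t = F (x + t *\<^sub>R y) - t * frechet_derivative F (at x) y - t\<^sup>2 * D2 F x y y / 2" for t
    define k' where "k' t = frechet_derivative F (at (x + t *\<^sub>R y)) y - frechet_derivative F (at x) y - t * D2 F x y y" for t
    have cl: "norm (x + t *\<^sub>R y - x) < r" if "0 \<le> t" "t \<le> 1" for t
    proof -
      have "t * norm y \<le> 1 * norm y" using that by (intro mult_right_mono) auto
      then show ?thesis using z that by (simp add: y_def)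
    qed
    have der: "(k has_real_derivative k' t) (at t)" if "0 \<le> t" "t \<le> 1" for t
      unfolding k_def k'_def using r[OF cl[OF that]]
      by (auto intro!: derivative_eq_intros has_derivative_along_line)
    obtain \<xi> where \<xi>: "0 < \<xi>" "\<xi> < 1" "k 1 - k 0 = (1 - 0) * k' \<xi>"
      using MVT2[of 0 1 k k'] der by auto
    have "\<bar>frechet_derivative F (at (x + \<xi> *\<^sub>R y)) y -
        frechet_derivative F (at x) y - D2 F x (x + \<xi> *\<^sub>R y - x) y\<bar> \<le> \<epsilon> * norm (x + \<xi> *\<^sub>R y - x) * norm y"
      using r[OF cl[of \<xi>]] \<xi> by auto
    then have "\<bar>k' \<xi>\<bar> \<le> \<epsilon> * (\<xi> * norm y) * norm y"
      using \<xi> D2_linear(1)[OF F, of y] by (simp add: k'_def linear_cmul[where f = "\<lambda>w. D2 F x w y"])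
    also have "\<dots> \<le> \<epsilon> * (1 * norm y) * norm y"
      using \<xi> \<open>\<epsilon> > 0\<close> by (intro mult_right_mono mult_left_mono) auto
    finally have "\<bar>k 1 - k 0\<bar> \<le> \<epsilon> * (norm y)\<^sup>2" using \<xi> by (simp add: power2_eq_square)
    then show "\<bar>F z - F x - frechet_derivative F (at x) (z - x) - D2 F x (z - x) (z - x) / 2\<bar>
        \<le> \<epsilon> * (norm (z - x))\<^sup>2"
      by (simp add: k_def y_def algebra_simps)
  qed
qed

lemma D2_inner:
  fixes F :: "'e::euclidean_space \<Rightarrow> 'f::euclidean_space"
  assumes F: "twice_diff F x"
  shows "twice_diff (\<lambda>y. F y \<bullet> a) x" and "D2 (\<lambda>y. F y \<bullet> a) x v w = D2 F x v w \<bullet> a"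
proof -
  have der: "((\<lambda>y. F y \<bullet> a) has_derivative (\<lambda>w. frechet_derivative F (at y) w \<bullet> a)) (at y)"
    if "F differentiable (at y)" for y
    using that by (intro has_derivative_inner_left) (simp add: frechet_derivative_works[symmetric])
  have ev0: "\<forall>\<^sub>F y in nhds x. F differentiable (at y)" using F by (simp add: twice_diff_def)
  then have ev: "\<forall>\<^sub>F y in nhds x. frechet_derivative F (at y) w \<bullet> a = frechet_derivative (\<lambda>y. F y \<bullet> a) (at y) w" for w
    by eventually_elim (simp add: frechet_derivative_eqI[OF der])
  have h: "((\<lambda>y. frechet_derivative (\<lambda>y. F y \<bullet> a) (at y) w) has_derivative (\<lambda>v. D2 F x v w \<bullet> a)) (at x)" for w
    by (rule has_derivative_transform_nhds[OF _ ev])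
      (intro has_derivative_inner_left twice_diff_has_derivative F)
  show "twice_diff (\<lambda>y. F y \<bullet> a) x"
    unfolding twice_diff_def using h ev0
    by (auto elim!: eventually_mono intro: differentiableI differentiableI[OF der])
  show "D2 (\<lambda>y. F y \<bullet> a) x v w = D2 F x v w \<bullet> a"
    unfolding D2_def[of "\<lambda>y. F y \<bullet> a"] by (simp add: frechet_derivative_eqI[OF h])
qed

text \<open>The vector-valued case is meant for transition maps; it follows component by
  component.\<close>

lemma D2_symmetric:
  fixes F :: "'e::euclidean_space \<Rightarrow> 'f::euclidean_space"
  assumes F: "twice_diff F x"
  shows "D2 F x v w = D2 F x w v"
  by (rule euclidean_eqI) (metis D2_inner[OF F] D2_symmetric_real)

section \<open>The Hessian of a metric under isometries\<close>

lemma inner_formD: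
  assumes "inner_form b"
  shows "bilinear b" "b v w = b w v" "v \<noteq> 0 \<Longrightarrow> b v v > 0"
  using assms by (auto simp: inner_form_def)

lemma inner_form_eqI:
  assumes b: "inner_form b" and eq: "\<And>z. b u z = b v z"
  shows "u = v"
proof (rule ccontr)
  assume "u \<noteq> v"
  then have "b (u - v) (u - v) > 0" using inner_formD(3)[OF b] by simp
  then show False using eq[of "u - v"] by (simp add: bilinear_lsub[OF inner_formD(1)[OF b]])
qed

text \<open>Riesz representation: by positivity the map \<open>T\<close> from vectors to covectors
  is injective, hence onto in finite dimension, and uniqueness justifies the definite description in
  \<open>sharp\<close>.\<close>

lemma sharp_works:
  fixes b :: "'e::euclidean_space \<Rightarrow> 'e \<Rightarrow> real"
  assumes b: "inner_form b" and L: "linear L"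
  shows "b (sharp b L) z = L z"
proof -
  note bl = inner_formD(1)[OF b]
  define T where "T u = (\<Sum>i\<in>Basis. b u i *\<^sub>R i)" for u
  have T: "T u \<bullet> z = b u z" for u z
  proof -
    have "b u z = b u (\<Sum>i\<in>Basis. (z \<bullet> i) *\<^sub>R i)" by (simp add: euclidean_representation)
    then show ?thesis
      unfolding T_def bilinear_sum_right[OF bl] by (simp add: inner_sum_left inner_commute[of z] mult.commute)
  qed
  have "linear T" unfolding T_def
    by (intro linearI) (auto simp: bilinear_ladd[OF bl] bilinear_lmul[OF bl] sum.distrib scaleR_sum_right algebra_simps)
  moreover have "inj T"
  proof (rule injI)
    fix u v assume "T u = T v"
    then show "u = v" by (intro inner_form_eqI[OF b]) (metis T)
  qed
  ultimately have "surj T" using linear_injective_imp_surjective by blast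
  then obtain u where u: "T u = (\<Sum>i\<in>Basis. L i *\<^sub>R i)" by (metis surjD)
  have uL: "b u z = L z" for z
  proof -
    have "b u z = (\<Sum>i\<in>Basis. L i *\<^sub>R i) \<bullet> z" using T u by metis
    also have "\<dots> = L (\<Sum>i\<in>Basis. (z \<bullet> i) *\<^sub>R i)"
      using L by (simp add: inner_sum_left linear_sum linear_cmul inner_commute[of z] mult.commute)
    finally show ?thesis by (simp add: euclidean_representation)
  qed
  have "sharp b L = u" unfolding sharp_def
    by (rule the_equality) (auto simp: uL intro!: inner_form_eqI[OF b])
  then show ?thesis by (simp add: uL)
qed

lemma sharp_unique:
  assumes b: "inner_form b" and "\<And>z. b u z = L z"
  shows "sharp b L = u"
  unfolding sharp_def by (rule the_equality) (auto simp: assms intro!: inner_form_eqI[OF b])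

text \<open>The inner product property is asked near \<open>x\<close> and not only at
  \<open>x\<close>: bilinearity and symmetry of the derivative of the metric result from
  differentiating these identities in the base point.\<close>

definition metric_at :: "'e::euclidean_space metric_field \<Rightarrow> 'e \<Rightarrow> bool" where
  "metric_at G x \<longleftrightarrow> (\<forall>\<^sub>F y in nhds x. inner_form (G y)) \<and>
     (\<forall>v w. (\<lambda>y. G y v w) differentiable (at x))"

definition metric_deriv :: "'e::euclidean_space metric_field \<Rightarrow> 'e \<Rightarrow> 'e \<Rightarrow> 'e \<Rightarrow> 'e \<Rightarrow> real" where
  "metric_deriv G x z v w = frechet_derivative (\<lambda>y. G y v w) (at x) z"

lemma metric_at_inner_form: "metric_at G x \<Longrightarrow> inner_form (G x)"
  unfolding metric_at_def using eventually_nhds_x_imp_x by blast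

lemma metric_deriv_has_derivative:
  "metric_at G x \<Longrightarrow> ((\<lambda>y. G y v w) has_derivative (\<lambda>z. metric_deriv G x z v w)) (at x)"
  unfolding metric_deriv_def metric_at_def by (metis frechet_derivative_works)

lemma metric_deriv_eqI:
  assumes "metric_at G x" "(f has_derivative f') (at x)" "\<forall>\<^sub>F y in nhds x. f y = G y v w"
  shows "metric_deriv G x z v w = f' z"
  using has_derivative_unique[OF has_derivative_transform_nhds[OF assms(2,3)] metric_deriv_has_derivative[OF assms(1)]]
  by (simp add: fun_eq_iff)

lemma metric_deriv_linear:
  assumes G: "metric_at G x"
  shows "linear (\<lambda>z. metric_deriv G x z v w)" "linear (\<lambda>v. metric_deriv G x z v w)"
    "linear (\<lambda>w. metric_deriv G x z v w)" and "metric_deriv G x z v w = metric_deriv G x z w v"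
proof -
  note h = metric_deriv_has_derivative[OF G]
  show "linear (\<lambda>z. metric_deriv G x z v w)" using h has_derivative_linear by blast
  have ev: "\<forall>\<^sub>F y in nhds x. inner_form (G y)" using G by (simp add: metric_at_def)
  have "metric_deriv G x z (p + q) w = metric_deriv G x z p w + metric_deriv G x z q w" for p q w
    by (rule metric_deriv_eqI[OF G has_derivative_add[OF h h]])
      (use ev in \<open>auto elim!: eventually_mono simp: bilinear_ladd[OF inner_formD(1)]\<close>)
  moreover have "metric_deriv G x z (r *\<^sub>R p) w = r * metric_deriv G x z p w" for p r w
    by (rule metric_deriv_eqI[OF G has_derivative_mult_right[OF h]])
      (use ev in \<open>auto elim!: eventually_mono simp: bilinear_lmul[OF inner_formD(1)]\<close>)
  ultimately show l: "linear (\<lambda>v. metric_deriv G x z v w)" for w by (intro linearI) auto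
  show sym: "metric_deriv G x z v w = metric_deriv G x z w v" for v w
    by (rule metric_deriv_eqI[OF G h])
      (use ev in \<open>auto elim!: eventually_mono intro: inner_formD(2)\<close>)
  show "linear (\<lambda>w. metric_deriv G x z v w)" unfolding sym[of v] by (rule l)
qed

lemmas metric_deriv_simps =
  linear_add[OF metric_deriv_linear(1)] linear_add[OF metric_deriv_linear(2)]
  linear_add[OF metric_deriv_linear(3)] linear_cmul[OF metric_deriv_linear(1)]
  linear_cmul[OF metric_deriv_linear(2)] linear_cmul[OF metric_deriv_linear(3)]

lemma linear_expand:
  fixes L :: "'e::euclidean_space \<Rightarrow> real"
  assumes "linear L"
  shows "L u = (\<Sum>i\<in>Basis. (u \<bullet> i) * L i)"
proof -
  have "L u = L (\<Sum>i\<in>Basis. (u \<bullet> i) *\<^sub>R i)" by (simp add: euclidean_representation)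
  then show ?thesis using assms by (simp add: linear_sum linear_cmul)
qed

lemma linear_functional_representer:
  fixes L :: "'e::euclidean_space \<Rightarrow> real"
  assumes "linear L"
  obtains a where "\<And>v. a \<bullet> v = L v"
proof (rule that)
  show "(\<Sum>i\<in>Basis. L i *\<^sub>R i) \<bullet> v = L v" for v
    unfolding linear_expand[OF assms, of v] by (simp add: inner_sum_left inner_commute[of v] mult.commute)
qed

lemma bilinear_expand:
  fixes b :: "'e::euclidean_space \<Rightarrow> 'e \<Rightarrow> real"
  assumes "bilinear b"
  shows "b v w = (\<Sum>i\<in>Basis. \<Sum>j\<in>Basis. (v \<bullet> i) * (w \<bullet> j) * b i j)"
proof -
  have "b v w = b (\<Sum>i\<in>Basis. (v \<bullet> i) *\<^sub>R i) (\<Sum>j\<in>Basis. (w \<bullet> j) *\<^sub>R j)"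
    by (simp add: euclidean_representation)
  then show ?thesis
    unfolding bilinear_sum_left[OF assms] bilinear_sum_right[OF assms]
    by (subst sum.swap) (simp add: sum_distrib_left mult.assoc mult.left_commute)
qed

lemma eventually_nhds_compose:
  assumes "isCont p x" "\<forall>\<^sub>F y in nhds (p x). P y"
  shows "\<forall>\<^sub>F y in nhds x. P (p y)"
  using assms(2) assms(1)[unfolded isCont_def tendsto_at_iff_tendsto_nhds]
  by (rule eventually_compose_filterlim)

text \<open>The metric is differentiable only for fixed vector arguments, so with moving arguments
  the product rule is applied to the expansion in the basis.\<close>

lemma metric_has_derivative:
  fixes p a c :: "'b::real_normed_vector \<Rightarrow> 'e::euclidean_space"
  assumes G: "metric_at G (p x)" and p: "(p has_derivative p') (at x)"
    and a: "(a has_derivative a') (at x)" and c: "(c has_derivative c') (at x)"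
  shows "((\<lambda>y. G (p y) (a y) (c y)) has_derivative (\<lambda>z. metric_deriv G (p x) (p' z) (a x) (c x)
           + G (p x) (a' z) (c x) + G (p x) (a x) (c' z))) (at x)"
proof -
  let ?md = "metric_deriv G (p x)"
  have Gp: "((\<lambda>y. G (p y) i j) has_derivative (\<lambda>z. ?md (p' z) i j)) (at x)" for i j
    using has_derivative_compose[OF p metric_deriv_has_derivative[OF G]] .
  have bl: "bilinear (G (p x))" using inner_formD(1)[OF metric_at_inner_form[OF G]] .
  have blmd: "bilinear (?md z)" for z using metric_deriv_linear[OF G] by (simp add: bilinear_def)
  have "((\<lambda>y. \<Sum>i\<in>Basis. \<Sum>j\<in>Basis. (a y \<bullet> i) * (c y \<bullet> j) * G (p y) i j) has_derivative
      (\<lambda>z. \<Sum>i\<in>Basis. \<Sum>j\<in>Basis. (a x \<bullet> i) * (c x \<bullet> j) * ?md (p' z) i j +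
         ((a x \<bullet> i) * (c' z \<bullet> j) + (a' z \<bullet> i) * (c x \<bullet> j)) * G (p x) i j)) (at x)"
    by (intro has_derivative_sum has_derivative_mult has_derivative_inner_left a c Gp)
  moreover have "(\<Sum>i\<in>Basis. \<Sum>j\<in>Basis. (a x \<bullet> i) * (c x \<bullet> j) * ?md (p' z) i j +
         ((a x \<bullet> i) * (c' z \<bullet> j) + (a' z \<bullet> i) * (c x \<bullet> j)) * G (p x) i j) =
      ?md (p' z) (a x) (c x) + G (p x) (a' z) (c x) + G (p x) (a x) (c' z)" for z
    unfolding bilinear_expand[OF blmd, of _ "a x" "c x"] bilinear_expand[OF bl, of "a' z" "c x"]
      bilinear_expand[OF bl, of "a x" "c' z"] sum.distrib[symmetric]
    by (intro sum.cong) (auto simp: algebra_simps)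
  ultimately have "((\<lambda>y. \<Sum>i\<in>Basis. \<Sum>j\<in>Basis. (a y \<bullet> i) * (c y \<bullet> j) * G (p y) i j) has_derivative
      (\<lambda>z. ?md (p' z) (a x) (c x) + G (p x) (a' z) (c x) + G (p x) (a x) (c' z))) (at x)" by simp
  moreover have "\<forall>\<^sub>F y in nhds x. inner_form (G (p y))"
    using G eventually_nhds_compose[OF has_derivative_continuous[OF p], of "\<lambda>y. inner_form (G y)"]
    by (simp add: metric_at_def)
  then have "\<forall>\<^sub>F y in nhds x. (\<Sum>i\<in>Basis. \<Sum>j\<in>Basis. (a y \<bullet> i) * (c y \<bullet> j) * G (p y) i j) = G (p y) (a y) (c y)"
    by eventually_elim (simp add: bilinear_expand[OF inner_formD(1), symmetric])
  ultimately show ?thesis by (rule has_derivative_transform_nhds)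
qed

text \<open>The Koszul formula in coordinates. Everything about \<open>christoffel\<close> is
  derived from it by pairing with an arbitrary \<open>z\<close>.\<close>

lemma christoffel_works:
  assumes G: "metric_at G x"
  shows "G x (christoffel G x v w) z =
     (metric_deriv G x v w z + metric_deriv G x w v z - metric_deriv G x z v w) / 2"
proof -
  have "linear (\<lambda>z. (metric_deriv G x v w z + metric_deriv G x w v z - metric_deriv G x z v w) / 2)"
    by (intro linearI) (simp_all add: metric_deriv_simps[OF G] field_simps)
  from sharp_works[OF metric_at_inner_form[OF G] this] show ?thesis
    by (simp add: christoffel_def metric_deriv_def)
qed

lemma christoffel_bilinear:
  assumes G: "metric_at G x"
  shows "bilinear (christoffel G x)" "christoffel G x v w = christoffel G x w v"
proof -
  note b = metric_at_inner_form[OF G]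
  note bl = inner_formD(1)[OF b]
  have add: "christoffel G x (v + v') w = christoffel G x v w + christoffel G x v' w" for v v' w
    by (rule inner_form_eqI[OF b])
      (auto simp: bilinear_ladd[OF bl] christoffel_works[OF G] metric_deriv_simps[OF G] diff_divide_distrib add_divide_distrib)
  have mul: "christoffel G x (r *\<^sub>R v) w = r *\<^sub>R christoffel G x v w" for r v w
    by (rule inner_form_eqI[OF b])
      (auto simp: bilinear_lmul[OF bl] christoffel_works[OF G] metric_deriv_simps[OF G] field_simps)
  show sym: "christoffel G x v w = christoffel G x w v" for v w
    by (rule inner_form_eqI[OF b])
      (simp add: christoffel_works[OF G] metric_deriv_linear(4)[OF G, of _ v w])
  show "bilinear (christoffel G x)"
    unfolding bilinear_def
  proof (intro conjI allI)
    show "linear (\<lambda>v. christoffel G x v w)" for w by (intro linearI add mul)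
    then show "linear (christoffel G x w)" for w by (subst sym[abs_def])
  qed
qed

lemma hessian_eq: "hessian G F x v w = D2 F x v w - frechet_derivative F (at x) (christoffel G x v w)"
  by (simp add: hessian_def D2_def)

lemma hessian_bilinear_symmetric:
  fixes F :: "'e::euclidean_space \<Rightarrow> real"
  assumes G: "metric_at G x" and F: "twice_diff F x"
  shows "bilinear (hessian G F x)" "hessian G F x v w = hessian G F x w v"
proof -
  have "linear (frechet_derivative F (at x))"
    using twice_diff_differentiable[OF F] linear_frechet_derivative by blast
  then show "bilinear (hessian G F x)"
    using D2_bilinear[OF F] christoffel_bilinear(1)[OF G]
    by (auto simp: bilinear_def hessian_eq linear_iff right_diff_distrib)
  show "hessian G F x v w = hessian G F x w v"
    by (simp add: hessian_eq D2_symmetric[OF F, of v w] christoffel_bilinear(2)[OF G, of v w])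
qed

text \<open>The term with \<open>D2 \<sigma>\<close> is the non-tensorial part of the transformation
  of second derivatives; the Christoffel symbols will cancel it. The derivative of \<open>F\<close>
  at \<open>\<sigma> y\<close>, applied to a moving vector, is expanded in the basis before it is
  differentiated.\<close>

lemma twice_diff_compose:
  fixes F :: "'e::euclidean_space \<Rightarrow> real" and \<sigma> :: "'e \<Rightarrow> 'e"
  assumes s: "twice_diff \<sigma> x" and F: "twice_diff F (\<sigma> x)"
  shows "twice_diff (F \<circ> \<sigma>) x"
    and "frechet_derivative (F \<circ> \<sigma>) (at x) w = frechet_derivative F (at (\<sigma> x)) (frechet_derivative \<sigma> (at x) w)"
    and "D2 (F \<circ> \<sigma>) x v w = D2 F (\<sigma> x) (frechet_derivative \<sigma> (at x) v) (frechet_derivative \<sigma> (at x) w)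
           + frechet_derivative F (at (\<sigma> x)) (D2 \<sigma> x v w)"
proof -
  let ?D = "\<lambda>y. frechet_derivative \<sigma> (at y)" and ?F = "\<lambda>y. frechet_derivative F (at y)"
  have ds: "(\<sigma> has_derivative ?D x) (at x)"
    using twice_diff_differentiable[OF s] frechet_derivative_works by blast
  have dF: "F differentiable (at (\<sigma> x))" using twice_diff_differentiable[OF F] .
  have ev: "\<forall>\<^sub>F y in nhds x. \<sigma> differentiable (at y)" "\<forall>\<^sub>F y in nhds x. F differentiable (at (\<sigma> y))"
    using s F eventually_nhds_compose[OF has_derivative_continuous[OF ds], of "\<lambda>y. F differentiable (at y)"]
    by (auto simp: twice_diff_def)
  have comp: "((F \<circ> \<sigma>) has_derivative (\<lambda>w. ?F (\<sigma> y) (?D y w))) (at y)"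
    if "\<sigma> differentiable (at y)" "F differentiable (at (\<sigma> y))" for y
    using that diff_chain_at[of \<sigma> "?D y" y F "?F (\<sigma> y)"]
    by (simp add: frechet_derivative_works[symmetric] o_def)
  show "frechet_derivative (F \<circ> \<sigma>) (at x) w = ?F (\<sigma> x) (?D x w)"
    using frechet_derivative_eqI[OF comp] twice_diff_differentiable[OF s] dF by simp
  have lin: "linear (?F (\<sigma> x))" using dF linear_frechet_derivative by blast
  have h: "((\<lambda>y. frechet_derivative (F \<circ> \<sigma>) (at y) w) has_derivative
      (\<lambda>v. D2 F (\<sigma> x) (?D x v) (?D x w) + ?F (\<sigma> x) (D2 \<sigma> x v w))) (at x)" for w
  proof -
    have F': "((\<lambda>y. ?F (\<sigma> y) i) has_derivative (\<lambda>v. D2 F (\<sigma> x) (?D x v) i)) (at x)" for i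
      using has_derivative_compose[OF ds twice_diff_has_derivative[OF F]] .
    have "((\<lambda>y. \<Sum>i\<in>Basis. (?D y w \<bullet> i) * ?F (\<sigma> y) i) has_derivative
        (\<lambda>v. \<Sum>i\<in>Basis. (?D x w \<bullet> i) * D2 F (\<sigma> x) (?D x v) i + (D2 \<sigma> x v w \<bullet> i) * ?F (\<sigma> x) i)) (at x)"
      by (intro has_derivative_sum has_derivative_mult has_derivative_inner_left F' twice_diff_has_derivative[OF s])
    moreover
    have "(\<Sum>i\<in>Basis. (?D x w \<bullet> i) * D2 F (\<sigma> x) (?D x v) i + (D2 \<sigma> x v w \<bullet> i) * ?F (\<sigma> x) i) =
        D2 F (\<sigma> x) (?D x v) (?D x w) + ?F (\<sigma> x) (D2 \<sigma> x v w)" for v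
      by (simp add: sum.distrib linear_expand[OF D2_linear(2)[OF F], of _ "?D x w"]
          linear_expand[OF lin, of "D2 \<sigma> x v w"])
    moreover have "\<forall>\<^sub>F y in nhds x. (\<Sum>i\<in>Basis. (?D y w \<bullet> i) * ?F (\<sigma> y) i) = frechet_derivative (F \<circ> \<sigma>) (at y) w"
      using ev by eventually_elim
        (simp add: frechet_derivative_eqI[OF comp] linear_expand[OF linear_frechet_derivative, symmetric])
    ultimately show ?thesis by (auto intro: has_derivative_transform_nhds)
  qed
  show "twice_diff (F \<circ> \<sigma>) x" unfolding twice_diff_def
  proof (intro conjI allI)
    show "\<forall>\<^sub>F y in nhds x. (F \<circ> \<sigma>) differentiable (at y)"
      using ev by eventually_elim (auto intro: differentiableI[OF comp])
    show "(\<lambda>y. frechet_derivative (F \<circ> \<sigma>) (at y) w) differentiable (at x)" for w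
      using h by (rule differentiableI)
  qed
  show "D2 (F \<circ> \<sigma>) x v w = D2 F (\<sigma> x) (?D x v) (?D x w) + ?F (\<sigma> x) (D2 \<sigma> x v w)"
    unfolding D2_def[of "F \<circ> \<sigma>"] by (simp add: frechet_derivative_eqI[OF h])
qed

text \<open>The map \<open>\<sigma>\<close> models a transition map, \<open>G\<close> and
  \<open>H\<close> the same metric in the two charts.\<close>

context
  fixes G H :: "'e::euclidean_space metric_field" and F :: "'e \<Rightarrow> real" and \<sigma> :: "'e \<Rightarrow> 'e" and x :: 'e
  assumes G: "metric_at G x" and H: "metric_at H (\<sigma> x)"
    and s: "twice_diff \<sigma> x" and F: "twice_diff F (\<sigma> x)"
    and iso: "\<forall>\<^sub>F y in nhds x. \<forall>v w. G y v w =
       H (\<sigma> y) (frechet_derivative \<sigma> (at y) v) (frechet_derivative \<sigma> (at y) w)"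
begin

text \<open>Positivity of \<open>G\<close> makes the derivative of \<open>\<sigma>\<close>
  injective, hence onto, so every test vector at \<open>\<sigma> x\<close> is the image of a vector
  at \<open>x\<close>.\<close>

lemma isometry_bij:
  shows "linear (frechet_derivative \<sigma> (at x))" "surj (frechet_derivative \<sigma> (at x))"
    and "G x v w = H (\<sigma> x) (frechet_derivative \<sigma> (at x) v) (frechet_derivative \<sigma> (at x) w)"
proof -
  let ?D = "frechet_derivative \<sigma> (at x)"
  show lin: "linear ?D" using twice_diff_differentiable[OF s] linear_frechet_derivative by blast
  show eq: "G x v w = H (\<sigma> x) (?D v) (?D w)" for v w
    using eventually_nhds_x_imp_x[OF iso] by blast
  have "v = 0" if "?D v = 0" for v
  proof (rule ccontr)
    assume "v \<noteq> 0"
    then have "G x v v > 0" using inner_formD(3)[OF metric_at_inner_form[OF G]] by blast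
    moreover have "G x v v = 0"
      using that bilinear_lzero[OF inner_formD(1)[OF metric_at_inner_form[OF H]]] by (simp add: eq)
    ultimately show False by simp
  qed
  then have "inj ?D" using lin linear_injective_0 by blast
  then show "surj ?D" using lin linear_injective_imp_surjective by blast
qed

text \<open>Differentiating the isometry relation gives six terms with \<open>D2 \<sigma>\<close> in
  the Koszul formula. By symmetry of \<open>D2 \<sigma>\<close> four of them cancel and the other
  two coincide, which produces the inhomogeneous term.\<close>

lemma christoffel_isometry:
  "frechet_derivative \<sigma> (at x) (christoffel G x v w) =
   christoffel H (\<sigma> x) (frechet_derivative \<sigma> (at x) v) (frechet_derivative \<sigma> (at x) w) + D2 \<sigma> x v w"
proof (rule inner_form_eqI[OF metric_at_inner_form[OF H]])
  let ?D = "frechet_derivative \<sigma> (at x)" and ?H = "H (\<sigma> x)"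
  fix z' obtain z where z: "z' = ?D z" using isometry_bij(2) by (metis surjD)
  have ds: "(\<sigma> has_derivative ?D) (at x)"
    using twice_diff_differentiable[OF s] frechet_derivative_works by blast
  have ev: "\<forall>\<^sub>F y in nhds x. H (\<sigma> y) (frechet_derivative \<sigma> (at y) v) (frechet_derivative \<sigma> (at y) w) = G y v w" for v w
    using iso by eventually_elim simp
  have md: "metric_deriv G x z v w = metric_deriv H (\<sigma> x) (?D z) (?D v) (?D w)
      + ?H (D2 \<sigma> x z v) (?D w) + ?H (?D v) (D2 \<sigma> x z w)" for z v w
    by (rule metric_deriv_eqI[OF G metric_has_derivative[OF H ds twice_diff_has_derivative[OF s]
            twice_diff_has_derivative[OF s]] ev])
  note sym = inner_formD(2)[OF metric_at_inner_form[OF H]]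
  have "?H (?D (christoffel G x v w)) z' = G x (christoffel G x v w) z" by (simp add: z isometry_bij(3))
  also have "\<dots> = ?H (christoffel H (\<sigma> x) (?D v) (?D w)) z' + ?H (D2 \<sigma> x v w) z'"
    unfolding christoffel_works[OF G] christoffel_works[OF H] md z
    using D2_symmetric[OF s, of v w] D2_symmetric[OF s, of v z] D2_symmetric[OF s, of w z]
      sym[of "?D w"  "D2 \<sigma> x z v"] sym[of "?D v"  "D2 \<sigma> x z w"]
    by (simp add: field_simps)
  also have "\<dots> = ?H (christoffel H (\<sigma> x) (?D v) (?D w) + D2 \<sigma> x v w) z'"
    by (simp add: bilinear_ladd[OF inner_formD(1)[OF metric_at_inner_form[OF H]]])
  finally show "?H (?D (christoffel G x v w)) z' = \<dots>" .
qed

text \<open>The inhomogeneous terms of the second derivative and of the Christoffel symbols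
  cancel.\<close>

lemma hessian_isometry:
  "hessian G (F \<circ> \<sigma>) x v w = hessian H F (\<sigma> x) (frechet_derivative \<sigma> (at x) v) (frechet_derivative \<sigma> (at x) w)"
proof -
  have "linear (frechet_derivative F (at (\<sigma> x)))"
    using twice_diff_differentiable[OF F] linear_frechet_derivative by blast
  then show ?thesis
    unfolding hessian_eq twice_diff_compose[OF s F] christoffel_isometry by (simp add: linear_add)
qed

lemma deriv_norm_isometry: "deriv_norm G (F \<circ> \<sigma>) x = deriv_norm H F (\<sigma> x)"
proof -
  let ?D = "frechet_derivative \<sigma> (at x)" and ?u = "sharp (G x) (frechet_derivative (F \<circ> \<sigma>) (at x))"
  have "linear (frechet_derivative (F \<circ> \<sigma>) (at x))"
    using twice_diff_differentiable[OF twice_diff_compose(1)[OF s F]] linear_frechet_derivative by blast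
  note u = sharp_works[OF metric_at_inner_form[OF G] this]
  have "sharp (H (\<sigma> x)) (frechet_derivative F (at (\<sigma> x))) = ?D ?u"
  proof (rule sharp_unique[OF metric_at_inner_form[OF H]])
    fix z' obtain z where z: "z' = ?D z" using isometry_bij(2) by (metis surjD)
    show "H (\<sigma> x) (?D ?u) z' = frechet_derivative F (at (\<sigma> x)) z'"
      using u[of z] by (simp add: z isometry_bij(3)[symmetric] twice_diff_compose(2)[OF s F])
  qed
  then show ?thesis by (simp add: deriv_norm_def isometry_bij(3) Let_def)
qed

end

section \<open>Sublevel sets of regular functions\<close>

text \<open>Since \<open>h\<close> is of first order at \<open>x\<close>, the oscillation of
  \<open>k\<close> only contributes a factor that tends to zero. This lets a merely continuous
  factor enter a differentiable product.\<close>

lemma has_derivative_mult_vanishing: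
  fixes h k :: "'e::real_normed_vector \<Rightarrow> real"
  assumes h: "(h has_derivative h') (at x)" "h x = 0" and k: "isCont k x"
  shows "((\<lambda>y. k y * h y) has_derivative (\<lambda>v. k x * h' v)) (at x)"
proof -
  have bl: "bounded_linear h'" using h(1) by (rule has_derivative_bounded_linear)
  then obtain B where B: "B > 0" "\<And>v. norm (h' v) \<le> norm v * B"
    using bounded_linear.pos_bounded by blast
  have "((\<lambda>y. (k y - k x) * h y) has_derivative (\<lambda>v. 0)) (at x)"
    unfolding has_derivative_at_alt
  proof (intro conjI allI impI)
    fix e :: real assume "e > 0"
    define e' where "e' = e / (B + 1)"
    have "e' > 0" using \<open>e > 0\<close> B(1) by (simp add: e'_def)
    obtain d1 where d1: "d1 > 0" "\<And>y. dist y x < d1 \<Longrightarrow> dist (k y) (k x) < e'"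
      using k \<open>e' > 0\<close> unfolding continuous_at_eps_delta by blast
    obtain d2 where d2: "d2 > 0" "\<And>y. norm (y - x) < d2 \<Longrightarrow> norm (h y - h x - h' (y - x)) \<le> 1 * norm (y - x)"
      using h(1) unfolding has_derivative_at_alt by (meson zero_less_one)
    show "\<exists>d>0. \<forall>y. norm (y - x) < d \<longrightarrow>
        norm ((k y - k x) * h y - (k x - k x) * h x - 0) \<le> e * norm (y - x)"
    proof (intro exI[of _ "min d1 d2"] conjI allI impI)
      fix y assume y: "norm (y - x) < min d1 d2"
      have "\<bar>h y\<bar> \<le> (B + 1) * norm (y - x)"
        using d2(2)[of y] y B(2)[of "y - x"] h(2) by (simp add: algebra_simps)
      moreover have "\<bar>k y - k x\<bar> \<le> e'"
        using d1(2)[of y] y by (simp add: dist_norm)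
      ultimately have "\<bar>k y - k x\<bar> * \<bar>h y\<bar> \<le> e' * ((B + 1) * norm (y - x))"
        using \<open>e' > 0\<close> by (intro mult_mono) auto
      also have "\<dots> = e * norm (y - x)" using B(1) by (simp add: e'_def)
      finally show "norm ((k y - k x) * h y - (k x - k x) * h x - 0) \<le> e * norm (y - x)"
        by (simp add: abs_mult)
    qed (use d1 d2 in auto)
  qed simp
  from has_derivative_add[OF has_derivative_mult_right[OF h(1), of "k x"] this] show ?thesis
    by (simp add: algebra_simps)
qed

section \<open>Regularity of the gradient for a metric that is only differentiable\<close>

lemma bilinear_abs_le:
  fixes b :: "'e::euclidean_space \<Rightarrow> 'e \<Rightarrow> real"
  assumes "bilinear b"
  shows "\<bar>b v w\<bar> \<le> (\<Sum>i\<in>Basis. \<Sum>j\<in>Basis. \<bar>b i j\<bar>) * norm v * norm w"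
proof -
  have "\<bar>b v w\<bar> \<le> (\<Sum>i\<in>Basis. \<Sum>j\<in>Basis. \<bar>(v \<bullet> i) * (w \<bullet> j) * b i j\<bar>)"
    unfolding bilinear_expand[OF assms, of v w]
    by (intro order_trans[OF sum_abs] sum_mono sum_abs)
  also have "\<dots> \<le> (\<Sum>i\<in>Basis. \<Sum>j\<in>Basis. norm v * norm w * \<bar>b i j\<bar>)"
    unfolding abs_mult by (intro sum_mono mult_mono Basis_le_norm) auto
  also have "\<dots> = (\<Sum>i\<in>Basis. \<Sum>j\<in>Basis. \<bar>b i j\<bar>) * norm v * norm w"
    by (simp add: sum_distrib_left sum_distrib_right mult.commute mult.left_commute)
  finally show ?thesis .
qed

lemma linear_abs_le:
  fixes L :: "'e::euclidean_space \<Rightarrow> real"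
  assumes "linear L"
  shows "\<bar>L v\<bar> \<le> (\<Sum>i\<in>Basis. \<bar>L i\<bar>) * norm v"
proof -
  have "\<bar>L v\<bar> \<le> (\<Sum>i\<in>Basis. \<bar>(v \<bullet> i) * L i\<bar>)"
    unfolding linear_expand[OF assms, of v] by (rule sum_abs)
  also have "\<dots> \<le> (\<Sum>i\<in>Basis. norm v * \<bar>L i\<bar>)"
    unfolding abs_mult by (intro sum_mono mult_mono Basis_le_norm) auto
  finally show ?thesis by (simp add: sum_distrib_left mult.commute)
qed

lemma isCont_tendsto_nhds: "isCont f x \<Longrightarrow> (f \<longlongrightarrow> f x) (nhds x)"
  by (simp add: isCont_def tendsto_at_iff_tendsto_nhds)

text \<open>Continuity of the finitely many matrix entries keeps \<open>G y\<close> within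
  \<open>c / 2\<close> of \<open>G x\<close>, so half of the coercivity constant at \<open>x\<close>
  survives nearby.\<close>

lemma metric_uniform_lower_bound:
  fixes G :: "'e::euclidean_space metric_field"
  assumes G: "\<forall>\<^sub>F y in nhds x. inner_form (G y)" "\<And>v w. isCont (\<lambda>y. G y v w) x"
  obtains c where "c > 0" "\<forall>\<^sub>F y in nhds x. \<forall>v. c * (norm v)\<^sup>2 \<le> G y v v"
proof -
  have Gx: "inner_form (G x)" using eventually_nhds_x_imp_x[OF G(1)] .
  obtain c where c: "c > 0" "\<And>v. c * (norm v)\<^sup>2 \<le> G x v v" using inner_form_lower_bound[OF Gx] by metis
  have "((\<lambda>y. \<Sum>i\<in>Basis. \<Sum>j\<in>Basis. \<bar>G y i j - G x i j\<bar>) \<longlongrightarrow> (\<Sum>i\<in>(Basis::'e set). \<Sum>j\<in>(Basis::'e set). \<bar>G x i j - G x i j\<bar>)) (nhds x)"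
    by (intro tendsto_intros isCont_tendsto_nhds[OF G(2)])
  then have "\<forall>\<^sub>F y in nhds x. (\<Sum>i\<in>Basis. \<Sum>j\<in>Basis. \<bar>G y i j - G x i j\<bar>) < c / 2"
    using c(1) by (intro order_tendstoD) auto
  with G(1) have "\<forall>\<^sub>F y in nhds x. \<forall>v. c / 2 * (norm v)\<^sup>2 \<le> G y v v"
  proof eventually_elim
    case (elim y)
    have bl: "bilinear (\<lambda>v w. 1 * G y v w + (-1) * G x v w)"
      by (intro bilinear_combination inner_formD(1) elim Gx)
    show ?case
    proof
      fix v
      have "\<bar>G y v v - G x v v\<bar> \<le> (\<Sum>i\<in>Basis. \<Sum>j\<in>Basis. \<bar>G y i j - G x i j\<bar>) * norm v * norm v"
        using bilinear_abs_le[OF bl, of v v] by simp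
      also have "\<dots> \<le> c / 2 * norm v * norm v"
        using elim(2) by (intro mult_right_mono) auto
      finally show "c / 2 * (norm v)\<^sup>2 \<le> G y v v" 
        using c(2)[of v] unfolding power2_eq_square mult.assoc by linarith
    qed
  qed
  then show thesis using that[of "c / 2"] c(1) by simp
qed

lemma metric_at_isCont:
  assumes "metric_at G x"
  shows "isCont (\<lambda>y. G y v w) x"
  using metric_deriv_has_derivative[OF assms] by (rule has_derivative_continuous)

text \<open>A bootstrap in place of a formula for the inverse matrix: \<open>u y\<close> is first
  bounded by coercivity, then continuous, then differentiable, each time from
  \<open>G x (u y) z = L y z - R y z\<close>.\<close>

lemma sharp_differentiable:
  fixes G :: "'e::euclidean_space metric_field"
  assumes G: "metric_at G x" and L: "\<forall>\<^sub>F y in nhds x. linear (L y)" "\<And>z. (\<lambda>y. L y z) differentiable (at x)"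
  shows "(\<lambda>y. sharp (G y) (L y)) differentiable (at x)"
proof -
  define u where "u y = sharp (G y) (L y)" for y
  have ev: "\<forall>\<^sub>F y in nhds x. inner_form (G y)" using G by (simp add: metric_at_def)
  note Gx = metric_at_inner_form[OF G]
  note blx = inner_formD(1)[OF Gx]
  have Lx: "linear (L x)" using eventually_nhds_x_imp_x[OF L(1)] .
  have contL: "((\<lambda>y. L y z) \<longlongrightarrow> L x z) (nhds x)" for z
    by (intro isCont_tendsto_nhds differentiable_imp_continuous_within L(2))
  have contG: "((\<lambda>y. G y v w) \<longlongrightarrow> G x v w) (nhds x)" for v w
    by (intro isCont_tendsto_nhds metric_at_isCont G)
  obtain c where c: "c > 0" "\<forall>\<^sub>F y in nhds x. \<forall>v. c * (norm v)\<^sup>2 \<le> G y v v"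
    using metric_uniform_lower_bound[OF ev metric_at_isCont[OF G]] by metis
  define M where "M = (\<Sum>i\<in>Basis. \<bar>L x i\<bar>) + 1"
  have "((\<lambda>y. \<Sum>i\<in>Basis. \<bar>L y i\<bar>) \<longlongrightarrow> (\<Sum>i\<in>Basis. \<bar>L x i\<bar>)) (nhds x)"
    by (intro tendsto_intros contL)
  then have evM: "\<forall>\<^sub>F y in nhds x. (\<Sum>i\<in>Basis. \<bar>L y i\<bar>) < M"
    by (rule order_tendstoD) (simp add: M_def)
  have uL: "\<forall>\<^sub>F y in nhds x. inner_form (G y) \<and> (\<forall>z. G y (u y) z = L y z)"
    using ev L(1) by eventually_elim (simp add: u_def sharp_works)
  have bound: "\<forall>\<^sub>F y in nhds x. norm (u y) \<le> M / c"
    using c(2) evM uL L(1)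
  proof eventually_elim
    case (elim y)
    have "c * (norm (u y))\<^sup>2 \<le> L y (u y)" using elim by metis
    also have "\<dots> \<le> (\<Sum>i\<in>Basis. \<bar>L y i\<bar>) * norm (u y)" using linear_abs_le[OF elim(4), of "u y"] by simp
    also have "\<dots> \<le> M * norm (u y)" using elim(2) by (intro mult_right_mono) auto
    finally have "norm (u y) * (c * norm (u y)) \<le> norm (u y) * M" by (simp add: power2_eq_square algebra_simps)
    moreover have "M \<ge> 0" by (simp add: M_def add_nonneg_nonneg sum_nonneg)
    ultimately have "c * norm (u y) \<le> M" by (cases "u y = 0") auto
    then show ?case using c(1) by (simp add: field_simps)
  qed
  \<comment> \<open>The error of pairing with \<open>G x\<close> instead of \<open>G y\<close>; it
    tends to zero as soon as \<open>u\<close> is bounded.\<close>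
  define R where "R y z = (\<Sum>i\<in>Basis. (u y \<bullet> i) * (G y i z - G x i z))" for y z
  have key: "\<forall>\<^sub>F y in nhds x. L y z - R y z = G x (u y) z" for z
    using uL
  proof eventually_elim
    case (elim y)
    have bl: "bilinear (\<lambda>v w. 1 * G y v w + (-1) * G x v w)"
      using elim by (intro bilinear_combination inner_formD(1) Gx) auto
    have "linear (\<lambda>v. G y v z - G x v z)" using bl by (simp add: bilinear_def)
    from linear_expand[OF this, of "u y"] show ?case using elim by (simp add: R_def)
  qed
  have sx: "G x (sharp (G x) (\<lambda>w. z \<bullet> w)) w = z \<bullet> w" for z w
    by (rule sharp_works[OF Gx]) (intro linearI, auto simp: inner_simps)
  \<comment> \<open>A vector depends linearly on its pairings with the basis under
    \<open>G x\<close>, so regularity of these numbers passes to \<open>u\<close>.\<close>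
  have rep: "(\<Sum>z\<in>Basis. G x v z *\<^sub>R sharp (G x) (\<lambda>w. z \<bullet> w)) = v" for v
  proof (rule inner_form_eqI[OF Gx])
    fix w
    have "G x (\<Sum>z\<in>Basis. G x v z *\<^sub>R sharp (G x) (\<lambda>w. z \<bullet> w)) w = (\<Sum>z\<in>Basis. (w \<bullet> z) * G x v z)"
      by (simp add: bilinear_sum_left[OF blx] sx inner_commute[of w] mult.commute)
    also have "\<dots> = G x v w"
      using linear_expand[of "G x v" w] blx by (simp add: bilinear_def)
    finally show "G x (\<Sum>z\<in>Basis. G x v z *\<^sub>R sharp (G x) (\<lambda>w. z \<bullet> w)) w = G x v w" .
  qed
  have "((\<lambda>y. R y z) \<longlongrightarrow> 0) (nhds x)" for z
  proof -
    have "((\<lambda>y. \<Sum>i\<in>Basis. \<bar>G y i z - G x i z\<bar>) \<longlongrightarrow> (\<Sum>i\<in>Basis. \<bar>G x i z - G x i z\<bar>)) (nhds x)"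
      by (intro tendsto_intros contG)
    then have "((\<lambda>y. \<Sum>i\<in>Basis. \<bar>G y i z - G x i z\<bar>) \<longlongrightarrow> 0) (nhds x)" by simp
    moreover have "\<forall>\<^sub>F y in nhds x. norm (R y z) \<le> norm (\<Sum>i\<in>Basis. \<bar>G y i z - G x i z\<bar>) * (M / c)"
      using bound
    proof eventually_elim
      case (elim y)
      have "norm (R y z) \<le> (\<Sum>i\<in>(Basis::'e set). (M / c) * \<bar>G y i z - G x i z\<bar>)"
        unfolding R_def
      proof (rule sum_norm_le)
        fix i :: 'e assume "i \<in> Basis"
        then have "\<bar>u y \<bullet> i\<bar> \<le> M / c" using Basis_le_norm[of i "u y"] elim by simp
        then show "norm ((u y \<bullet> i) * (G y i z - G x i z)) \<le> M / c * \<bar>G y i z - G x i z\<bar>"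
          unfolding real_norm_def abs_mult by (intro mult_right_mono) auto
      qed
      also have "\<dots> = norm (\<Sum>i\<in>(Basis::'e set). \<bar>G y i z - G x i z\<bar>) * (M / c)"
        by (simp add: sum_distrib_left sum_nonneg abs_of_nonneg mult.commute)
      finally show ?case .
    qed
    ultimately show ?thesis by (rule tendsto_0_le)
  qed
  then have "((\<lambda>y. L y z - R y z) \<longlongrightarrow> L x z - 0) (nhds x)" for z
    by (intro tendsto_diff contL)
  then have "((\<lambda>y. G x (u y) z) \<longlongrightarrow> L x z) (nhds x)" for z
    using Lim_transform_eventually[OF _ key] by fastforce
  moreover have "L x z = G x (u x) z" for z using eventually_nhds_x_imp_x[OF uL] by simp
  ultimately have "((\<lambda>y. \<Sum>z\<in>Basis. G x (u y) z *\<^sub>R sharp (G x) (\<lambda>w. z \<bullet> w)) \<longlongrightarrow>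
      (\<Sum>z\<in>Basis. G x (u x) z *\<^sub>R sharp (G x) (\<lambda>w. z \<bullet> w))) (nhds x)"
    by (intro tendsto_intros) auto
  then have contu: "isCont u x" by (simp add: rep isCont_def tendsto_at_iff_tendsto_nhds)
  have "(\<lambda>y. G x (u y) z) differentiable (at x)" for z
  proof -
    \<comment> \<open>At this stage \<open>u\<close> is only continuous; its cofactors
      \<open>G y i z - G x i z\<close> vanish at \<open>x\<close>, which is enough.\<close>
    have "((\<lambda>y. R y z) has_derivative (\<lambda>v. \<Sum>i\<in>Basis. (u x \<bullet> i) * (metric_deriv G x v i z - 0))) (at x)"
      unfolding R_def
      by (intro has_derivative_sum has_derivative_mult_vanishing has_derivative_diff
          metric_deriv_has_derivative[OF G] has_derivative_const continuous_intros contu) auto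
    moreover have "((\<lambda>y. L y z) has_derivative frechet_derivative (\<lambda>y. L y z) (at x)) (at x)"
      using L(2) frechet_derivative_works by blast
    ultimately show ?thesis
      using has_derivative_transform_nhds[OF has_derivative_diff key] differentiableI by blast
  qed
  then have "(\<lambda>y. \<Sum>z\<in>Basis. G x (u y) z *\<^sub>R sharp (G x) (\<lambda>w. z \<bullet> w)) differentiable (at x)"
    by (intro derivative_intros) auto
  then show ?thesis by (simp add: rep u_def[abs_def])
qed

text \<open>The transversal coordinate of the curve at time \<open>t\<close> is a root of minimal modulus.  It is then
  \<open>o(t)\<close>, so differentiability of \<open>U\<close> at the single point \<open>y\<close> suffices.\<close>

lemma implicit_curve:
  fixes U :: "'e::euclidean_space \<Rightarrow> real"
  assumes U: "(U has_derivative L) (at y)" and cont: "continuous_on W U" and W: "open W" "y \<in> W"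
    and "U y = 0" "L v = 0" "L n > 0"
  obtains \<gamma> \<epsilon> where "\<gamma> 0 = y" "\<epsilon> > 0" "\<And>t. \<bar>t\<bar> < \<epsilon> \<Longrightarrow> \<gamma> t \<in> W \<and> U (\<gamma> t) = 0"
    "(\<gamma> has_vector_derivative v) (at 0)"
proof -
  have lin: "linear L" using U has_derivative_linear by blast
  define c where "c = norm v + norm n + 1"
  have "c > 0" using norm_ge_zero[of v] norm_ge_zero[of n] unfolding c_def by linarith
  obtain r where r: "r > 0" "ball y r \<subseteq> W" using W openE by blast
  let ?z = "\<lambda>t s. y + t *\<^sub>R v + s *\<^sub>R n"
  have zy: "norm (?z t s - y) \<le> c * \<bar>t\<bar>" if "\<bar>s\<bar> \<le> \<bar>t\<bar>" for t s
  proof -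
    have "norm (?z t s - y) \<le> \<bar>t\<bar> * norm v + \<bar>s\<bar> * norm n"
      using norm_triangle_ineq[of "t *\<^sub>R v" "s *\<^sub>R n"] by (simp add: add.assoc)
    also have "\<dots> \<le> \<bar>t\<bar> * norm v + \<bar>t\<bar> * norm n" using that by (intro add_left_mono mult_right_mono) auto
    finally show ?thesis by (simp add: c_def algebra_simps)
  qed
  have inW: "?z t s \<in> W" if "\<bar>s\<bar> \<le> \<bar>t\<bar>" "\<bar>t\<bar> < r / c" for t s
  proof -
    have "c * \<bar>t\<bar> < r" using that(2) \<open>c > 0\<close> by (simp add: field_simps)
    then have "dist (?z t s) y < r" unfolding dist_norm using zy[OF that(1)] by linarith
    then have "dist y (?z t s) < r" by (simp only: dist_commute)
    then show ?thesis using r by auto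
  qed
  have contz: "continuous_on {-\<bar>t\<bar>..\<bar>t\<bar>} (\<lambda>s. U (?z t s))" if "\<bar>t\<bar> < r / c" for t
    by (rule continuous_on_compose2[OF cont]) (use inW that in \<open>auto intro!: continuous_intros\<close>)
  have zero: "\<exists>\<delta>>0. \<forall>t. \<bar>t\<bar> < \<delta> \<longrightarrow> (\<exists>s. \<bar>s\<bar> \<le> e * \<bar>t\<bar> \<and> U (?z t s) = 0)" if "e > 0" "e \<le> 1" for e
  proof -
    \<comment> \<open>With this tolerance the linearisation error at distance at most
      \<open>c * \<bar>t\<bar>\<close> is at most \<open>e * \<bar>t\<bar> * L n\<close>, just the
      size of the linear term at \<open>s = e * \<bar>t\<bar>\<close> and at its negative. So
      \<open>U\<close> has opposite weak signs there and the intermediate value theorem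
      applies.\<close>
    have "e * L n / c > 0" using that \<open>c > 0\<close> assms(7) by simp
    then obtain d where d: "d > 0" "\<And>z. norm (z - y) < d \<Longrightarrow> norm (U z - U y - L (z - y)) \<le> e * L n / c * norm (z - y)"
      using U unfolding has_derivative_at_alt by blast
    show ?thesis
    proof (rule exI[of _ "min (r / c) (d / c)"], intro conjI allI impI)
      show "min (r / c) (d / c) > 0" using r d \<open>c > 0\<close> by simp
      fix t :: real assume t: "\<bar>t\<bar> < min (r / c) (d / c)"
      have et: "e * \<bar>t\<bar> \<le> \<bar>t\<bar>" "0 \<le> e * \<bar>t\<bar>" using that by (auto intro: mult_left_le_one_le)
      have est: "\<bar>U (?z t s) - s * L n\<bar> \<le> e * \<bar>t\<bar> * L n" if s: "\<bar>s\<bar> \<le> \<bar>t\<bar>" for s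
      proof -
        have "c * \<bar>t\<bar> < d" using t \<open>c > 0\<close> by (simp add: field_simps)
        then have "norm (?z t s - y) < d" using zy[OF s] by simp
        from d(2)[OF this] have "\<bar>U (?z t s) - L (t *\<^sub>R v + s *\<^sub>R n)\<bar> \<le> e * L n / c * norm (?z t s - y)"
          using \<open>U y = 0\<close> by (simp add: add.assoc)
        also have "\<dots> \<le> e * L n / c * (c * \<bar>t\<bar>)"
          using zy[OF s] \<open>e * L n / c > 0\<close> by (intro mult_left_mono) auto
        also have "L (t *\<^sub>R v + s *\<^sub>R n) = s * L n" using lin \<open>L v = 0\<close> by (simp add: linear_add linear_cmul)
        finally show ?thesis using \<open>c > 0\<close> by (simp add: algebra_simps)
      qed
      have "U (?z t (- (e * \<bar>t\<bar>))) \<le> 0" "0 \<le> U (?z t (e * \<bar>t\<bar>))"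
        using est[of "- (e * \<bar>t\<bar>)"] est[of "e * \<bar>t\<bar>"] et by (auto simp: abs_le_iff)
      moreover have "continuous_on {- (e * \<bar>t\<bar>)..e * \<bar>t\<bar>} (\<lambda>s. U (?z t s))"
        using contz[of t] t et by (intro continuous_on_subset[OF contz]) auto
      ultimately obtain s where "- (e * \<bar>t\<bar>) \<le> s" "s \<le> e * \<bar>t\<bar>" "U (?z t s) = 0"
        using IVT'[of "\<lambda>s. U (?z t s)" "- (e * \<bar>t\<bar>)" 0 "e * \<bar>t\<bar>"] et by auto
      then show "\<exists>s. \<bar>s\<bar> \<le> e * \<bar>t\<bar> \<and> U (?z t s) = 0" by (intro exI[of _ s]) auto
    qed
  qed
  have "\<exists>\<delta>>0. \<forall>t. \<bar>t\<bar> < \<delta> \<longrightarrow> (\<exists>s. \<bar>s\<bar> \<le> \<bar>t\<bar> \<and> U (?z t s) = 0)"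
    using zero[of 1] by simp
  then obtain \<delta>1 where \<delta>1: "\<delta>1 > 0" "\<And>t. \<bar>t\<bar> < \<delta>1 \<Longrightarrow> \<exists>s. \<bar>s\<bar> \<le> \<bar>t\<bar> \<and> U (?z t s) = 0"
    by blast
  define \<epsilon> where "\<epsilon> = min \<delta>1 (r / c)"
  have "\<epsilon> > 0" using \<delta>1 r \<open>c > 0\<close> by (simp add: \<epsilon>_def)
  have "\<exists>s. \<bar>s\<bar> \<le> \<bar>t\<bar> \<and> U (?z t s) = 0 \<and> (\<forall>s'. \<bar>s'\<bar> \<le> \<bar>t\<bar> \<and> U (?z t s') = 0 \<longrightarrow> \<bar>s\<bar> \<le> \<bar>s'\<bar>)"
    if t: "\<bar>t\<bar> < \<epsilon>" for t
  proof -
    let ?K = "{s \<in> {-\<bar>t\<bar>..\<bar>t\<bar>}. U (?z t s) = 0}"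
    have "closed ?K" using t by (intro continuous_closed_preimage_constant contz) (auto simp: \<epsilon>_def)
    moreover have "bounded ?K" by (rule bounded_subset[OF bounded_closed_interval]) auto
    ultimately have "compact ?K" by (simp add: compact_eq_bounded_closed)
    moreover have "?K \<noteq> {}" using \<delta>1(2)[of t] t by (auto simp: \<epsilon>_def abs_le_iff minus_le_iff)
    moreover have "continuous_on ?K (\<lambda>s. \<bar>s\<bar>)" by (intro continuous_intros)
    ultimately obtain s where "s \<in> ?K" "\<And>s'. s' \<in> ?K \<Longrightarrow> \<bar>s\<bar> \<le> \<bar>s'\<bar>"
      using continuous_attains_inf[of ?K "\<lambda>s. \<bar>s\<bar>"] by blast
    then show ?thesis by (intro exI[of _ s]) (auto simp: abs_le_iff minus_le_iff)
  qed
  then obtain s where s: "\<And>t. \<bar>t\<bar> < \<epsilon> \<Longrightarrow> \<bar>s t\<bar> \<le> \<bar>t\<bar> \<and> U (?z t (s t)) = 0 \<and>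
      (\<forall>s'. \<bar>s'\<bar> \<le> \<bar>t\<bar> \<and> U (?z t s') = 0 \<longrightarrow> \<bar>s t\<bar> \<le> \<bar>s'\<bar>)" by metis
  have s0: "s 0 = 0" using s[of 0] \<open>\<epsilon> > 0\<close> by simp
  show thesis
  proof (rule that[of "\<lambda>t. ?z t (s t)" \<epsilon>])
    show "?z 0 (s 0) = y" by (simp add: s0)
    show "?z t (s t) \<in> W \<and> U (?z t (s t)) = 0" if "\<bar>t\<bar> < \<epsilon>" for t
      using s[OF that] inW[of "s t" t] that by (auto simp: \<epsilon>_def)
    show "((\<lambda>t. ?z t (s t)) has_vector_derivative v) (at 0)"
      unfolding has_vector_derivative_def has_derivative_at_alt
    proof (intro conjI allI impI)
      show "bounded_linear (\<lambda>t. t *\<^sub>R v)" by (rule bounded_linear_scaleR_left)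
      fix e :: real assume "e > 0"
      define e' where "e' = min 1 (e / c)"
      have e': "e' > 0" "e' \<le> 1" "e' * c \<le> e" using \<open>e > 0\<close> \<open>c > 0\<close> by (auto simp: e'_def min_def field_simps)
      obtain \<delta> where \<delta>: "\<delta> > 0" "\<And>t. \<bar>t\<bar> < \<delta> \<Longrightarrow> \<exists>s. \<bar>s\<bar> \<le> e' * \<bar>t\<bar> \<and> U (?z t s) = 0"
        using zero[OF e'(1,2)] by blast
      show "\<exists>d>0. \<forall>t. norm (t - 0) < d \<longrightarrow>
          norm (?z t (s t) - ?z 0 (s 0) - (t - 0) *\<^sub>R v) \<le> e * norm (t - 0)"
      proof (intro exI[of _ "min \<delta> \<epsilon>"] conjI allI impI)
        fix t :: real assume "norm (t - 0) < min \<delta> \<epsilon>"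
        then have t: "\<bar>t\<bar> < \<delta>" "\<bar>t\<bar> < \<epsilon>" by auto
        obtain s' where s': "\<bar>s'\<bar> \<le> e' * \<bar>t\<bar>" "U (?z t s') = 0" using \<delta>(2)[OF t(1)] by blast
        have "e' * \<bar>t\<bar> \<le> \<bar>t\<bar>" using e' by (auto intro: mult_left_le_one_le)
        with s'(1) have "\<bar>s'\<bar> \<le> \<bar>t\<bar>" by linarith
        then have "\<bar>s t\<bar> \<le> \<bar>s'\<bar>" using s[OF t(2)] s'(2) by blast
        with s'(1) have "\<bar>s t\<bar> \<le> e' * \<bar>t\<bar>" by linarith
        have "norm (?z t (s t) - ?z 0 (s 0) - (t - 0) *\<^sub>R v) = \<bar>s t\<bar> * norm n" by (simp add: s0)
        also have "\<dots> \<le> (e' * \<bar>t\<bar>) * c"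
          using \<open>\<bar>s t\<bar> \<le> e' * \<bar>t\<bar>\<close> e' by (intro mult_mono) (auto simp: c_def)
        also have "\<dots> \<le> e * \<bar>t\<bar>" using mult_right_mono[OF e'(3), of "\<bar>t\<bar>"] by (simp add: algebra_simps)
        finally show "norm (?z t (s t) - ?z 0 (s 0) - (t - 0) *\<^sub>R v) \<le> e * norm (t - 0)" by simp
      qed (use \<delta> \<open>\<epsilon> > 0\<close> in auto)
    qed
  qed (fact \<open>\<epsilon> > 0\<close>)
qed

text \<open>The assumptions on \<open>W\<close> and at \<open>x\<close> differ in strength because
  the normal has to be identified on a whole neighbourhood, but is differentiated at
  \<open>x\<close> only. The sets \<open>R\<close> and \<open>S\<close> are constrained inside
  \<open>W\<close> alone.\<close>

locale sublevel_region =
  fixes G :: "'e::euclidean_space metric_field" and U :: "'e \<Rightarrow> real" and W R S :: "'e set" and x :: 'e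
  assumes W: "open W" "x \<in> W"
    and G: "metric_at G x" "\<And>y. y \<in> W \<Longrightarrow> inner_form (G y)"
    and U: "twice_diff U x" "U x = 0" "\<And>y. y \<in> W \<Longrightarrow> U differentiable (at y)"
    and regular: "\<And>y. y \<in> W \<Longrightarrow> \<exists>v. frechet_derivative U (at y) v \<noteq> 0"
    and RS: "R \<inter> W = {y\<in>W. U y \<le> 0}" "S \<inter> W = {y\<in>W. U y = 0}"
begin

abbreviation "dU y \<equiv> frechet_derivative U (at y)"

definition "grad y = sharp (G y) (dU y)"

lemma dU: assumes "y \<in> W" shows "(U has_derivative dU y) (at y)" "linear (dU y)"
  using U(3)[OF assms] frechet_derivative_works linear_frechet_derivative by blast+

lemma grad: assumes "y \<in> W" shows "G y (grad y) z = dU y z"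
  unfolding grad_def by (rule sharp_works[OF G(2)[OF assms] dU(2)[OF assms]])

lemma grad_pos: assumes "y \<in> W" shows "G y (grad y) (grad y) > 0"
proof -
  obtain v where "dU y v \<noteq> 0" using regular[OF assms] by blast
  then have "grad y \<noteq> 0"
    using grad[OF assms, of v] bilinear_lzero[OF inner_formD(1)[OF G(2)[OF assms]]] by auto
  then show ?thesis using inner_formD(3)[OF G(2)[OF assms]] by blast
qed

lemma continuous_on_U: "continuous_on W U"
  using U(3) W(1) by (simp add: continuous_at_imp_continuous_on differentiable_imp_continuous_within)

text \<open>One inclusion is the chain rule along a curve on which \<open>U\<close> vanishes; for
  the other, \<open>implicit_curve\<close> is used with the gradient as transversal
  direction.\<close>

lemma tangent_vectors_eq:
  assumes y: "y \<in> W" "U y = 0"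
  shows "tangent_vectors S y = {v. dU y v = 0}"
proof (intro equalityI subsetI)
  fix v assume "v \<in> tangent_vectors S y"
  then obtain \<gamma> \<epsilon> where c: "\<gamma> 0 = y" "\<epsilon> > 0" "\<And>t. \<bar>t\<bar> < \<epsilon> \<Longrightarrow> \<gamma> t \<in> S"
    "(\<gamma> has_vector_derivative v) (at 0)" unfolding tangent_vectors_def by blast
  have der: "(\<gamma> has_derivative (\<lambda>t. t *\<^sub>R v)) (at 0)" using c(4) by (simp add: has_vector_derivative_def)
  have "((\<lambda>t. U (\<gamma> t)) has_derivative (\<lambda>t. dU y (t *\<^sub>R v))) (at 0)"
    using has_derivative_compose[OF der, of U "dU y"] dU(1)[OF y(1)] c(1) by simp
  moreover have "\<forall>\<^sub>F t in nhds 0. U (\<gamma> t) = 0"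
  proof -
    have "\<forall>\<^sub>F y in nhds (\<gamma> 0). y \<in> W" using W(1) y(1) c(1) eventually_nhds by blast
    then have "\<forall>\<^sub>F t in nhds 0. \<gamma> t \<in> W"
      using eventually_nhds_compose[OF has_derivative_continuous[OF der], of "\<lambda>y. y \<in> W"] by blast
    moreover have "\<forall>\<^sub>F t in nhds 0. \<gamma> t \<in> S"
      unfolding eventually_nhds_metric using c(2,3) by (intro exI[of _ \<epsilon>]) (auto simp: dist_norm)
    ultimately show ?thesis by eventually_elim (use RS(2) in blast)
  qed
  ultimately have "((\<lambda>t. 0::real) has_derivative (\<lambda>t. dU y (t *\<^sub>R v))) (at (0::real))"
    by (rule has_derivative_transform_nhds)
  from has_derivative_unique[OF this has_derivative_const] have "dU y (1 *\<^sub>R v) = 0" by metis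
  then show "v \<in> {v. dU y v = 0}" by simp
next
  fix v assume "v \<in> {v. dU y v = 0}"
  moreover have "dU y (grad y) > 0" using grad_pos[OF y(1)] grad[OF y(1), of "grad y"] by simp
  ultimately obtain \<gamma> \<epsilon> where "\<gamma> 0 = y" "\<epsilon> > 0" "\<And>t. \<bar>t\<bar> < \<epsilon> \<Longrightarrow> \<gamma> t \<in> W \<and> U (\<gamma> t) = 0"
    "(\<gamma> has_vector_derivative v) (at 0)"
    using implicit_curve[OF dU(1)[OF y(1)] continuous_on_U W(1) y, of v "grad y"] by auto
  then show "v \<in> tangent_vectors S y"
    unfolding tangent_vectors_def using RS(2) by blast
qed

text \<open>This decides which of the two unit normals is the inward one.\<close>

lemma sign_along_line:
  assumes y: "y \<in> W" "U y = 0"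
  shows "dU y v < 0 \<Longrightarrow> \<exists>\<epsilon>>0. \<forall>t\<in>{0<..<\<epsilon>}. y + t *\<^sub>R v \<in> R"
    and "dU y v > 0 \<Longrightarrow> \<not> (\<exists>\<epsilon>>0. \<forall>t\<in>{0<..<\<epsilon>}. y + t *\<^sub>R v \<in> R)"
proof -
  have der: "((\<lambda>t. U (y + t *\<^sub>R v)) has_real_derivative dU y v) (at 0)"
    using has_derivative_along_line[of U y 0 v] U(3)[OF y(1)] by simp
  have "isCont (\<lambda>t. y + t *\<^sub>R v) 0" by (intro continuous_intros)
  moreover have "\<forall>\<^sub>F z in nhds (y + 0 *\<^sub>R v). z \<in> W" using W(1) y(1) by (auto simp: eventually_nhds)
  ultimately have "\<forall>\<^sub>F t in nhds 0. y + t *\<^sub>R v \<in> W" by (rule eventually_nhds_compose)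
  then obtain d where d: "d > 0" "\<And>t. \<bar>t\<bar> < d \<Longrightarrow> y + t *\<^sub>R v \<in> W"
    unfolding eventually_nhds_metric by (auto simp: dist_norm)
  show "\<exists>\<epsilon>>0. \<forall>t\<in>{0<..<\<epsilon>}. y + t *\<^sub>R v \<in> R" if neg: "dU y v < 0"
  proof -
    obtain e where e: "e > 0" "\<And>h. 0 < h \<Longrightarrow> h < e \<Longrightarrow> U (y + h *\<^sub>R v) < 0"
      using DERIV_neg_dec_right[OF der neg] y(2) by auto
    show ?thesis
    proof (intro exI[of _ "min d e"] conjI ballI)
      fix t assume t: "t \<in> {0<..<min d e}"
      then have "y + t *\<^sub>R v \<in> {y\<in>W. U y \<le> 0}" using d(2)[of t] e(2)[of t] by auto
      then show "y + t *\<^sub>R v \<in> R" using RS(1) by blast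
    qed (use d e in auto)
  qed
  show "\<not> (\<exists>\<epsilon>>0. \<forall>t\<in>{0<..<\<epsilon>}. y + t *\<^sub>R v \<in> R)" if pos: "dU y v > 0"
  proof
    assume "\<exists>\<epsilon>>0. \<forall>t\<in>{0<..<\<epsilon>}. y + t *\<^sub>R v \<in> R"
    then obtain \<epsilon> where \<epsilon>: "\<epsilon> > 0" "\<And>t. 0 < t \<Longrightarrow> t < \<epsilon> \<Longrightarrow> y + t *\<^sub>R v \<in> R" by auto
    obtain e where e: "e > 0" "\<And>h. 0 < h \<Longrightarrow> h < e \<Longrightarrow> U (y + h *\<^sub>R v) > 0"
      using DERIV_pos_inc_right[OF der pos] y(2) by auto
    define t where "t = min \<epsilon> (min d e) / 2"
    have t: "0 < t" "t < \<epsilon>" "t < d" "t < e" using \<epsilon>(1) d(1) e(1) by (auto simp: t_def)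
    then have "y + t *\<^sub>R v \<in> R \<inter> W" using \<epsilon>(2)[of t] d(2)[of t] by auto
    then show False using RS(1) e(2)[OF t(1,4)] by auto
  qed
qed

text \<open>For uniqueness, a candidate minus its component along the gradient is both tangent and
  orthogonal to the tangent space, hence zero. The unit length then leaves two multiples of the
  gradient, and the direction of entry into \<open>R\<close> rules out the positive one.\<close>

lemma inward_normal_eq:
  assumes y: "y \<in> W" "U y = 0"
  shows "inward_normal G R S y = (- 1 / sqrt (G y (grad y) (grad y))) *\<^sub>R grad y"
proof -
  note b = G(2)[OF y(1)]
  note bl = inner_formD(1)[OF b] and sym = inner_formD(2)[OF b]
  define q where "q = G y (grad y) (grad y)"
  have q: "q > 0" "dU y (grad y) = q" using grad_pos[OF y(1)] grad[OF y(1)] by (auto simp: q_def)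
  define \<kappa> where "\<kappa> = - 1 / sqrt q"
  have \<kappa>: "\<kappa> < 0" "\<kappa> * (\<kappa> * q) = 1"
    using q(1) by (auto simp: \<kappa>_def real_sqrt_mult_self field_simps)
  show ?thesis unfolding inward_normal_def tangent_vectors_eq[OF y] q_def[symmetric] \<kappa>_def[symmetric]
  proof (rule the_equality)
    have "dU y (\<kappa> *\<^sub>R grad y) < 0"
      using q \<kappa> dU(2)[OF y(1)] by (simp add: linear_cmul mult_neg_pos)
    then show "G y (\<kappa> *\<^sub>R grad y) (\<kappa> *\<^sub>R grad y) = 1 \<and> (\<forall>w\<in>{v. dU y v = 0}. G y (\<kappa> *\<^sub>R grad y) w = 0) \<and>
        (\<exists>\<epsilon>>0. \<forall>t\<in>{0<..<\<epsilon>}. y + t *\<^sub>R (\<kappa> *\<^sub>R grad y) \<in> R)"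
      using sign_along_line(1)[OF y, of "\<kappa> *\<^sub>R grad y"] \<kappa>(2)
      by (auto simp: bilinear_lmul[OF bl] bilinear_rmul[OF bl] grad[OF y(1)] q(2))
  next
    fix n assume n: "G y n n = 1 \<and> (\<forall>w\<in>{v. dU y v = 0}. G y n w = 0) \<and>
        (\<exists>\<epsilon>>0. \<forall>t\<in>{0<..<\<epsilon>}. y + t *\<^sub>R n \<in> R)"
    define k where "k = G y n (grad y) / q"
    define w where "w = n - k *\<^sub>R grad y"
    have "dU y w = 0"
      using q sym[of n "grad y"]
      by (simp add: grad[OF y(1), symmetric] w_def k_def bilinear_rsub[OF bl] bilinear_rmul[OF bl] flip: q_def)
    then have "G y n w = 0" "G y (grad y) w = 0" using n by (auto simp: grad[OF y(1)])
    then have "G y w w = 0"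
      by (subst (1) w_def) (simp add: bilinear_lsub[OF bl] bilinear_lmul[OF bl])
    then have "w = 0" using inner_formD(3)[OF b] by force
    then have nk: "n = k *\<^sub>R grad y" by (simp add: w_def)
    then have "k * k * q = 1"
      using n by (simp add: bilinear_lmul[OF bl] bilinear_rmul[OF bl] mult.assoc flip: q_def)
    then have "(k * sqrt q)\<^sup>2 = 1" using q(1) by (simp add: power_mult_distrib) (simp add: power2_eq_square)
    then have "k * sqrt q = 1 \<or> k * sqrt q = - 1" by (simp add: power2_eq_1_iff)
    moreover have "k \<le> 0"
    proof (rule ccontr)
      assume "\<not> k \<le> 0"
      then have "dU y n > 0" using q dU(2)[OF y(1)] by (simp add: nk linear_cmul)
      then show False using sign_along_line(2)[OF y] n by blast
    qed
    ultimately have "k * sqrt q = - 1" using q(1) mult_nonpos_nonneg[of k "sqrt q"] by auto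
    then have "k = \<kappa>" using q(1) by (simp add: \<kappa>_def field_simps)
    then show "n = \<kappa> *\<^sub>R grad y" by (simp add: nk)
  qed
qed

text \<open>With the normal written as \<open>\<rho> y *\<^sub>R grad y\<close>, the derivative of
  \<open>\<rho>\<close> only yields a multiple of the gradient, which is orthogonal to
  \<open>w\<close>. What remains is \<open>\<rho> x\<close> times the covariant derivative of the
  gradient, that is, the Hessian.\<close>

lemma second_fund_form_eq:
  assumes v: "dU x v = 0" and w: "dU x w = 0"
  shows "second_fund_form G R S x v w = hessian G U x v w / deriv_norm G U x"
proof -
  note b = metric_at_inner_form[OF G(1)]
  note bl = inner_formD(1)[OF b] and sym = inner_formD(2)[OF b]
  define q where "q y = G y (grad y) (grad y)" for y
  define \<rho> where "\<rho> y = - 1 / sqrt (q y)" for y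
  define n where "n y = \<rho> y *\<^sub>R grad y" for y
  have "q x > 0" using grad_pos[OF W(2)] by (simp add: q_def)
  have evW: "\<forall>\<^sub>F y in nhds x. y \<in> W" using W eventually_nhds by blast
  have "grad differentiable (at x)"
    unfolding grad_def[abs_def]
  proof (rule sharp_differentiable[OF G(1)])
    show "\<forall>\<^sub>F y in nhds x. linear (dU y)" using evW by eventually_elim (rule dU(2))
    show "(\<lambda>y. dU y z) differentiable (at x)" for z using U(1) by (simp add: twice_diff_def)
  qed
  then obtain g' where g': "(grad has_derivative g') (at x)" by (auto simp: differentiable_def)
  obtain q' where "(q has_derivative q') (at x)"
    unfolding q_def using metric_has_derivative[OF _ has_derivative_ident g' g'] G(1) by blast
  then obtain \<rho>' where \<rho>': "(\<rho> has_derivative \<rho>') (at x)"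
  proof -
    have "(\<lambda>s. - 1 / sqrt s) differentiable (at (q x))"
      using \<open>q x > 0\<close> by (auto intro!: derivative_eq_intros exI simp: differentiable_def has_field_derivative_def[symmetric])
    then have "((\<lambda>s. - 1 / sqrt s) \<circ> q) differentiable (at x)"
      using \<open>(q has_derivative q') (at x)\<close> by (intro differentiable_chain_at) (auto simp: differentiable_def)
    then show thesis using that by (auto simp: differentiable_def o_def \<rho>_def[abs_def])
  qed
  have n': "(n has_derivative (\<lambda>z. \<rho> x *\<^sub>R g' z + \<rho>' z *\<^sub>R grad x)) (at x)" (is "(n has_derivative ?n') _")
    unfolding n_def by (rule has_derivative_scaleR[OF \<rho>' g'])
  have n_eq: "inward_normal G R S y = n y" if "y \<in> S \<inter> W" for y
    using that RS(2) by (auto simp: inward_normal_eq n_def \<rho>_def q_def)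
  have xS: "x \<in> S \<inter> W" using W(2) U(2) RS(2) by blast
  have "(inward_normal G R S has_derivative ?n') (at x within S)"
  proof -
    obtain d where d: "d > 0" "ball x d \<subseteq> W" using W openE by blast
    show ?thesis
      by (rule has_derivative_transform_within[OF has_derivative_at_withinI[OF n'] d(1)])
        (use xS d n_eq in \<open>auto simp: dist_commute mem_ball subset_iff\<close>)
  qed
  then have D: "(inward_normal G R S has_derivative frechet_derivative (inward_normal G R S) (at x within S)) (at x within S)"
    (is "(?\<nu> has_derivative ?D) _")
    using frechet_derivative_works differentiableI by blast
  \<comment> \<open>A derivative within \<open>S\<close> is not determined off the tangent space, so
    \<open>?D\<close> and \<open>?n'\<close> need not agree as maps. Composition with a curve in
    \<open>S\<close> of velocity \<open>v\<close> shows that they agree at \<open>v\<close>.\<close>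
  have Dv: "?D v = ?n' v"
  proof -
    have "v \<in> tangent_vectors S x" using v tangent_vectors_eq[OF W(2) U(2)] by simp
    then obtain \<gamma> \<epsilon> where c: "\<gamma> 0 = x" "\<epsilon> > 0" "\<And>t. \<bar>t\<bar> < \<epsilon> \<Longrightarrow> \<gamma> t \<in> S"
      "(\<gamma> has_vector_derivative v) (at 0)" unfolding tangent_vectors_def by blast
    have der: "(\<gamma> has_derivative (\<lambda>t. t *\<^sub>R v)) (at 0 within ball 0 \<epsilon>)"
      using c(4) by (auto simp: has_vector_derivative_def intro: has_derivative_at_withinI)
    have sub: "\<gamma> ` ball 0 \<epsilon> \<subseteq> S" using c(3) by auto
    have h: "((\<lambda>t. ?\<nu> (\<gamma> t)) has_derivative (\<lambda>t. L (t *\<^sub>R v))) (at 0)"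
      if "(?\<nu> has_derivative L) (at x within S)" for L
    proof -
      have "(?\<nu> has_derivative L) (at (\<gamma> 0) within \<gamma> ` ball 0 \<epsilon>)"
        using has_derivative_subset[OF that sub] c(1) by simp
      from has_derivative_in_compose[OF der this] show ?thesis
        using c(2) by (simp add: at_within_open[of 0 "ball 0 \<epsilon>"])
    qed
    from has_derivative_unique[OF h[OF D] h[OF \<open>(?\<nu> has_derivative ?n') (at x within S)\<close>]]
    have "?D (1 *\<^sub>R v) = ?n' (1 *\<^sub>R v)" by metis
    then show ?thesis by simp
  qed
  \<comment> \<open>Obtained by differentiating \<open>G y (grad y) w = dU y w\<close> at
    \<open>x\<close> in direction \<open>v\<close>.\<close>
  have Gg': "G x (g' v) w = D2 U x v w - metric_deriv G x v (grad x) w"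
  proof -
    have "((\<lambda>y. G y (grad y) w) has_derivative (\<lambda>z. metric_deriv G x z (grad x) w + G x (g' z) w + G x (grad x) 0)) (at x)"
      using metric_has_derivative[OF _ has_derivative_ident g' has_derivative_const, of G w] G(1) by simp
    moreover have "\<forall>\<^sub>F y in nhds x. G y (grad y) w = dU y w" using evW by eventually_elim (rule grad)
    ultimately have "((\<lambda>y. dU y w) has_derivative (\<lambda>z. metric_deriv G x z (grad x) w + G x (g' z) w + G x (grad x) 0)) (at x)"
      by (rule has_derivative_transform_nhds)
    from has_derivative_unique[OF this twice_diff_has_derivative[OF U(1)]] show ?thesis
      by (simp add: fun_eq_iff bilinear_rzero[OF bl] algebra_simps)
  qed
  have gw: "G x (grad x) w = 0" using grad[OF W(2)] w by simp
  have "G x (?D v + christoffel G x v (?\<nu> x)) w = \<rho> x * (G x (g' v) w + G x (christoffel G x v (grad x)) w)"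
    unfolding Dv n_eq[OF xS]
    by (simp add: n_def bilinear_ladd[OF bl] bilinear_lmul[OF bl] gw
        bilinear_rmul[OF christoffel_bilinear(1)[OF G(1)]] algebra_simps)
  \<comment> \<open>Compatibility of the connection with the metric: by the Koszul formula, moving
    the gradient out of the Christoffel symbol absorbs the derivative of the metric.\<close>
  also have "G x (g' v) w + G x (christoffel G x v (grad x)) w = D2 U x v w - G x (christoffel G x v w) (grad x)"
    unfolding christoffel_works[OF G(1)] Gg'
    using metric_deriv_linear(4)[OF G(1)] by (simp add: field_simps)
  also have "G x (christoffel G x v w) (grad x) = dU x (christoffel G x v w)"
    using sym grad[OF W(2)] by metis
  finally show ?thesis
    by (simp add: second_fund_form_def hessian_eq \<rho>_def q_def deriv_norm_def Let_def grad_def[symmetric])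
qed

end

section \<open>Quadratic functions with a quartic cutoff\<close>

lemma Ck_on_2_twice_diff:
  assumes "Ck_on 2 F S" "open S" "x \<in> S"
  shows "twice_diff F x"
  unfolding twice_diff_def
proof (intro conjI allI)
  show "\<forall>\<^sub>F y in nhds x. F differentiable (at y)"
    using assms by (auto simp: numeral_2_eq_2 eventually_nhds)
  show "(\<lambda>y. frechet_derivative F (at y) w) differentiable (at x)" for w
    using assms by (auto simp: numeral_2_eq_2)
qed

text \<open>Closure of polynomials under directional derivatives is what makes them smooth to every
  order by induction.\<close>

lemma frechet_derivative_real_polynomial_function:
  assumes "real_polynomial_function f"
  shows "real_polynomial_function (\<lambda>x. frechet_derivative f (at x) v)"
  using assms
proof induction
  case (linear f)
  then have "frechet_derivative f (at x) = f" for x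
    by (intro frechet_derivative_eqI bounded_linear_imp_has_derivative)
  then show ?case by (simp add: real_polynomial_function.intros(2))
next
  case (const c)
  then show ?case by (simp add: real_polynomial_function.intros(2))
next
  case (add f g)
  then have "(f has_derivative frechet_derivative f (at x)) (at x)" "(g has_derivative frechet_derivative g (at x)) (at x)" for x
    using differentiable_at_real_polynomial_function frechet_derivative_works by blast+
  from frechet_derivative_eqI[OF has_derivative_add[OF this]] add show ?case
    by (simp add: real_polynomial_function.intros(3))
next
  case (mult f g)
  then have "(f has_derivative frechet_derivative f (at x)) (at x)" "(g has_derivative frechet_derivative g (at x)) (at x)" for x
    using differentiable_at_real_polynomial_function frechet_derivative_works by blast+
  from frechet_derivative_eqI[OF has_derivative_mult[OF this]] mult show ?case
    by (simp add: real_polynomial_function.intros(3) real_polynomial_function.intros(4))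
qed

lemma smooth_on_real_polynomial_function:
  fixes f :: "'e::euclidean_space \<Rightarrow> real"
  assumes "real_polynomial_function f"
  shows "smooth_on f S"
proof -
  have "Ck_on k f S" for k
    using assms
  proof (induction k arbitrary: f)
    case 0
    then show ?case
      using continuous_on_polymonial_function real_polynomial_function_eq by auto
  next
    case (Suc k)
    then show ?case
      by (auto intro: differentiable_at_real_polynomial_function frechet_derivative_real_polynomial_function)
  qed
  then show ?thesis by (simp add: smooth_on_def)
qed

lemma bilinear_bound_pos:
  fixes C :: "'e::euclidean_space \<Rightarrow> 'e \<Rightarrow> real"
  assumes "bilinear C"
  obtains M where "M > 0" "\<And>v w. \<bar>C v w\<bar> \<le> M * norm v * norm w"
  using bilinear_bounded_pos[OF assms] by auto

definition quartic_bump :: "'e::euclidean_space \<Rightarrow> ('e \<Rightarrow> 'e \<Rightarrow> real) \<Rightarrow> real \<Rightarrow> 'e \<Rightarrow> 'e \<Rightarrow> real" where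
  "quartic_bump a C K p y = a \<bullet> (y - p) + C (y - p) (y - p) / 2 - K * ((y - p) \<bullet> (y - p))\<^sup>2"

context
  fixes a p :: "'e::euclidean_space" and C :: "'e \<Rightarrow> 'e \<Rightarrow> real" and K :: real
  assumes C: "bilinear C" "\<And>v w. C v w = C w v"
begin

lemma bounded_bilinear_C: "bounded_bilinear C"
  using C(1) by (simp add: bilinear_conv_bounded_bilinear)

lemma quartic_bump_has_derivative:
  "(quartic_bump a C K p has_derivative
     (\<lambda>v. a \<bullet> v + C (y - p) v - 4 * K * ((y - p) \<bullet> (y - p)) * ((y - p) \<bullet> v))) (at y)"
proof -
  have q: "((\<lambda>y. B (y - p) (y - p)) has_derivative (\<lambda>v. B (y - p) (v - 0) + B (v - 0) (y - p))) (at y)"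
    if "bounded_bilinear B" for B :: "'e \<Rightarrow> 'e \<Rightarrow> real"
    by (intro bounded_bilinear.FDERIV[OF that] has_derivative_diff has_derivative_ident has_derivative_const)
  have d: "((\<lambda>y. a \<bullet> (y - p) + C (y - p) (y - p) * (1 / 2) - K * ((y - p) \<bullet> (y - p))\<^sup>2) has_derivative
     (\<lambda>v. a \<bullet> (v - 0) + (C (y - p) (v - 0) + C (v - 0) (y - p)) * (1 / 2) -
        K * (of_nat 2 * ((y - p) \<bullet> (v - 0) + (v - 0) \<bullet> (y - p)) * ((y - p) \<bullet> (y - p)) ^ (2 - 1)))) (at y)"
    by (intro has_derivative_diff has_derivative_add has_derivative_mult_right has_derivative_mult_left
        has_derivative_inner_right has_derivative_ident has_derivative_const has_derivative_power
        q[OF bounded_bilinear_C] q[OF bounded_bilinear_inner])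
  have e: "a \<bullet> (v - 0) + (C z (v - 0) + C (v - 0) z) * (1 / 2) -
        K * (of_nat 2 * (z \<bullet> (v - 0) + (v - 0) \<bullet> z) * (z \<bullet> z) ^ (2 - 1)) =
      a \<bullet> v + C z v - 4 * K * (z \<bullet> z) * (z \<bullet> v)" for z v
    using C(2)[of v z] by (simp add: inner_commute[of v z] algebra_simps)
  have f: "quartic_bump a C K p = (\<lambda>y. a \<bullet> (y - p) + C (y - p) (y - p) * (1 / 2) - K * ((y - p) \<bullet> (y - p))\<^sup>2)"
    by (simp add: fun_eq_iff quartic_bump_def)
  show ?thesis using d unfolding e f .
qed

lemma frechet_derivative_quartic_bump:
  "frechet_derivative (quartic_bump a C K p) (at y) v =
     a \<bullet> v + C (y - p) v - 4 * K * ((y - p) \<bullet> (y - p)) * ((y - p) \<bullet> v)"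
  by (simp add: frechet_derivative_eqI[OF quartic_bump_has_derivative])

lemma quartic_bump_polynomial: "real_polynomial_function (quartic_bump a C K p)"
proof -
  have id: "real_polynomial_function (\<lambda>y. (y - p) \<bullet> i)" for i
    unfolding inner_diff_left by (intro real_polynomial_function_diff real_polynomial_function.intros bounded_linear_inner_left)
  have "real_polynomial_function (\<lambda>y. (y - p) \<bullet> a + (\<Sum>i\<in>Basis. \<Sum>j\<in>Basis. ((y - p) \<bullet> i) * ((y - p) \<bullet> j) * C i j) * (1 / 2)
      - K * (\<Sum>i\<in>Basis. ((y - p) \<bullet> i) * ((y - p) \<bullet> i))\<^sup>2)"
    by (intro real_polynomial_function_diff real_polynomial_function.intros(3) real_polynomial_function.intros(4)
       real_polynomial_function_sum real_polynomial_function_power id real_polynomial_function.intros(2)) auto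
  moreover have "quartic_bump a C K p y = (y - p) \<bullet> a +
      (\<Sum>i\<in>Basis. \<Sum>j\<in>Basis. ((y - p) \<bullet> i) * ((y - p) \<bullet> j) * C i j) * (1 / 2)
      - K * (\<Sum>i\<in>Basis. ((y - p) \<bullet> i) * ((y - p) \<bullet> i))\<^sup>2" for y
    unfolding quartic_bump_def bilinear_expand[OF C(1), symmetric] euclidean_inner[symmetric]
    by (simp add: inner_commute)
  ultimately show ?thesis by presburger
qed

lemma quartic_bump_at_center:
  "quartic_bump a C K p p = 0" "frechet_derivative (quartic_bump a C K p) (at p) v = a \<bullet> v"
  "twice_diff (quartic_bump a C K p) p" "D2 (quartic_bump a C K p) p v w = C v w"
proof -
  show "quartic_bump a C K p p = 0" by (simp add: quartic_bump_def bilinear_lzero[OF C(1)])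
  show "frechet_derivative (quartic_bump a C K p) (at p) v = a \<bullet> v"
    by (simp add: frechet_derivative_quartic_bump bilinear_lzero[OF C(1)])
  have h: "((\<lambda>y. frechet_derivative (quartic_bump a C K p) (at y) w) has_derivative (\<lambda>v. C v w)) (at p)" for w
  proof -
    have "((\<lambda>y. a \<bullet> w + C (y - p) w - 4 * K * ((y - p) \<bullet> (y - p)) * ((y - p) \<bullet> w)) has_derivative
      (\<lambda>v. 0 + (C (p - p) 0 + C (v - 0) w) - (4 * K * ((p - p) \<bullet> (p - p)) * ((v - 0) \<bullet> w) +
        4 * K * ((p - p) \<bullet> (v - 0) + (v - 0) \<bullet> (p - p)) * ((p - p) \<bullet> w)))) (at p)"
      by (intro has_derivative_diff has_derivative_add has_derivative_mult has_derivative_mult_right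
        has_derivative_inner_left has_derivative_ident has_derivative_const
        bounded_bilinear.FDERIV[OF bounded_bilinear_C] bounded_bilinear.FDERIV[OF bounded_bilinear_inner])
    then show ?thesis
      by (simp add: frechet_derivative_quartic_bump bilinear_rzero[OF C(1)])
  qed
  show "twice_diff (quartic_bump a C K p) p"
    unfolding twice_diff_def
    using differentiableI[OF h] differentiableI[OF quartic_bump_has_derivative] by (simp add: always_eventually)
  show "D2 (quartic_bump a C K p) p v w = C v w"
    unfolding D2_def by (simp add: frechet_derivative_eqI[OF h])
qed

end

text \<open>A large \<open>K\<close> serves two purposes: it makes the bump negative off the ball,
  and it confines the zeros so closely to \<open>p\<close> that the linear part \<open>a\<close>
  still dominates the derivative there.\<close>

lemma quartic_bump_choice:
  fixes a p :: "'e::euclidean_space"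
  assumes C: "bilinear C" "\<And>v w. C v w = C w v" and "a \<noteq> 0" "\<rho> > 0"
  obtains K where "K \<ge> 0" "\<And>y. quartic_bump a C K p y \<ge> 0 \<Longrightarrow> norm (y - p) < \<rho>"
    "\<And>y. quartic_bump a C K p y = 0 \<Longrightarrow> \<exists>v. frechet_derivative (quartic_bump a C K p) (at y) v \<noteq> 0"
proof -
  obtain M where M: "M > 0" "\<And>v w. \<bar>C v w\<bar> \<le> M * norm v * norm w" using bilinear_bound_pos[OF C(1)] by metis
  have na: "norm a > 0" using assms by simp
  \<comment> \<open>The first summand makes the quartic term beat the linear and quadratic ones once
    \<open>norm z\<close> is at least \<open>\<rho>\<close>. The second gives
    \<open>K * (norm a)\<^sup>2 \<ge> M ^ 3\<close>, which contradicts the existence of a critical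
    zero.\<close>
  define K where "K = (norm a / \<rho> + M) / \<rho>\<^sup>2 + M ^ 3 / (norm a)\<^sup>2"
  have K1: "K * \<rho>\<^sup>2 \<ge> norm a / \<rho> + M"
  proof -
    have "(norm a / \<rho> + M) / \<rho>\<^sup>2 \<le> K" using M by (simp add: K_def)
    then show ?thesis using \<open>\<rho> > 0\<close> by (simp add: field_simps)
  qed
  have K2: "K * (norm a)\<^sup>2 \<ge> M ^ 3"
  proof -
    have "M ^ 3 / (norm a)\<^sup>2 \<le> K" using M \<open>\<rho> > 0\<close> by (simp add: K_def)
    then show ?thesis using na by (simp add: field_simps)
  qed
  have "K > 0" using M \<open>\<rho> > 0\<close> na unfolding K_def by (intro add_pos_pos divide_pos_pos) auto
  show thesis
  proof (rule that)
    show "K \<ge> 0" using \<open>K > 0\<close> by simp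
    fix y assume nn: "quartic_bump a C K p y \<ge> 0"
    define z where "z = y - p"
    show "norm (y - p) < \<rho>"
    proof (rule ccontr)
      assume "\<not> norm (y - p) < \<rho>"
      then have zr: "\<rho> \<le> norm z" by (simp add: z_def)
      have "norm z > 0" using zr \<open>\<rho> > 0\<close> by linarith
      have "norm a / \<rho> * norm z * \<rho> \<le> norm a / \<rho> * norm z * norm z"
        using zr \<open>\<rho> > 0\<close> by (intro mult_left_mono) auto
      then have "norm a * norm z \<le> norm a / \<rho> * (norm z)\<^sup>2"
        using \<open>\<rho> > 0\<close> by (simp add: power2_eq_square mult.assoc)
      moreover have "a \<bullet> z \<le> norm a * norm z" by (rule norm_cauchy_schwarz)
      moreover have "C z z \<le> M * (norm z)\<^sup>2" using M(2)[of z z] by (simp add: power2_eq_square mult.assoc)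
      moreover have "K * \<rho>\<^sup>2 * (norm z)\<^sup>2 \<le> K * (norm z)\<^sup>2 * (norm z)\<^sup>2"
        using zr \<open>K > 0\<close> \<open>\<rho> > 0\<close> by (intro mult_right_mono mult_left_mono power_mono) auto
      moreover have "(norm a / \<rho> + M) * (norm z)\<^sup>2 \<le> K * \<rho>\<^sup>2 * (norm z)\<^sup>2"
        using K1 by (intro mult_right_mono) auto
      moreover have "M * (norm z)\<^sup>2 > 0" using M(1) \<open>norm z > 0\<close> by simp
      moreover have "0 \<le> a \<bullet> z + C z z / 2 - K * (norm z)\<^sup>2 * (norm z)\<^sup>2"
        using nn by (simp add: quartic_bump_def z_def dot_square_norm power2_eq_square mult.assoc)
      ultimately show False by (simp add: distrib_right)
    qed
  next
    fix y assume z0: "quartic_bump a C K p y = 0"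
    define z where "z = y - p"
    define n where "n = norm z"
    show "\<exists>v. frechet_derivative (quartic_bump a C K p) (at y) v \<noteq> 0"
    proof (rule ccontr)
      assume "\<nexists>v. frechet_derivative (quartic_bump a C K p) (at y) v \<noteq> 0"
      then have d: "a \<bullet> v + C z v - 4 * K * n\<^sup>2 * (z \<bullet> v) = 0" for v
        by (simp add: frechet_derivative_quartic_bump[OF C] z_def n_def dot_square_norm)
      have "z \<noteq> 0" using d[of a] \<open>a \<noteq> 0\<close> bilinear_lzero[OF C(1)] by auto
      then have "n > 0" by (simp add: n_def)
      have "a \<bullet> z + C z z / 2 - K * (n\<^sup>2)\<^sup>2 = 0"
        using z0 by (simp add: quartic_bump_def z_def n_def dot_square_norm)
      \<comment> \<open>Eliminates \<open>a \<bullet> z\<close> from the value and the radial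
        derivative, both zero. With the bound \<open>M\<close> this gives
        \<open>6 * K * n\<^sup>2 \<le> M\<close>; the derivative along \<open>a\<close> then gives
        \<open>norm a \<le> 2 * M * n\<close>, so \<open>K * (norm a)\<^sup>2\<close> is at most two
        thirds of \<open>M ^ 3\<close>.\<close>
      then have "C z z = 6 * K * (n\<^sup>2)\<^sup>2"
        using d[of z] by (simp add: n_def dot_square_norm power2_eq_square algebra_simps)
      moreover have "C z z \<le> M * n\<^sup>2" using M(2)[of z z] by (simp add: power2_eq_square mult.assoc n_def)
      ultimately have "(6 * K * n\<^sup>2) * n\<^sup>2 \<le> M * n\<^sup>2" by (simp add: power2_eq_square mult.assoc)
      then have Kn: "6 * K * n\<^sup>2 \<le> M" using \<open>n > 0\<close> by simp
      have "a \<bullet> a = 4 * K * n\<^sup>2 * (z \<bullet> a) - C z a" using d[of a] by simp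
      also have "\<dots> \<le> 4 * K * n\<^sup>2 * (n * norm a) + M * n * norm a"
      proof -
        have "4 * K * n\<^sup>2 * (z \<bullet> a) \<le> 4 * K * n\<^sup>2 * (n * norm a)"
          using norm_cauchy_schwarz[of z a] \<open>K > 0\<close> by (intro mult_left_mono) (auto simp: n_def)
        moreover have "- C z a \<le> M * n * norm a" using M(2)[of z a] by (simp add: n_def abs_le_iff)
        ultimately show ?thesis by linarith
      qed
      also have "\<dots> = (4 * K * n\<^sup>2 + M) * n * norm a" by (simp add: algebra_simps)
      also have "\<dots> \<le> (2 * M) * n * norm a" using Kn \<open>n > 0\<close> M(1) by (intro mult_right_mono) auto
      finally have "norm a * norm a \<le> (2 * M * n) * norm a" by (simp add: dot_square_norm power2_eq_square)
      then have "norm a \<le> 2 * M * n" using na by simp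
      then have "(norm a)\<^sup>2 \<le> (2 * M * n)\<^sup>2" using na by (intro power_mono) auto
      then have "K * (norm a)\<^sup>2 \<le> K * (2 * M * n)\<^sup>2" using \<open>K > 0\<close> by simp
      also have "\<dots> = 4 * M\<^sup>2 * (K * n\<^sup>2)" by (simp add: power_mult_distrib mult.left_commute)
      finally have "M ^ 3 \<le> 4 * M\<^sup>2 * (K * n\<^sup>2)" using K2 by linarith
      moreover have "4 * M\<^sup>2 * (6 * K * n\<^sup>2) = 6 * (4 * M\<^sup>2 * (K * n\<^sup>2))" by simp
      ultimately have "6 * M ^ 3 \<le> 4 * M\<^sup>2 * (6 * K * n\<^sup>2)" by linarith
      also have "\<dots> \<le> 4 * M\<^sup>2 * M" using Kn M(1) by (intro mult_left_mono) auto
      finally show False using M(1) by (simp add: power2_eq_square power3_eq_cube)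
    qed
  qed
qed

section \<open>Reduction to quadratic functions\<close>

lemma tuple_convergent_subsequence:
  fixes v :: "nat \<Rightarrow> nat \<Rightarrow> 'e::euclidean_space"
  assumes "\<And>k i. i < m \<Longrightarrow> norm (v k i) \<le> B"
  shows "\<exists>l r. strict_mono r \<and> (\<forall>i<m. (\<lambda>k. v (r k) i) \<longlonglongrightarrow> l i)"
  using assms
proof (induction m)
  case 0
  then show ?case by (auto intro: strict_mono_id)
next
  case (Suc m)
  have "\<exists>l r. strict_mono r \<and> (\<forall>i<m. (\<lambda>k. v (r k) i) \<longlonglongrightarrow> l i)"
    by (rule Suc.IH) (simp add: Suc.prems)
  then obtain l r where lr: "strict_mono r" "\<And>i. i < m \<Longrightarrow> (\<lambda>k. v (r k) i) \<longlonglongrightarrow> l i" by blast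
  have "bounded (range (\<lambda>k. v (r k) m))" using Suc.prems by (intro boundedI[of _ B]) auto
  then obtain lm s where s: "strict_mono s" "(\<lambda>k. v (r (s k)) m) \<longlonglongrightarrow> lm"
    using bounded_imp_convergent_subsequence[of "\<lambda>k. v (r k) m"] by (auto simp: o_def)
  have "(\<lambda>k. v (r (s k)) i) \<longlonglongrightarrow> l i" if "i < m" for i
    using LIMSEQ_subseq_LIMSEQ[OF lr(2)[OF that] s(1)] by (simp add: o_def)
  then show ?case using strict_mono_o[OF lr(1) s(1), unfolded o_def] s(2)
    by (intro exI[of _ "l(m := lm)"] exI[of _ "\<lambda>k. r (s k)"]) (auto simp: less_Suc_eq)
qed

text \<open>Compactness: if tuples with trace below \<open>s'\<close> existed at points tending to
  \<open>x\<close>, a subsequence would converge to a tuple that is orthonormal at \<open>x\<close>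
  and has trace at most \<open>s'\<close>. The form \<open>C\<close> stays fixed, only the metric
  moves.\<close>

lemma trace_lower_semicontinuous:
  fixes G :: "'e::euclidean_space metric_field" and C :: "'e \<Rightarrow> 'e \<Rightarrow> real"
  assumes G: "\<forall>\<^sub>F y in nhds x. inner_form (G y)" "\<And>v w. isCont (\<lambda>y. G y v w) x"
    and C: "bilinear C" and "s' < s"
    and s: "\<And>v. orthonormal_tuple (G x) UNIV m v \<Longrightarrow> s \<le> (\<Sum>i<m. C (v i) (v i))"
  shows "\<forall>\<^sub>F y in nhds x. \<forall>v. orthonormal_tuple (G y) UNIV m v \<longrightarrow> s' \<le> (\<Sum>i<m. C (v i) (v i))"
proof (rule ccontr)
  assume neg: "\<not> ?thesis"
  obtain c where c: "c > 0" "\<forall>\<^sub>F y in nhds x. \<forall>v. c * (norm v)\<^sup>2 \<le> G y v v"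
    by (rule metric_uniform_lower_bound[OF G])
  \<comment> \<open>Uniform coercivity is part of \<open>P\<close> because it bounds the Euclidean
    norms of the tuples.\<close>
  define P where "P y v \<longleftrightarrow> inner_form (G y) \<and> (\<forall>v. c * (norm v)\<^sup>2 \<le> G y v v) \<and>
    orthonormal_tuple (G y) UNIV m v \<and> (\<Sum>i<m. C (v i) (v i)) < s'" for y v
  have "\<exists>y v. norm (y - x) < 1 / real (Suc k) \<and> P y v" for k
  proof (rule ccontr)
    assume no: "\<nexists>y v. norm (y - x) < 1 / real (Suc k) \<and> P y v"
    have "\<forall>\<^sub>F y in nhds x. norm (y - x) < 1 / real (Suc k)"
      unfolding eventually_nhds_metric dist_norm by (intro exI[of _ "1 / real (Suc k)"]) auto
    with G(1) c(2) have "\<forall>\<^sub>F y in nhds x. \<forall>v. orthonormal_tuple (G y) UNIV m v \<longrightarrow> s' \<le> (\<Sum>i<m. C (v i) (v i))"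
    proof eventually_elim
      case (elim y)
      show ?case
      proof (intro allI impI)
        fix v assume "orthonormal_tuple (G y) UNIV m v"
        moreover have "\<not> P y v" using elim(3) no by blast
        ultimately show "s' \<le> (\<Sum>i<m. C (v i) (v i))"
          using elim(1,2) by (auto simp: P_def not_less)
      qed
    qed
    with neg show False by blast
  qed
  then obtain y v where yv: "\<And>k. norm (y k - x) < 1 / real (Suc k)" "\<And>k. P (y k) (v k)" by metis
  have "norm (v k i) \<le> sqrt (1 / c)" if "i < m" for k i
  proof -
    have "c * (norm (v k i))\<^sup>2 \<le> G (y k) (v k i) (v k i)" using yv(2)[of k] unfolding P_def by blast
    moreover have "G (y k) (v k i) (v k i) = 1"
      using yv(2)[of k] that unfolding P_def orthonormal_tuple_def by simp
    ultimately have "(norm (v k i))\<^sup>2 \<le> 1 / c" using c(1) by (simp add: field_simps)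
    then show ?thesis by (rule real_le_rsqrt)
  qed
  then obtain l r where lr: "strict_mono r" "\<And>i. i < m \<Longrightarrow> (\<lambda>k. v (r k) i) \<longlonglongrightarrow> l i"
    using tuple_convergent_subsequence[of m v] by blast
  have "y \<longlonglongrightarrow> x"
  proof (rule Lim_transform_bound[of _ "\<lambda>k. 1 / real (Suc k)", THEN LIM_zero_cancel])
    show "\<forall>\<^sub>F k in sequentially. norm (y k - x) \<le> norm (1 / real (Suc k))"
      using yv(1) by (intro always_eventually) (auto simp: less_imp_le)
    show "(\<lambda>k. 1 / real (Suc k)) \<longlonglongrightarrow> 0"
      using LIMSEQ_inverse_real_of_nat by (simp add: inverse_eq_divide)
  qed
  then have yr: "(\<lambda>k. y (r k)) \<longlonglongrightarrow> x" using LIMSEQ_subseq_LIMSEQ[OF _ lr(1)] by (auto simp: o_def)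
  have Gx: "inner_form (G x)" using eventually_nhds_x_imp_x[OF G(1)] .
  have Gy: "inner_form (G (y (r k)))" for k using yv(2) by (simp add: P_def)
  have "G x (l i) (l j) = (if i = j then 1 else 0)" if ij: "i < m" "j < m" for i j
  proof -
    have "(\<lambda>k. G (y (r k)) a b) \<longlonglongrightarrow> G x a b" for a b
      using isCont_tendsto_compose[OF G(2) yr] .
    then have "(\<lambda>k. \<Sum>a\<in>Basis. \<Sum>b\<in>Basis. (v (r k) i \<bullet> a) * (v (r k) j \<bullet> b) * G (y (r k)) a b) \<longlonglongrightarrow>
        (\<Sum>a\<in>Basis. \<Sum>b\<in>Basis. (l i \<bullet> a) * (l j \<bullet> b) * G x a b)"
      using lr(2) ij by (intro tendsto_intros) auto
    then have "(\<lambda>k. G (y (r k)) (v (r k) i) (v (r k) j)) \<longlonglongrightarrow> G x (l i) (l j)"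
      by (simp add: bilinear_expand[OF inner_formD(1)[OF Gx], symmetric]
          bilinear_expand[OF inner_formD(1)[OF Gy], symmetric])
    moreover have "G (y (r k)) (v (r k) i) (v (r k) j) = (if i = j then 1 else 0)" for k
      using yv(2)[of "r k"] ij by (simp add: P_def orthonormal_tuple_def)
    ultimately show ?thesis by (simp add: LIMSEQ_const_iff)
  qed
  then have "s \<le> (\<Sum>i<m. C (l i) (l i))" by (intro s) (simp add: orthonormal_tuple_def)
  moreover have "(\<Sum>i<m. C (l i) (l i)) \<le> s'"
  proof (rule LIMSEQ_le_const2)
    have bb: "bounded_bilinear C" using C by (simp add: bilinear_conv_bounded_bilinear)
    show "(\<lambda>k. \<Sum>i<m. C (v (r k) i) (v (r k) i)) \<longlonglongrightarrow> (\<Sum>i<m. C (l i) (l i))"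
      by (intro tendsto_sum bounded_bilinear.tendsto[OF bb]) (use lr(2) in auto)
    show "\<exists>N. \<forall>n\<ge>N. (\<Sum>i<m. C (v (r n) i) (v (r n) i)) \<le> s'"
      using yv(2) by (auto simp: P_def less_imp_le)
  qed
  ultimately show False using \<open>s' < s\<close> by simp
qed

text \<open>The Koszul formula tested against the Christoffel vector itself: its three terms are
  bounded by \<open>B y\<close>, and coercivity of the metric allows one factor of the norm to be
  cancelled.\<close>

lemma christoffel_locally_bounded:
  fixes G :: "'e::euclidean_space metric_field"
  assumes G: "\<forall>\<^sub>F y in nhds x. metric_at G y" "\<And>z v w. isCont (\<lambda>y. metric_deriv G y z v w) x"
  obtains K where "K \<ge> 0" "\<forall>\<^sub>F y in nhds x. \<forall>v. norm (christoffel G y v v) \<le> K * (norm v)\<^sup>2"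
proof -
  have Gx: "metric_at G x" using eventually_nhds_x_imp_x[OF G(1)] .
  have inner: "\<forall>\<^sub>F y in nhds x. inner_form (G y)" using G(1) by eventually_elim (rule metric_at_inner_form)
  obtain c where c: "c > 0" "\<forall>\<^sub>F y in nhds x. \<forall>v. c * (norm v)\<^sup>2 \<le> G y v v"
    by (rule metric_uniform_lower_bound[OF inner metric_at_isCont[OF Gx]])
  define B where "B y = (\<Sum>j\<in>Basis. \<Sum>k\<in>Basis. \<Sum>i\<in>Basis. \<bar>metric_deriv G y i j k\<bar>)" for y
  have Bpos: "B y \<ge> 0" for y by (simp add: B_def sum_nonneg)
  have "(B \<longlongrightarrow> B x) (nhds x)"
    unfolding B_def by (intro tendsto_intros isCont_tendsto_nhds G(2))
  then have evB: "\<forall>\<^sub>F y in nhds x. B y < B x + 1" by (rule order_tendstoD) simp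
  have md: "\<bar>metric_deriv G y z v w\<bar> \<le> B y * norm z * norm v * norm w" if "metric_at G y" for y z v w
  proof -
    have "bilinear (metric_deriv G y z)" using metric_deriv_linear[OF that] by (simp add: bilinear_def)
    from bilinear_abs_le[OF this]
    have "\<bar>metric_deriv G y z v w\<bar> \<le> (\<Sum>j\<in>Basis. \<Sum>k\<in>Basis. \<bar>metric_deriv G y z j k\<bar>) * norm v * norm w" .
    also have "\<dots> \<le> (\<Sum>j\<in>Basis. \<Sum>k\<in>Basis. (\<Sum>i\<in>Basis. \<bar>metric_deriv G y i j k\<bar>) * norm z) * norm v * norm w"
      by (intro mult_right_mono sum_mono linear_abs_le metric_deriv_linear(1)[OF that]) auto
    also have "\<dots> = B y * norm z * norm v * norm w" by (simp add: B_def sum_distrib_right)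
    finally show ?thesis .
  qed
  define K where "K = 3 * (B x + 1) / (2 * c)"
  show thesis
  proof (rule that)
    show "K \<ge> 0" using Bpos[of x] c(1) by (simp add: K_def)
    show "\<forall>\<^sub>F y in nhds x. \<forall>v. norm (christoffel G y v v) \<le> K * (norm v)\<^sup>2"
      using G(1) c(2) evB
    proof eventually_elim
      case (elim y)
      show ?case
      proof
        fix v
        define \<Gamma> where "\<Gamma> = christoffel G y v v"
        have "c * (norm \<Gamma>)\<^sup>2 \<le> G y \<Gamma> \<Gamma>" using elim(2) by blast
        also have "\<dots> = (metric_deriv G y v v \<Gamma> + metric_deriv G y v v \<Gamma> - metric_deriv G y \<Gamma> v v) / 2"
          unfolding \<Gamma>_def by (rule christoffel_works[OF elim(1)])
        also have "\<dots> \<le> (3 * B y * (norm v)\<^sup>2 * norm \<Gamma>) / 2"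
          using md[OF elim(1), of v v \<Gamma>] md[OF elim(1), of \<Gamma> v v]
          by (simp add: power2_eq_square mult.commute mult.left_commute abs_le_iff)
        also have "\<dots> \<le> (3 * (B x + 1) * (norm v)\<^sup>2 * norm \<Gamma>) / 2"
          using elim(3) by (intro divide_right_mono mult_right_mono) auto
        finally have "norm \<Gamma> * (c * norm \<Gamma>) \<le> norm \<Gamma> * (3 * (B x + 1) * (norm v)\<^sup>2 / 2)"
          by (simp add: power2_eq_square mult.commute mult.left_commute)
        then have "c * norm \<Gamma> \<le> 3 * (B x + 1) * (norm v)\<^sup>2 / 2"
          using Bpos[of x] by (cases "norm \<Gamma> = 0") auto
        then show "norm (christoffel G y v v) \<le> K * (norm v)\<^sup>2"
          using c(1) by (simp add: K_def \<Gamma>_def field_simps)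
      qed
    qed
  qed
qed

text \<open>\<open>deriv_norm\<close> depends on the function only through its differential; this is
  that norm as a function of the covector.\<close>

definition dual_norm :: "('e::euclidean_space \<Rightarrow> 'e \<Rightarrow> real) \<Rightarrow> ('e \<Rightarrow> real) \<Rightarrow> real" where
  "dual_norm b L = sqrt (b (sharp b L) (sharp b L))"

lemma deriv_norm_eq: "deriv_norm G F x = dual_norm (G x) (frechet_derivative F (at x))"
  by (simp add: deriv_norm_def dual_norm_def Let_def)

lemma dual_norm_zero: "inner_form b \<Longrightarrow> dual_norm b (\<lambda>z. 0) = 0"
proof -
  assume b: "inner_form b"
  note bl = inner_formD(1)[OF b]
  have "sharp b (\<lambda>z. 0) = 0" by (rule sharp_unique[OF b]) (simp add: bilinear_lzero[OF bl])
  then show ?thesis by (simp add: dual_norm_def bilinear_lzero[OF bl])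
qed

lemma dual_norm_bounds:
  assumes b: "inner_form b" and c: "c > 0" "\<And>v. c * (norm v)\<^sup>2 \<le> b v v"
  shows "0 \<le> dual_norm b (\<lambda>z. a \<bullet> z)" "dual_norm b (\<lambda>z. a \<bullet> z) \<le> norm a / sqrt c"
proof -
  define u where "u = sharp b (\<lambda>z. a \<bullet> z)"
  have "linear (\<lambda>z. a \<bullet> z)" by (intro linearI) (auto simp: inner_simps)
  from sharp_works[OF b this] have bu: "b u u = a \<bullet> u" by (simp add: u_def)
  have "c * (norm u)\<^sup>2 \<le> norm a * norm u"
    using c(2)[of u] bu norm_cauchy_schwarz[of a u] by linarith
  then have "norm u * (c * norm u) \<le> norm u * norm a" by (simp add: power2_eq_square algebra_simps)
  then have "c * norm u \<le> norm a" by (cases "norm u = 0") auto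
  then have "norm u \<le> norm a / c" using c(1) by (simp add: field_simps)
  then have "norm a * norm u \<le> norm a * (norm a / c)" by (intro mult_left_mono) auto
  then have "b u u \<le> (norm a)\<^sup>2 / c" using bu norm_cauchy_schwarz[of a u] by (simp add: power2_eq_square)
  then have "sqrt (b u u) \<le> sqrt ((norm a)\<^sup>2 / c)" by simp
  then show "dual_norm b (\<lambda>z. a \<bullet> z) \<le> norm a / sqrt c" by (simp add: dual_norm_def u_def real_sqrt_divide)
  have "0 \<le> c * (norm u)\<^sup>2" using c(1) by simp
  also have "\<dots> \<le> b u u" by (rule c)
  finally show "0 \<le> dual_norm b (\<lambda>z. a \<bullet> z)" by (simp add: dual_norm_def u_def)
qed

text \<open>The sum is the trace, over an orthonormal \<open>m\<close>-tuple, of the covariant Hessian at \<open>x\<close> of the function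
  with gradient \<open>a\<close> and coordinate Hessian \<open>C\<close>.\<close>

definition touching_quadratic ::
    "nat \<Rightarrow> real \<Rightarrow> 'e::euclidean_space metric_field \<Rightarrow> 'e set \<Rightarrow> 'e set \<Rightarrow> 'e \<Rightarrow> 'e \<Rightarrow>
     ('e \<Rightarrow> 'e \<Rightarrow> real) \<Rightarrow> real \<Rightarrow> bool" where
  "touching_quadratic m h G \<Omega> Z x a C r \<longleftrightarrow>
     x \<in> Z \<and> r > 0 \<and> cball x r \<subseteq> \<Omega> \<and> a \<noteq> 0 \<and> bilinear C \<and> (\<forall>v w. C v w = C w v) \<and>
     (\<forall>y\<in>Z \<inter> cball x r. a \<bullet> (y - x) + C (y - x) (y - x) / 2 \<le> 0) \<and>
     (\<forall>v. orthonormal_tuple (G x) UNIV m v \<longrightarrow>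
        h * dual_norm (G x) (\<lambda>z. a \<bullet> z) < (\<Sum>i<m. C (v i) (v i) - a \<bullet> christoffel G x (v i) (v i)))"

text \<open>At a critical point the touching function is tilted by a small linear function \<open>- t C(e, \<cdot>)\<close> with
  \<open>C(e, e) > 0\<close>.  The tilted function is positive or zero at its new maximum point on \<open>Z\<close>, but at a critical
  point its value would be \<open>- t\<^sup>2 C(e, e) / 2 < 0\<close>.\<close>

lemma tilt_critical_quadratic:
  fixes G :: "'e::euclidean_space metric_field"
  assumes \<Omega>: "open \<Omega>" "r > 0" "cball x0 r \<subseteq> \<Omega>" "x0 \<in> Z" "closed (Z \<inter> cball x0 r)"
    and G: "\<And>y. y \<in> \<Omega> \<Longrightarrow> metric_at G y" "\<And>z v w. continuous_on \<Omega> (\<lambda>y. metric_deriv G y z v w)"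
    and C: "bilinear C" "\<And>v w. C v w = C w v"
    and "\<epsilon> > 0" and below: "\<And>y. y \<in> Z \<inter> cball x0 r \<Longrightarrow> C (y - x0) (y - x0) / 2 \<le> - \<epsilon> * (norm (y - x0))\<^sup>2"
    and "s > 0" and s: "\<And>v. orthonormal_tuple (G x0) UNIV m v \<Longrightarrow> s \<le> (\<Sum>i<m. C (v i) (v i))"
    and e: "C e e > 0"
  shows "\<exists>x a r. touching_quadratic m h G \<Omega> Z x a C r"
proof -
  let ?K = "Z \<inter> cball x0 r"
  have x0: "x0 \<in> \<Omega>" "x0 \<in> ?K" using \<Omega> by auto
  obtain M where M: "M > 0" "\<And>v w. \<bar>C v w\<bar> \<le> M * norm v * norm w"
    using bilinear_bounded_pos[OF C(1)] by auto
  have "compact ?K" using \<Omega>(5) bounded_subset[OF bounded_cball, of ?K x0 r] by (auto simp: compact_eq_bounded_closed)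
  have evm: "\<forall>\<^sub>F y in nhds x0. metric_at G y" using \<Omega>(1) x0(1) G(1) by (auto simp: eventually_nhds)
  have inner: "\<forall>\<^sub>F y in nhds x0. inner_form (G y)" using evm by eventually_elim (rule metric_at_inner_form)
  note cont = metric_at_isCont[OF G(1)[OF x0(1)]]
  have contd: "isCont (\<lambda>y. metric_deriv G y z v w) x0" for z v w
    using G(2) \<Omega>(1) x0(1) continuous_on_eq_continuous_at by blast
  obtain c where c: "c > 0" "\<forall>\<^sub>F y in nhds x0. \<forall>v. c * (norm v)\<^sup>2 \<le> G y v v"
    by (rule metric_uniform_lower_bound[OF inner cont])
  obtain K where K: "K \<ge> 0" "\<forall>\<^sub>F y in nhds x0. \<forall>v. norm (christoffel G y v v) \<le> K * (norm v)\<^sup>2"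
    by (rule christoffel_locally_bounded[OF evm contd])
  have "\<forall>\<^sub>F y in nhds x0. \<forall>v. orthonormal_tuple (G y) UNIV m v \<longrightarrow> s / 2 \<le> (\<Sum>i<m. C (v i) (v i))"
    by (rule trace_lower_semicontinuous[OF inner cont C(1) _ s]) (use \<open>s > 0\<close> in auto)
  with inner c(2) K(2) have "\<forall>\<^sub>F y in nhds x0. inner_form (G y) \<and> (\<forall>v. c * (norm v)\<^sup>2 \<le> G y v v) \<and>
      (\<forall>v. norm (christoffel G y v v) \<le> K * (norm v)\<^sup>2) \<and>
      (\<forall>v. orthonormal_tuple (G y) UNIV m v \<longrightarrow> s / 2 \<le> (\<Sum>i<m. C (v i) (v i)))"
    by eventually_elim blast
  then obtain d where d: "d > 0" "\<And>y. norm (y - x0) < d \<Longrightarrow> inner_form (G y) \<and> (\<forall>v. c * (norm v)\<^sup>2 \<le> G y v v) \<and>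
      (\<forall>v. norm (christoffel G y v v) \<le> K * (norm v)\<^sup>2) \<and>
      (\<forall>v. orthonormal_tuple (G y) UNIV m v \<longrightarrow> s / 2 \<le> (\<Sum>i<m. C (v i) (v i)))"
    unfolding eventually_nhds_metric dist_norm by blast
  have "e \<noteq> 0" using e bilinear_lzero[OF C(1)] by auto
  \<comment> \<open>For a tilt of size \<open>t\<close>, the new maximum point will lie within
    \<open>t * \<kappa>\<close> of \<open>x0\<close> and its gradient will have norm at most
    \<open>t * \<kappa>'\<close>. The number \<open>q\<close> bounds, per unit of gradient, what the
    Christoffel terms and the \<open>h\<close> term can cost.\<close>
  define \<kappa> where "\<kappa> = M * norm e / \<epsilon>"
  define \<kappa>' where "\<kappa>' = M * \<kappa> + M * norm e"
  define q where "q = real m * K / c + \<bar>h\<bar> / sqrt c"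
  have \<kappa>: "\<kappa> > 0" "\<kappa>' > 0" using M(1) \<open>e \<noteq> 0\<close> \<open>\<epsilon> > 0\<close> by (auto simp: \<kappa>_def \<kappa>'_def add_pos_pos)
  have "q \<ge> 0" using K(1) c(1) by (simp add: q_def)
  define p where "p = \<kappa>' * (q + 1)"
  have "p > 0" using \<kappa> \<open>q \<ge> 0\<close> by (simp add: p_def)
  \<comment> \<open>The three bounds keep the new point inside the ball of radius \<open>r\<close>,
    inside the ball of radius \<open>d\<close> where the uniform estimates hold, and the total loss
    below \<open>s / 2\<close>. The \<open>q + 1\<close> in \<open>p\<close> guards against
    \<open>q = 0\<close>.\<close>
  define t where "t = min (min (r / (2 * \<kappa>)) (d / (2 * \<kappa>))) (s / (4 * p))"
  have t: "t > 0" "t * \<kappa> < r" "t * \<kappa> < d" "q * (t * \<kappa>') < s / 2"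
  proof -
    show "t > 0" using \<kappa> \<Omega>(2) d(1) \<open>s > 0\<close> \<open>p > 0\<close> by (simp add: t_def)
    have "t \<le> r / (2 * \<kappa>)" "t \<le> d / (2 * \<kappa>)" "t \<le> s / (4 * p)" by (auto simp: t_def)
    then have *: "t * \<kappa> \<le> r / 2" "t * \<kappa> \<le> d / 2" "t * p \<le> s / 4"
      using \<kappa> \<open>p > 0\<close> by (auto simp: field_simps)
    then show "t * \<kappa> < r" "t * \<kappa> < d" using \<Omega>(2) d(1) by auto
    have "q * (t * \<kappa>') \<le> (q + 1) * (t * \<kappa>')" using \<open>t > 0\<close> \<kappa> by (intro mult_right_mono) auto
    also have "\<dots> = t * p" by (simp add: p_def)
    finally show "q * (t * \<kappa>') < s / 2" using *(3) \<open>s > 0\<close> by linarith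
  qed
  define \<phi> where "\<phi> y = C (y - x0) (y - x0) / 2 - t * C e (y - x0)" for y
  have bb: "bounded_bilinear C" using C(1) by (simp add: bilinear_conv_bounded_bilinear)
  have "continuous_on ?K \<phi>"
    unfolding \<phi>_def by (intro continuous_intros bounded_bilinear.continuous_on[OF bb]) auto
  then obtain x where x: "x \<in> ?K" "\<And>y. y \<in> ?K \<Longrightarrow> \<phi> y \<le> \<phi> x"
    using continuous_attains_sup[OF \<open>compact ?K\<close>] x0(2) by blast
  define z where "z = x - x0"
  have "\<phi> x \<ge> 0" using x(2)[OF x0(2)] by (simp add: \<phi>_def bilinear_lzero[OF C(1)] bilinear_rzero[OF C(1)])
  \<comment> \<open>At \<open>x\<close> the quadratic part is at most
    \<open>- \<epsilon> * (norm z)\<^sup>2\<close>, while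
    \<open>\<phi> x \<ge> \<phi> x0 = 0\<close>; so the linear tilt must make up for it, which
    bounds \<open>z\<close>.\<close>
  have nz: "norm z \<le> t * \<kappa>"
  proof -
    have "\<epsilon> * (norm z)\<^sup>2 \<le> - (t * C e z)" using below[OF x(1)] \<open>\<phi> x \<ge> 0\<close> by (simp add: \<phi>_def z_def)
    also have "\<dots> \<le> t * (M * norm e * norm z)"
      using M(2)[of e z] \<open>t > 0\<close> unfolding mult_minus_right[symmetric] by (intro mult_left_mono) (auto simp: abs_le_iff)
    finally have "norm z * (\<epsilon> * norm z) \<le> norm z * (t * (M * norm e))" by (simp add: power2_eq_square algebra_simps)
    then have "\<epsilon> * norm z \<le> t * (M * norm e)" using t(1) M(1) by (cases "norm z = 0") auto
    then show ?thesis using \<open>\<epsilon> > 0\<close> by (simp add: \<kappa>_def field_simps)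
  qed
  define L where "L v = C z v - t * C e v" for v
  have "linear L" unfolding L_def using C(1)
    by (intro linearI) (auto simp: bilinear_radd[OF C(1)] bilinear_rmul[OF C(1)] algebra_simps)
  then obtain a where a: "\<And>v. a \<bullet> v = L v" using linear_functional_representer by metis
  have na: "norm a \<le> t * \<kappa>'"
  proof -
    have "norm a * norm a = C z a - t * C e a" using a[of a] by (simp add: L_def dot_square_norm power2_eq_square)
    also have "\<dots> \<le> M * norm z * norm a + t * (M * norm e * norm a)"
    proof -
      have "t * (- C e a) \<le> t * (M * norm e * norm a)"
        using M(2)[of e a] t(1) by (intro mult_left_mono) (auto simp: abs_le_iff)
      then show ?thesis using M(2)[of z a] by (simp add: abs_le_iff)
    qed
    also have "\<dots> \<le> M * (t * \<kappa>) * norm a + t * (M * norm e * norm a)"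
      using nz M(1) by (intro add_right_mono mult_right_mono mult_left_mono) auto
    also have "\<dots> = t * \<kappa>' * norm a" by (simp add: \<kappa>'_def algebra_simps)
    finally show ?thesis using t(1) \<kappa> by (cases "norm a = 0") auto
  qed
  have "a \<noteq> 0"
  proof
    assume "a = 0"
    then have crit: "C z v = t * C e v" for v using a[of v] by (simp add: L_def)
    have "\<phi> x = - (t * (t * C e e)) / 2"
      using crit[of z] crit[of e] C(2)[of e z] by (simp add: \<phi>_def z_def)
    moreover have "t * (t * C e e) > 0" using t(1) e by simp
    ultimately show False using \<open>\<phi> x \<ge> 0\<close> by simp
  qed
  have xd: "norm (x - x0) < d" using nz t(3) by (simp add: z_def)
  have sub: "cball x (r - norm z) \<subseteq> cball x0 r"
  proof
    fix y assume "y \<in> cball x (r - norm z)"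
    moreover have "dist x0 x = norm z" by (simp add: z_def dist_norm norm_minus_commute)
    ultimately show "y \<in> cball x0 r" using dist_triangle[of x0 y x] by simp
  qed
  \<comment> \<open>\<open>\<phi>\<close> is quadratic, so its Taylor expansion at \<open>x\<close>
    is exact, with gradient \<open>a\<close> and unchanged Hessian \<open>C\<close>.\<close>
  have touch: "a \<bullet> (y - x) + C (y - x) (y - x) / 2 \<le> 0" if "y \<in> Z \<inter> cball x (r - norm z)" for y
  proof -
    have "\<phi> y \<le> \<phi> x" using x(2) that sub by blast
    moreover have "\<phi> y - \<phi> x = a \<bullet> (y - x) + C (y - x) (y - x) / 2"
    proof -
      define w where "w = y - x"
      have y: "y - x0 = z + w" by (simp add: z_def w_def)
      show ?thesis unfolding \<phi>_def y a L_def
        using C(2)[of w z] unfolding w_def[symmetric] z_def[symmetric]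
        by (simp add: bilinear_ladd[OF C(1)] bilinear_radd[OF C(1)] field_simps)
    qed
    ultimately show ?thesis by simp
  qed
  \<comment> \<open>Semicontinuity leaves a trace of at least \<open>s / 2\<close>; the Christoffel
    terms and the \<open>h\<close> term together cost at most \<open>q * norm a\<close>, which is
    smaller.\<close>
  have trace: "h * dual_norm (G x) (\<lambda>z. a \<bullet> z) < (\<Sum>i<m. C (v i) (v i) - a \<bullet> christoffel G x (v i) (v i))"
    if v: "orthonormal_tuple (G x) UNIV m v" for v
  proof -
    have "h * dual_norm (G x) (\<lambda>z. a \<bullet> z) \<le> \<bar>h\<bar> * (norm a / sqrt c)"
      using dual_norm_bounds[of "G x" c a] d(2)[OF xd] c(1)
      by (intro mult_mono) auto
    moreover have "(\<Sum>i<m. a \<bullet> christoffel G x (v i) (v i)) \<le> (\<Sum>i<m. norm a * (K / c))"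
    proof (rule sum_mono)
      fix i assume "i \<in> {..<m}"
      then have "c * (norm (v i))\<^sup>2 \<le> 1" using d(2)[OF xd] v by (metis orthonormal_tuple_def lessThan_iff)
      then have "(norm (v i))\<^sup>2 \<le> 1 / c" using c(1) by (simp add: field_simps)
      then have "K * (norm (v i))\<^sup>2 \<le> K * (1 / c)" using K(1) by (rule mult_left_mono)
      then have "norm (christoffel G x (v i) (v i)) \<le> K / c" using d(2)[OF xd] order_trans by fastforce
      then have "norm a * norm (christoffel G x (v i) (v i)) \<le> norm a * (K / c)" by (intro mult_left_mono) auto
      then show "a \<bullet> christoffel G x (v i) (v i) \<le> norm a * (K / c)"
        using norm_cauchy_schwarz[of a "christoffel G x (v i) (v i)"] by linarith
    qed
    moreover have "s / 2 \<le> (\<Sum>i<m. C (v i) (v i))" using d(2)[OF xd] v by blast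
    moreover have "q * norm a \<le> q * (t * \<kappa>')" using na \<open>q \<ge> 0\<close> by (rule mult_left_mono)
    moreover have "q * norm a = (\<Sum>i<m. norm a * (K / c)) + \<bar>h\<bar> * (norm a / sqrt c)"
      by (simp add: q_def algebra_simps)
    ultimately show ?thesis using t(4) by (simp add: sum_subtractf)
  qed
  have "touching_quadratic m h G \<Omega> Z x a C (r - norm z)"
    unfolding touching_quadratic_def using x(1) nz t(2) sub \<Omega>(3) \<open>a \<noteq> 0\<close> C touch trace by auto
  then show ?thesis by blast
qed

lemma exists_touching_quadratic:
  fixes G :: "'e::euclidean_space metric_field"
  assumes \<Omega>: "open \<Omega>" "r0 > 0" "cball x0 r0 \<subseteq> \<Omega>" "x0 \<in> Z" "closed (Z \<inter> cball x0 r0)"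
    and G: "\<And>y. y \<in> \<Omega> \<Longrightarrow> metric_at G y" "\<And>z v w. continuous_on \<Omega> (\<lambda>y. metric_deriv G y z v w)"
    and F: "twice_diff F x0" "\<And>y. y \<in> Z \<inter> cball x0 r0 \<Longrightarrow> F y \<le> F x0"
    and m: "m \<le> DIM('e)"
    and large: "sum_lowest_eigenvalues m (G x0) UNIV (hessian G F x0) > h * deriv_norm G F x0"
  shows "\<exists>x a C r. touching_quadratic m h G \<Omega> Z x a C r"
proof -
  let ?dF = "frechet_derivative F (at x0)"
  have x0: "x0 \<in> \<Omega>" using \<Omega> by auto
  note g = metric_at_inner_form[OF G(1)[OF x0]]
  have lin: "linear ?dF" using twice_diff_differentiable[OF F(1)] linear_frechet_derivative by blast
  obtain a where a: "\<And>v. a \<bullet> v = ?dF v" using linear_functional_representer[OF lin] by metis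
  define s where "s = sum_lowest_eigenvalues m (G x0) UNIV (hessian G F x0) - h * deriv_norm G F x0"
  have "s > 0" using large by (simp add: s_def)
  obtain c where c: "c > 0" "\<And>v. c * (norm v)\<^sup>2 \<le> G x0 v v" using inner_form_lower_bound[OF g] by metis
  \<comment> \<open>Subtracting \<open>4 * \<epsilon>\<close> times the Euclidean inner product
    lowers a trace over \<open>m\<close> vectors of squared norm at most \<open>1 / c\<close> by at
    most \<open>4 * \<epsilon> * m / c\<close>, so half of the gap \<open>s\<close> is left.\<close>
  define \<epsilon> where "\<epsilon> = s * c / (8 * (real m + 1))"
  have \<epsilon>: "\<epsilon> > 0" "4 * \<epsilon> * (real m / c) \<le> s / 2"
  proof -
    show "\<epsilon> > 0" using \<open>s > 0\<close> c(1) by (simp add: \<epsilon>_def)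
    have "4 * \<epsilon> * (real m / c) = s * real m / (2 * (real m + 1))" using c(1) by (simp add: \<epsilon>_def field_simps)
    also have "\<dots> \<le> s / 2" using \<open>s > 0\<close> by (simp add: field_simps)
    finally show "4 * \<epsilon> * (real m / c) \<le> s / 2" .
  qed
  \<comment> \<open>Half of \<open>C\<close> enters the quadratic, which therefore loses
    \<open>2 * \<epsilon>\<close> times the squared distance: one \<open>\<epsilon>\<close> absorbs
    the Taylor remainder, the other is the strict margin in \<open>below\<close>.\<close>
  define C where "C v w = D2 F x0 v w - 4 * \<epsilon> * (v \<bullet> w)" for v w
  have C: "bilinear C" "C v w = C w v" for v w
  proof -
    have "bilinear (\<lambda>v w. 1 * D2 F x0 v w + (- 4 * \<epsilon>) * (v \<bullet> w))"
      by (intro bilinear_combination D2_bilinear F)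
        (simp add: bilinear_def linear_iff inner_left_distrib inner_right_distrib)
    then show "bilinear C" by (simp add: C_def[abs_def])
    show "C v w = C w v" by (simp add: C_def D2_symmetric[OF F(1), of v w] inner_commute)
  qed
  obtain r1 where r1: "r1 > 0" "\<And>y. norm (y - x0) < r1 \<Longrightarrow>
      \<bar>F y - F x0 - ?dF (y - x0) - D2 F x0 (y - x0) (y - x0) / 2\<bar> \<le> \<epsilon> * (norm (y - x0))\<^sup>2"
    using second_order_Taylor[OF F(1) \<epsilon>(1)] unfolding eventually_nhds_metric dist_norm by blast
  define r where "r = min r0 (r1 / 2)"
  have r: "r > 0" "cball x0 r \<subseteq> cball x0 r0" using \<Omega>(2) r1(1) by (auto simp: r_def)
  have below: "a \<bullet> (y - x0) + C (y - x0) (y - x0) / 2 \<le> - \<epsilon> * (norm (y - x0))\<^sup>2"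
    if y: "y \<in> Z \<inter> cball x0 r" for y
  proof -
    have "norm (y - x0) < r1" using y r1(1) by (auto simp: r_def dist_norm norm_minus_commute)
    from r1(2)[OF this] have "?dF (y - x0) + D2 F x0 (y - x0) (y - x0) / 2 - \<epsilon> * (norm (y - x0))\<^sup>2 \<le> F y - F x0"
      by (simp add: abs_le_iff)
    moreover have "F y \<le> F x0" using F(2) y r(2) by blast
    ultimately show ?thesis unfolding a C_def dot_square_norm by (simp add: diff_divide_distrib)
  qed
  have "closed (Z \<inter> cball x0 r0 \<inter> cball x0 r)" by (rule closed_Int[OF \<Omega>(5) closed_cball])
  moreover have "Z \<inter> cball x0 r0 \<inter> cball x0 r = Z \<inter> cball x0 r" using r(2) by blast
  ultimately have cl: "closed (Z \<inter> cball x0 r)" by simp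
  have sub: "cball x0 r \<subseteq> \<Omega>" using r(2) \<Omega>(3) by blast
  have trace: "h * deriv_norm G F x0 + s / 2 \<le> (\<Sum>i<m. C (v i) (v i) - a \<bullet> christoffel G x0 (v i) (v i))"
    if v: "orthonormal_tuple (G x0) UNIV m v" for v
  proof -
    have "(\<Sum>i<m. hessian G F x0 (v i) (v i) - 4 * \<epsilon> * (1 / c)) \<le>
        (\<Sum>i<m. C (v i) (v i) - a \<bullet> christoffel G x0 (v i) (v i))"
    proof (rule sum_mono)
      fix i assume "i \<in> {..<m}"
      then have "c * (norm (v i))\<^sup>2 \<le> 1" using c(2)[of "v i"] v by (simp add: orthonormal_tuple_def)
      then have "(norm (v i))\<^sup>2 \<le> 1 / c" using c(1) by (simp add: field_simps)
      then have "4 * \<epsilon> * (v i \<bullet> v i) \<le> 4 * \<epsilon> * (1 / c)"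
        unfolding dot_square_norm using \<epsilon>(1) by (intro mult_left_mono) auto
      then show "hessian G F x0 (v i) (v i) - 4 * \<epsilon> * (1 / c) \<le> C (v i) (v i) - a \<bullet> christoffel G x0 (v i) (v i)"
        by (simp add: hessian_eq C_def a)
    qed
    moreover have "sum_lowest_eigenvalues m (G x0) UNIV (hessian G F x0) \<le> (\<Sum>i<m. hessian G F x0 (v i) (v i))"
      by (rule Ky_Fan_minimum_principle[OF g hessian_bilinear_symmetric[OF G(1)[OF x0] F(1)] subspace_UNIV v])
    moreover have "real m * (4 * \<epsilon> * (1 / c)) \<le> s / 2" using \<epsilon>(2) by (simp add: algebra_simps)
    moreover have "(\<Sum>i<m. hessian G F x0 (v i) (v i) - 4 * \<epsilon> * (1 / c)) =
        (\<Sum>i<m. hessian G F x0 (v i) (v i)) - real m * (4 * \<epsilon> * (1 / c))" by (simp add: sum_subtractf)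
    ultimately show ?thesis using s_def by linarith
  qed
  have dn: "deriv_norm G F x0 = dual_norm (G x0) (\<lambda>z. a \<bullet> z)" by (simp add: deriv_norm_eq a)
  show ?thesis
  proof (cases "a = 0")
    case False
    have "a \<bullet> (y - x0) + C (y - x0) (y - x0) / 2 \<le> 0" if "y \<in> Z \<inter> cball x0 r" for y
    proof -
      have "0 \<le> \<epsilon> * (norm (y - x0))\<^sup>2" using \<epsilon>(1) by simp
      then show ?thesis using below[OF that] by simp
    qed
    moreover have "h * dual_norm (G x0) (\<lambda>z. a \<bullet> z) < (\<Sum>i<m. C (v i) (v i) - a \<bullet> christoffel G x0 (v i) (v i))"
      if "orthonormal_tuple (G x0) UNIV m v" for v
      using trace[OF that] \<open>s > 0\<close> unfolding dn by linarith
    ultimately have "touching_quadratic m h G \<Omega> Z x0 a C r"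
      unfolding touching_quadratic_def using False \<Omega>(4) r(1) sub C by blast
    then show ?thesis by blast
  next
    case True
    have "(\<lambda>z. a \<bullet> z) = (\<lambda>z. 0)" using True by (simp add: fun_eq_iff)
    then have "deriv_norm G F x0 = 0" using dual_norm_zero[OF g] unfolding dn by simp
    then have tr: "s / 2 \<le> (\<Sum>i<m. C (v i) (v i))" if "orthonormal_tuple (G x0) UNIV m v" for v
      using trace[OF that] by (simp add: True)
    \<comment> \<open>A tuple exists as \<open>m \<le> DIM('e)\<close>, and its trace is positive,
      so one of its vectors is a direction of positive curvature of \<open>C\<close>. An empty tuple
      would have trace 0, hence \<open>m = 0\<close> cannot occur in the critical case.\<close>
    obtain v where "orthonormal_tuple (G x0) UNIV m v"
      using sum_lowest_eigenvalues_attained[OF g C subspace_UNIV] m by (auto simp: dim_UNIV)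
    then have "(\<Sum>i<m. C (v i) (v i)) > 0" using tr \<open>s > 0\<close> by fastforce
    then obtain i where e: "C (v i) (v i) > 0" by (metis not_less sum_nonpos)
    have neg: "C (y - x0) (y - x0) / 2 \<le> - \<epsilon> * (norm (y - x0))\<^sup>2" if "y \<in> Z \<inter> cball x0 r" for y
      using below[OF that] True by simp
    have s2: "s / 2 > 0" using \<open>s > 0\<close> by simp
    have "\<exists>x a r. touching_quadratic m h G \<Omega> Z x a C r"
      by (rule tilt_critical_quadratic[OF \<Omega>(1) r(1) sub \<Omega>(4) cl G C \<epsilon>(1) neg s2 tr e])
    then show ?thesis by blast
  qed
qed

section \<open>The region\<close>

lemma atlas_chart:
  assumes "smooth_atlas A" "c \<in> A"
  shows "open (chart_dom c)" "open (chart_ran c)"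
    and "continuous_on (chart_dom c) (coord c)" "continuous_on (chart_ran c) (param c)"
    and "\<And>q. q \<in> chart_dom c \<Longrightarrow> param c (coord c q) = q"
    and "\<And>y. y \<in> chart_ran c \<Longrightarrow> coord c (param c y) = y"
    and "\<And>y. y \<in> chart_ran c \<Longrightarrow> param c y \<in> chart_dom c"
proof -
  have h: "homeomorphism (chart_dom c) (chart_ran c) (coord c) (param c)"
    and "open (chart_dom c)" "open (chart_ran c)"
    using assms by (auto simp: smooth_atlas_def)
  then show "open (chart_dom c)" "open (chart_ran c)"
    "continuous_on (chart_dom c) (coord c)" "continuous_on (chart_ran c) (param c)"
    "\<And>q. q \<in> chart_dom c \<Longrightarrow> param c (coord c q) = q"
    "\<And>y. y \<in> chart_ran c \<Longrightarrow> coord c (param c y) = y"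
    "\<And>y. y \<in> chart_ran c \<Longrightarrow> param c y \<in> chart_dom c"
    by (auto simp: homeomorphism_def)
qed

lemma riemannian_metric_chart:
  assumes A: "smooth_atlas A" "C1_riemannian_metric A g" "c \<in> A"
  shows "\<And>y. y \<in> chart_ran c \<Longrightarrow> metric_at (g c) y"
    and "\<And>z v w. continuous_on (chart_ran c) (\<lambda>y. metric_deriv (g c) y z v w)"
proof -
  have C1: "Ck_on 1 (\<lambda>x. g c x v w) (chart_ran c)" for v w
    using A by (auto simp: C1_riemannian_metric_def)
  have inner: "inner_form (g c y)" if "y \<in> chart_ran c" for y
    using A that unfolding C1_riemannian_metric_def inner_form_def by blast
  show "metric_at (g c) y" if y: "y \<in> chart_ran c" for y
    unfolding metric_at_def
  proof (intro conjI allI)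
    show "\<forall>\<^sub>F z in nhds y. inner_form (g c z)"
      using inner atlas_chart(2)[OF A(1,3)] y by (auto simp: eventually_nhds)
    show "(\<lambda>y. g c y v w) differentiable (at y)" for v w
      using C1[of v w] y unfolding One_nat_def Ck_on.simps by blast
  qed
  show "continuous_on (chart_ran c) (\<lambda>y. metric_deriv (g c) y z v w)" for z v w
    using C1[of v w] unfolding metric_deriv_def One_nat_def Ck_on.simps by blast
qed

text \<open>The region lives in the chart \<open>c\<close>, its curvature is asked for in an
  arbitrary chart \<open>d\<close>; the transition therefore goes from \<open>d\<close> to
  \<open>c\<close>.\<close>

context
  fixes A :: "('a::{t2_space,second_countable_topology}, 'e::euclidean_space) chart set"
    and g :: "('a, 'e) chart \<Rightarrow> 'e metric_field" and c d :: "('a, 'e) chart"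
  assumes A: "smooth_atlas A" "C1_riemannian_metric A g" "c \<in> A" "d \<in> A"
begin

abbreviation "overlap \<equiv> coord d ` (chart_dom d \<inter> chart_dom c)"
abbreviation "transition \<equiv> coord c \<circ> param d"

lemma transition_apply: "q \<in> chart_dom d \<Longrightarrow> transition (coord d q) = coord c q"
  by (simp add: atlas_chart(5)[OF A(1,4)])

lemma overlap_open: "open overlap"
proof -
  have "overlap = chart_ran d \<inter> param d -` chart_dom c"
    using atlas_chart(5-7)[OF A(1,4)] by force
  then show ?thesis
    using continuous_open_preimage[OF atlas_chart(4,2)[OF A(1,4)] atlas_chart(1)[OF A(1,3)]] by simp
qed

lemma transition_smooth: "smooth_on transition overlap"
  using A unfolding smooth_atlas_def by blast

lemma transition_twice_diff: "y \<in> overlap \<Longrightarrow> twice_diff transition y"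
  using transition_smooth overlap_open by (intro Ck_on_2_twice_diff[of _ overlap]) (auto simp: smooth_on_def)

lemma transition_continuous: "continuous_on overlap transition"
  using transition_smooth unfolding smooth_on_def by (metis Ck_on.simps(1))

lemma transition_isometry:
  assumes "y \<in> overlap"
  shows "\<forall>\<^sub>F z in nhds y. \<forall>v w. g d z v w = g c (transition z)
    (frechet_derivative transition (at z) v) (frechet_derivative transition (at z) w)"
proof -
  have key: "g d z v w = g c (transition z) (frechet_derivative transition (at z) v) (frechet_derivative transition (at z) w)"
    if z: "z \<in> overlap" for z v w
  proof -
    obtain q where q: "q \<in> chart_dom d \<inter> chart_dom c" "z = coord d q" using z by blast
    have "\<forall>p\<in>chart_dom d \<inter> chart_dom c. \<forall>v w. g d (coord d p) v w =
        g c (coord c p) (frechet_derivative transition (at (coord d p)) v)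
                        (frechet_derivative transition (at (coord d p)) w)"
      using A unfolding C1_riemannian_metric_def by blast
    then show ?thesis using q transition_apply[of q] by simp
  qed
  show ?thesis unfolding eventually_nhds
    by (rule exI[of _ overlap]) (intro conjI overlap_open assms ballI allI key)
qed

end

text \<open>\<open>\<psi>\<close> is a function on the whole coordinate space; the
  \<open>ball\<close> assumption confines its nonnegativity set to the image of the chart, so that
  \<open>param c\<close> is applied only where it inverts \<open>coord c\<close>.\<close>

locale bump_region =
  fixes A :: "('a::{t2_space,second_countable_topology}, 'e::euclidean_space) chart set"
    and c :: "('a, 'e) chart" and \<psi> :: "'e \<Rightarrow> real" and x1 :: 'e and r :: real
  assumes A: "smooth_atlas A" "c \<in> A"
    and ball: "cball x1 r \<subseteq> chart_ran c" "\<And>y. \<psi> y \<ge> 0 \<Longrightarrow> norm (y - x1) < r"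
    and poly: "real_polynomial_function \<psi>"
    and regular: "\<And>y. \<psi> y = 0 \<Longrightarrow> \<exists>v. frechet_derivative \<psi> (at y) v \<noteq> 0"
begin

definition "N = - param c ` {y. \<psi> y > 0}"

lemmas chart = atlas_chart[OF A]

lemma nonneg_in_ran: "\<psi> y \<ge> 0 \<Longrightarrow> y \<in> chart_ran c"
  using ball by (force simp: dist_norm norm_minus_commute)

lemma psi_continuous: "continuous_on S \<psi>"
  using poly continuous_on_polymonial_function real_polynomial_function_eq by blast

lemma psi_twice_diff: "twice_diff \<psi> y"
  using smooth_on_real_polynomial_function[OF poly, of UNIV]
  by (intro Ck_on_2_twice_diff[of _ UNIV]) (auto simp: smooth_on_def)

lemma mem_N: "q \<in> chart_dom c \<Longrightarrow> q \<in> N \<longleftrightarrow> \<psi> (coord c q) \<le> 0"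
proof -
  assume q: "q \<in> chart_dom c"
  have "q \<in> param c ` {y. \<psi> y > 0} \<longleftrightarrow> \<psi> (coord c q) > 0"
  proof
    assume "q \<in> param c ` {y. \<psi> y > 0}"
    then obtain y where y: "q = param c y" "\<psi> y > 0" by blast
    then have "coord c q = y" using chart(6)[OF nonneg_in_ran] by simp
    then show "\<psi> (coord c q) > 0" using y by simp
  next
    assume "\<psi> (coord c q) > 0"
    then show "q \<in> param c ` {y. \<psi> y > 0}"
      by (intro image_eqI[of _ _ "coord c q"]) (auto simp: chart(5)[OF q])
  qed
  then show ?thesis by (auto simp: N_def)
qed

lemma open_complement: "open (param c ` {y. \<psi> y > 0})"
proof -
  have "param c ` {y. \<psi> y > 0} = chart_dom c \<inter> coord c -` {y. \<psi> y > 0}"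
  proof (intro equalityI subsetI)
    fix q assume "q \<in> param c ` {y. \<psi> y > 0}"
    then obtain y where y: "q = param c y" "\<psi> y > 0" by blast
    then have "y \<in> chart_ran c" by (intro nonneg_in_ran) simp
    then show "q \<in> chart_dom c \<inter> coord c -` {y. \<psi> y > 0}" using chart(6,7)[of y] y by simp
  next
    fix q assume "q \<in> chart_dom c \<inter> coord c -` {y. \<psi> y > 0}"
    then show "q \<in> param c ` {y. \<psi> y > 0}"
      by (intro image_eqI[of _ _ "coord c q"]) (auto simp: chart(5))
  qed
  moreover have "open {y. \<psi> y > 0}" using open_Collect_less[OF continuous_on_const psi_continuous] .
  ultimately show ?thesis using continuous_open_preimage[OF chart(3,1)] by presburger
qed

lemma closed_N: "closed N"
  using open_complement by (simp add: N_def closed_def)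

text \<open>The derivative at a zero does not vanish, so \<open>\<psi>\<close> increases along some
  direction or its opposite. Hence no part of the zero set is lost when passing to the
  frontier.\<close>

lemma zero_in_closure:
  assumes "\<psi> y = 0"
  shows "y \<in> closure {y. \<psi> y > 0}"
proof -
  have diff: "\<psi> differentiable (at y)" using twice_diff_differentiable[OF psi_twice_diff] .
  obtain v0 where v0: "frechet_derivative \<psi> (at y) v0 \<noteq> 0" using regular[OF assms] by blast
  obtain v where v: "frechet_derivative \<psi> (at y) v > 0"
  proof (cases "frechet_derivative \<psi> (at y) v0 > 0")
    case True then show ?thesis using that by blast
  next
    case False
    then have "frechet_derivative \<psi> (at y) (- v0) > 0"
      using v0 linear_neg[OF linear_frechet_derivative[OF diff], of v0] by simp
    then show ?thesis using that by blast
  qed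
  have "((\<lambda>t. \<psi> (y + t *\<^sub>R v)) has_real_derivative frechet_derivative \<psi> (at y) v) (at 0)"
    using has_derivative_along_line[of \<psi> y 0 v] diff by simp
  from DERIV_pos_inc_right[OF this v] obtain e where e: "e > 0" "\<And>t. 0 < t \<Longrightarrow> t < e \<Longrightarrow> \<psi> (y + t *\<^sub>R v) > 0"
    using assms by auto
  show ?thesis unfolding closure_approachable
  proof (intro allI impI)
    fix \<epsilon> :: real assume "\<epsilon> > 0"
    define t where "t = min (e / 2) (\<epsilon> / (2 * (norm v + 1)))"
    have nv: "norm v + 1 > 0" using norm_ge_zero[of v] by linarith
    have t: "0 < t" "t < e" using e(1) \<open>\<epsilon> > 0\<close> nv by (auto simp: t_def)
    have "t * norm v \<le> t * (norm v + 1)" using t by simp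
    also have "\<dots> \<le> \<epsilon> / (2 * (norm v + 1)) * (norm v + 1)"
      using nv by (intro mult_right_mono) (auto simp: t_def)
    also have "\<dots> = \<epsilon> / 2" using nv by (simp add: field_simps)
    finally have "t * norm v < \<epsilon>" using \<open>\<epsilon> > 0\<close> by simp
    then show "\<exists>z\<in>{y. \<psi> y > 0}. dist z y < \<epsilon>"
      using e(2)[OF t] t(1) by (intro bexI[of _ "y + t *\<^sub>R v"]) (auto simp: dist_norm)
  qed
qed

text \<open>Compactness matters: the closure of the removed set is taken in the manifold and could
  otherwise contain points outside the chart.\<close>

lemma frontier_N: "frontier N = param c ` {y. \<psi> y = 0}"
proof -
  let ?D = "{y. \<psi> y > 0}" and ?E = "{y. \<psi> y \<ge> 0}"
  have "closed ?E" using closed_Collect_le[OF continuous_on_const psi_continuous] .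
  moreover have "bounded ?E"
    using ball(2) by (intro bounded_subset[OF bounded_cball[of x1 r]]) (force simp: dist_norm norm_minus_commute)
  ultimately have "compact ?E" by (simp add: compact_eq_bounded_closed)
  have Er: "?E \<subseteq> chart_ran c" using nonneg_in_ran by blast
  then have cE: "continuous_on ?E (param c)" using chart(4) continuous_on_subset by blast
  \<comment> \<open>The continuous image of a compact set is closed because the manifold is
    Hausdorff.\<close>
  then have "closed (param c ` ?E)" using \<open>compact ?E\<close> compact_continuous_image compact_imp_closed by blast
  then have up: "closure (param c ` ?D) \<subseteq> param c ` ?E" by (intro closure_minimal) auto
  have cD: "closure ?D \<subseteq> ?E" using \<open>closed ?E\<close> by (intro closure_minimal) auto
  have "param c ` closure ?D \<subseteq> closure (param c ` ?D)"
    by (intro image_closure_subset continuous_on_subset[OF cE cD] closed_closure closure_subset)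
  then have low: "param c y \<in> closure (param c ` ?D)" if "\<psi> y = 0" for y
    using zero_in_closure[OF that] by blast
  have fr: "frontier N = closure (param c ` ?D) - param c ` ?D"
    using interior_open[OF open_complement] by (simp add: N_def frontier_complement frontier_def[of "param c ` _"])
  show ?thesis unfolding fr
  proof (intro equalityI subsetI)
    fix q assume q: "q \<in> closure (param c ` ?D) - param c ` ?D"
    then obtain y where y: "q = param c y" "\<psi> y \<ge> 0" using up by blast
    then have "\<not> \<psi> y > 0" using q by blast
    then show "q \<in> param c ` {y. \<psi> y = 0}" using y by auto
  next
    fix q assume "q \<in> param c ` {y. \<psi> y = 0}"
    then obtain y where y: "q = param c y" "\<psi> y = 0" by blast
    have "q \<notin> param c ` ?D"
    proof
      assume "q \<in> param c ` ?D"
      then obtain z where z: "q = param c z" "\<psi> z > 0" by blast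
      have "coord c q = y" unfolding y(1) by (intro chart(6) nonneg_in_ran) (simp add: y(2))
      moreover have "coord c q = z" unfolding z(1) by (intro chart(6) nonneg_in_ran) (use z(2) in simp)
      ultimately show False using y(2) z(2) by simp
    qed
    then show "q \<in> closure (param c ` ?D) - param c ` ?D" using low y by blast
  qed
qed

lemma mem_frontier_N:
  assumes "q \<in> chart_dom c"
  shows "q \<in> frontier N \<longleftrightarrow> \<psi> (coord c q) = 0"
  unfolding frontier_N
proof
  assume "q \<in> param c ` {y. \<psi> y = 0}"
  then obtain y where y: "q = param c y" "\<psi> y = 0" by blast
  then have "coord c q = y" using chart(6)[OF nonneg_in_ran] by simp
  then show "\<psi> (coord c q) = 0" using y by simp
next
  assume "\<psi> (coord c q) = 0"
  then show "q \<in> param c ` {y. \<psi> y = 0}"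
    by (intro image_eqI[of _ _ "coord c q"]) (auto simp: chart(5)[OF assms])
qed

text \<open>An open set that contains all zeros of \<open>\<psi>\<close>, so one neighbourhood
  serves every boundary point.\<close>

definition "regular_points = {y \<in> chart_ran c. \<exists>v. frechet_derivative \<psi> (at y) v \<noteq> 0}"

lemma open_regular_points: "open regular_points"
proof -
  have "regular_points = (\<Union>v. chart_ran c \<inter> {y. frechet_derivative \<psi> (at y) v \<noteq> 0})"
    by (auto simp: regular_points_def)
  moreover have "open {y. frechet_derivative \<psi> (at y) v \<noteq> 0}" for v
    using frechet_derivative_real_polynomial_function[OF poly] continuous_on_polymonial_function
      real_polynomial_function_eq by (intro open_Collect_neq continuous_on_const) blast
  then have "open (\<Union>v. chart_ran c \<inter> {y. frechet_derivative \<psi> (at y) v \<noteq> 0})"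
    by (intro open_UN ballI open_Int chart(2))
  ultimately show ?thesis by simp
qed

lemma smooth_closed_region_N: "smooth_closed_region A N"
  unfolding smooth_closed_region_def
proof (intro conjI ballI closed_N)
  fix q assume "q \<in> frontier N"
  then obtain y where y: "q = param c y" "\<psi> y = 0" unfolding frontier_N by blast
  have yr: "y \<in> chart_ran c" using y nonneg_in_ran by simp
  have q: "q \<in> chart_dom c" "coord c q = y" using y yr chart(6,7)[of y] by auto
  have "coord c ` (N \<inter> chart_dom c) \<inter> regular_points = {y \<in> regular_points. \<psi> y \<le> 0}"
  proof (intro equalityI subsetI)
    fix z assume "z \<in> coord c ` (N \<inter> chart_dom c) \<inter> regular_points"
    then show "z \<in> {y \<in> regular_points. \<psi> y \<le> 0}" using mem_N by auto
  next
    fix z assume z: "z \<in> {y \<in> regular_points. \<psi> y \<le> 0}"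
    then have "z \<in> chart_ran c" by (simp add: regular_points_def)
    then have "param c z \<in> N \<inter> chart_dom c" "coord c (param c z) = z"
      using z mem_N[of "param c z"] chart(6,7)[of z] by auto
    then show "z \<in> coord c ` (N \<inter> chart_dom c) \<inter> regular_points" using z by force
  qed
  moreover have "coord c q \<in> regular_points" using q yr regular[OF y(2)] by (simp add: regular_points_def)
  ultimately show "\<exists>c\<in>A. q \<in> chart_dom c \<and>
       (\<exists>W (u :: 'e \<Rightarrow> real). open W \<and> coord c q \<in> W \<and> W \<subseteq> chart_ran c \<and> smooth_on u W \<and>
          (\<forall>y\<in>W. \<exists>v. frechet_derivative u (at y) v \<noteq> 0) \<and>
          coord c ` (N \<inter> chart_dom c) \<inter> W = {y\<in>W. u y \<le> 0})"
    using A(2) q(1) open_regular_points smooth_on_real_polynomial_function[OF poly]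
    by (intro bexI[of _ c] conjI exI[of _ regular_points] exI[of _ \<psi>]) (auto simp: regular_points_def)
qed

text \<open>In the chart \<open>d\<close> the region is the sublevel set of \<open>\<psi>\<close>
  composed with the transition map. The lowest eigenvalues on the tangent space are attained on a
  tuple there; its image under the derivative of the transition is an admissible tuple for
  \<open>large\<close>, and dividing by the gradient norm gives the curvature bound.\<close>

lemma boundary_curvature_sum_greater:
  assumes g: "C1_riemannian_metric A g" and "d \<in> A"
    and x1: "x1 \<in> chart_ran c" "\<psi> x1 = 0" and p: "param c x1 \<in> chart_dom d" and m: "m < DIM('e)"
    and large: "\<And>v. orthonormal_tuple (g c x1) UNIV m v \<Longrightarrow>
      h * deriv_norm (g c) \<psi> x1 < (\<Sum>i<m. hessian (g c) \<psi> x1 (v i) (v i))"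
  shows "boundary_curvature_sum d (g d) m N (param c x1) > h"
proof -
  note [simp] = atlas_chart(5)[OF A(1) \<open>d \<in> A\<close>]
  note tr = A(1) g A(2) \<open>d \<in> A\<close>
  let ?\<sigma> = "coord c \<circ> param d" and ?O = "coord d ` (chart_dom d \<inter> chart_dom c)"
  let ?D = "\<lambda>y. frechet_derivative ?\<sigma> (at y)"
  define x where "x = coord d (param c x1)"
  have p1: "param c x1 \<in> chart_dom d \<inter> chart_dom c" using p x1 chart(7) by blast
  have xO: "x \<in> ?O" using p1 by (auto simp: x_def)
  have sx: "?\<sigma> x = x1" using p x1 chart(6) by (simp add: x_def)
  define U where "U = \<psi> \<circ> ?\<sigma>"
  define W where "W = ?O \<inter> ?\<sigma> -` regular_points"
  define R where "R = coord d ` (N \<inter> chart_dom d)"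
  define S where "S = coord d ` (frontier N \<inter> chart_dom d)"
  have "open W" unfolding W_def
    by (intro continuous_open_preimage transition_continuous[OF tr] overlap_open[OF tr] open_regular_points)
  have Gd: "metric_at (g d) y" if "y \<in> ?O" for y
    using riemannian_metric_chart(1)[OF A(1) g \<open>d \<in> A\<close>] that by blast
  have Gc: "metric_at (g c) (?\<sigma> y)" if "y \<in> ?O" for y
    using riemannian_metric_chart(1)[OF A(1) g A(2), of "?\<sigma> y"] that by auto
  note iso = transition_isometry[OF tr] and s2 = transition_twice_diff[OF tr]
  have xW: "x \<in> W" using xO sx x1 regular by (auto simp: W_def regular_points_def)
  interpret sublevel_region "g d" U W R S x
  proof
    show "open W" "x \<in> W" by fact+
    show "metric_at (g d) x" by (rule Gd[OF xO])
    show "inner_form (g d y)" if "y \<in> W" for y using that Gd metric_at_inner_form by (auto simp: W_def)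
    show "twice_diff U x" unfolding U_def by (rule twice_diff_compose(1)[OF s2[OF xO] psi_twice_diff])
    show "U x = 0" using sx x1 by (simp add: U_def)
    fix y assume "y \<in> W"
    then have y: "y \<in> ?O" "?\<sigma> y \<in> regular_points" by (auto simp: W_def)
    show "U differentiable (at y)"
      unfolding U_def by (rule twice_diff_differentiable[OF twice_diff_compose(1)[OF s2[OF y(1)] psi_twice_diff]])
    obtain w where w: "frechet_derivative \<psi> (at (?\<sigma> y)) w \<noteq> 0" using y(2) unfolding regular_points_def by blast
    obtain v where "w = ?D y v"
      using isometry_bij(2)[OF Gd[OF y(1)] Gc[OF y(1)] s2[OF y(1)] psi_twice_diff iso[OF y(1)]] by (metis surjD)
    then show "\<exists>v. frechet_derivative U (at y) v \<noteq> 0"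
      using w twice_diff_compose(2)[OF s2[OF y(1)] psi_twice_diff] unfolding U_def by metis
  next
    \<comment> \<open>As \<open>coord d\<close> is injective on its domain, a point whose
      coordinates fall into \<open>W\<close> also lies in the domain of \<open>c\<close>, where
      \<open>N\<close> and its frontier are described by \<open>\<psi>\<close>.\<close>
    have mem: "coord d q \<in> W \<Longrightarrow> q \<in> chart_dom d \<Longrightarrow> q \<in> chart_dom c" for q
      unfolding W_def by (metis (no_types, lifting) IntE imageE atlas_chart(5)[OF A(1) \<open>d \<in> A\<close>])
    have U: "U (coord d q) = \<psi> (coord c q)" if "q \<in> chart_dom d" for q using that by (simp add: U_def)
    have W: "\<exists>q. y = coord d q \<and> q \<in> chart_dom d \<and> q \<in> chart_dom c" if "y \<in> W" for y
      using that by (auto simp: W_def)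
    show "R \<inter> W = {y \<in> W. U y \<le> 0}"
    proof (intro equalityI subsetI)
      fix y assume "y \<in> R \<inter> W"
      then show "y \<in> {y \<in> W. U y \<le> 0}" using mem mem_N U by (auto simp: R_def)
    next
      fix y assume y: "y \<in> {y \<in> W. U y \<le> 0}"
      then obtain q where q: "y = coord d q" "q \<in> chart_dom d" "q \<in> chart_dom c" using W by blast
      then have "q \<in> N \<inter> chart_dom d" using mem_N[OF q(3)] U[OF q(2)] y by simp
      then show "y \<in> R \<inter> W" using y q(1) unfolding R_def by blast
    qed
    show "S \<inter> W = {y \<in> W. U y = 0}"
    proof (intro equalityI subsetI)
      fix y assume "y \<in> S \<inter> W"
      then show "y \<in> {y \<in> W. U y = 0}" using mem mem_frontier_N U by (auto simp: S_def)
    next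
      fix y assume y: "y \<in> {y \<in> W. U y = 0}"
      then obtain q where q: "y = coord d q" "q \<in> chart_dom d" "q \<in> chart_dom c" using W by blast
      then have "q \<in> frontier N \<inter> chart_dom d" using mem_frontier_N[OF q(3)] U[OF q(2)] y by simp
      then show "y \<in> S \<inter> W" using y q(1) unfolding S_def by blast
    qed
  qed
  note tw = Gd[OF xO] Gc[OF xO] s2[OF xO] psi_twice_diff iso[OF xO]
  note gx = metric_at_inner_form[OF Gd[OF xO]]
  have dn: "deriv_norm (g d) U x = deriv_norm (g c) \<psi> x1"
    unfolding U_def deriv_norm_isometry[OF tw] sx ..
  have dn_pos: "deriv_norm (g d) U x > 0"
    using grad_pos[OF xW] by (simp add: deriv_norm_def Let_def grad_def)
  have hs: "hessian (g d) U x v w = hessian (g c) \<psi> x1 (?D x v) (?D x w)" for v w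
    unfolding U_def hessian_isometry[OF tw] sx ..
  define q where "q = 1 / deriv_norm (g d) U x"
  have "q > 0" using dn_pos by (simp add: q_def)
  define B where "B v w = q * hessian (g d) U x v w" for v w
  have "twice_diff U x" using U(1) .
  have B: "bilinear B" "B v w = B w v" for v w
  proof -
    have "bilinear (\<lambda>v w. q * hessian (g d) U x v w + 0 * hessian (g d) U x v w)"
      by (intro bilinear_combination hessian_bilinear_symmetric Gd[OF xO] \<open>twice_diff U x\<close>)
    then show "bilinear B" by (simp add: B_def[abs_def])
    show "B v w = B w v" unfolding B_def using hessian_bilinear_symmetric(2)[OF Gd[OF xO] \<open>twice_diff U x\<close>] by metis
  qed
  let ?T = "{v. frechet_derivative U (at x) v = 0}"
  have lin: "linear (frechet_derivative U (at x))" using dU(2)[OF xW] .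
  have T: "subspace ?T" using lin by (auto simp: subspace_def linear_0 linear_add linear_cmul)
  \<comment> \<open>The tangent space is a hyperplane, so this is where the strict inequality
    \<open>m < DIM('e)\<close> enters.\<close>
  have dimT: "m \<le> dim ?T"
  proof -
    obtain b where b: "\<And>v. b \<bullet> v = frechet_derivative U (at x) v"
      using linear_functional_representer[OF lin] by metis
    obtain v where "frechet_derivative U (at x) v \<noteq> 0" using sublevel_region.regular[OF sublevel_region_axioms xW] by blast
    then have "b \<noteq> 0" using b[of v] by auto
    from dim_hyperplane[OF this] show ?thesis using m by (simp add: b)
  qed
  obtain v where v: "orthonormal_tuple (g d x) ?T m v"
    and sum: "sum_lowest_eigenvalues m (g d x) ?T B = (\<Sum>i<m. B (v i) (v i))"
    using sum_lowest_eigenvalues_attained[OF gx B T dimT] by metis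
  have "g c x1 (?D x v) (?D x w) = g d x v w" for v w
    by (rule isometry_bij(3)[OF tw, unfolded sx, symmetric])
  then have "orthonormal_tuple (g c x1) UNIV m (\<lambda>i. ?D x (v i))"
    using v by (simp add: orthonormal_tuple_def)
  from large[OF this] have "h * deriv_norm (g d) U x < (\<Sum>i<m. hessian (g d) U x (v i) (v i))"
    by (simp add: hs dn)
  then have "q * (h * deriv_norm (g d) U x) < q * (\<Sum>i<m. hessian (g d) U x (v i) (v i))"
    using \<open>q > 0\<close> by (rule mult_strict_left_mono)
  also have "\<dots> = sum_lowest_eigenvalues m (g d x) ?T B" by (simp add: sum B_def sum_distrib_left)
  also have "\<dots> = sum_lowest_eigenvalues m (g d x) ?T (second_fund_form (g d) R S x)"
    by (rule sum_lowest_eigenvalues_cong) (simp add: second_fund_form_eq B_def q_def)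
  also have "\<dots> = boundary_curvature_sum d (g d) m N (param c x1)"
    unfolding boundary_curvature_sum_def Let_def R_def[symmetric] S_def[symmetric] x_def[symmetric]
      tangent_vectors_eq[OF xW U(2)] ..
  finally show ?thesis using dn_pos by (simp add: q_def)
qed

end

theorem theorem8p2:
  fixes A :: "('a::{t2_space,second_countable_topology}, 'e::euclidean_space) chart set"
    and g :: "('a, 'e) chart \<Rightarrow> 'e metric_field"
    and Z :: "'a set" and m :: nat and h :: real
  assumes "smooth_atlas A" and "C1_riemannian_metric A g"
    and "closed Z" and "m < DIM('e)"
    and "\<not> mh_set A g m h Z"
  shows "\<exists>N p. smooth_closed_region A N \<and> Z \<subseteq> N \<and> p \<in> Z \<inter> frontier N \<and>
           (\<forall>c\<in>A. p \<in> chart_dom c \<longrightarrow> boundary_curvature_sum c (g c) m N p > h)"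
proof -
  \<comment> \<open>As \<open>Z\<close> is closed, only the inequality for test functions can fail.
    The chart in which it fails is kept for the construction.\<close>
  obtain f p c where f: "C2_function A f" "local_max_on f Z p" "c \<in> A" "p \<in> chart_dom c"
    and large: "sum_lowest_eigenvalues m (g c (coord c p)) UNIV (hessian (g c) (f \<circ> param c) (coord c p))
        > h * deriv_norm (g c) (f \<circ> param c) (coord c p)"
    using assms(3,5) unfolding mh_set_def by (auto simp: not_le)
  note chart = atlas_chart[OF assms(1) f(3)]
  note metric = riemannian_metric_chart[OF assms(1,2) f(3)]
  let ?\<Omega> = "chart_ran c" and ?F = "f \<circ> param c"
  define x0 where "x0 = coord c p"
  define Zc where "Zc = coord c ` (Z \<inter> chart_dom c)"
  have x0: "x0 \<in> ?\<Omega>" "param c x0 = p" using f(4) chart(5) by (auto simp: x0_def)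
  obtain W where W: "open W" "p \<in> W" "\<And>q. q \<in> Z \<inter> W \<Longrightarrow> f q \<le> f p" and pZ: "p \<in> Z"
    using f(2) unfolding local_max_on_def by blast
  have "open (?\<Omega> \<inter> param c -` W)" by (rule continuous_open_preimage[OF chart(4,2) W(1)])
  moreover have "x0 \<in> ?\<Omega> \<inter> param c -` W" using x0 W(2) by simp
  ultimately obtain r0 where r0: "r0 > 0" "cball x0 r0 \<subseteq> ?\<Omega> \<inter> param c -` W"
    using open_contains_cball by blast
  have Zc_mem: "y \<in> Zc \<longleftrightarrow> param c y \<in> Z" if "y \<in> ?\<Omega>" for y
  proof
    assume "y \<in> Zc"
    then show "param c y \<in> Z" using chart(5) by (auto simp: Zc_def)
  next
    assume "param c y \<in> Z"
    then show "y \<in> Zc" unfolding Zc_def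
      by (intro image_eqI[of _ _ "param c y"]) (simp_all only: chart(6,7)[OF that] IntI)
  qed
  \<comment> \<open>\<open>Zc\<close> itself need not be closed in the coordinate space; its part in
    a closed ball inside the chart image is.\<close>
  have "Zc \<inter> cball x0 r0 = cball x0 r0 \<inter> param c -` Z" using Zc_mem r0(2) by blast
  moreover have "closed (cball x0 r0 \<inter> param c -` Z)"
    using r0(2) by (intro continuous_closed_preimage[OF continuous_on_subset[OF chart(4)]] assms(3)) auto
  ultimately have cl: "closed (Zc \<inter> cball x0 r0)" by simp
  have "\<exists>x a C r. touching_quadratic m h (g c) ?\<Omega> Zc x a C r"
  proof (rule exists_touching_quadratic[OF chart(2) r0(1) _ _ cl metric])
    show "cball x0 r0 \<subseteq> ?\<Omega>" using r0(2) by blast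
    show "x0 \<in> Zc" using Zc_mem[OF x0(1)] x0(2) pZ by simp
    show "twice_diff ?F x0"
      using f(1,3) x0(1) chart(2) by (intro Ck_on_2_twice_diff[of _ ?\<Omega>]) (auto simp: C2_function_def)
    show "?F y \<le> ?F x0" if y: "y \<in> Zc \<inter> cball x0 r0" for y
    proof -
      have "y \<in> ?\<Omega>" "param c y \<in> W" using y r0(2) by blast+
      then have "param c y \<in> Z \<inter> W" using y Zc_mem by blast
      then show ?thesis using W(3) x0(2) by simp
    qed
    show "m \<le> DIM('e)" using assms(4) by simp
    show "h * deriv_norm (g c) ?F x0 < sum_lowest_eigenvalues m (g c x0) UNIV (hessian (g c) ?F x0)"
      using large by (simp add: x0_def)
  qed
  then obtain x a C r where "touching_quadratic m h (g c) ?\<Omega> Zc x a C r" by blast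
  then have tq: "x \<in> Zc" "r > 0" "cball x r \<subseteq> ?\<Omega>" "a \<noteq> 0" "bilinear C" "\<And>v w. C v w = C w v"
     "\<And>y. y \<in> Zc \<inter> cball x r \<Longrightarrow> a \<bullet> (y - x) + C (y - x) (y - x) / 2 \<le> 0"
     "\<And>v. orthonormal_tuple (g c x) UNIV m v \<Longrightarrow>
        h * dual_norm (g c x) (\<lambda>z. a \<bullet> z) < (\<Sum>i<m. C (v i) (v i) - a \<bullet> christoffel (g c) x (v i) (v i))"
    unfolding touching_quadratic_def by blast+
  \<comment> \<open>The radius is that of the touching ball, so wherever the bump is positive the
    touching inequality is available.\<close>
  obtain K where K: "K \<ge> 0" "\<And>y. quartic_bump a C K x y \<ge> 0 \<Longrightarrow> norm (y - x) < r"
    "\<And>y. quartic_bump a C K x y = 0 \<Longrightarrow> \<exists>v. frechet_derivative (quartic_bump a C K x) (at y) v \<noteq> 0"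
    using quartic_bump_choice[OF tq(5,6,4,2)] by metis
  let ?\<psi> = "quartic_bump a C K x"
  note center = quartic_bump_at_center[OF tq(5,6)]
  interpret bump_region A c ?\<psi> x r
    by unfold_locales (use assms(1) f(3) tq(3) K quartic_bump_polynomial[OF tq(5,6)] in auto)
  have xr: "x \<in> ?\<Omega>" using tq(2,3) by auto
  \<comment> \<open>At a removed point the quadratic part of the bump would be positive, since the
    quartic term only lowers the value; on \<open>Zc\<close> within the ball it is at most
    0.\<close>
  have "Z \<subseteq> N"
  proof
    fix q assume q: "q \<in> Z"
    show "q \<in> N"
    proof (rule ccontr)
      assume "q \<notin> N"
      then obtain y where y: "q = param c y" "?\<psi> y > 0" by (auto simp: N_def)
      then have "y \<in> Zc" using Zc_mem[of y] nonneg_in_ran[of y] q by simp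
      moreover have "y \<in> cball x r" using K(2)[of y] y(2) by (simp add: dist_norm norm_minus_commute)
      ultimately have "a \<bullet> (y - x) + C (y - x) (y - x) / 2 \<le> 0" using tq(7) by blast
      moreover have "0 \<le> K * ((y - x) \<bullet> (y - x))\<^sup>2" using K(1) by simp
      ultimately show False using y(2) by (simp add: quartic_bump_def)
    qed
  qed
  moreover have "param c x \<in> Z \<inter> frontier N"
    using Zc_mem[OF xr] tq(1) center(1) by (auto simp: frontier_N)
  moreover have "boundary_curvature_sum d (g d) m N (param c x) > h"
    if d: "d \<in> A" "param c x \<in> chart_dom d" for d
  proof (rule boundary_curvature_sum_greater[OF assms(2) d(1) xr center(1) d(2) assms(4)])
    \<comment> \<open>At \<open>x\<close> the bump has gradient \<open>a\<close> and second
      derivative \<open>C\<close>, so its Hessian trace is the sum in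
      \<open>touching_quadratic\<close>.\<close>
    fix v assume "orthonormal_tuple (g c x) UNIV m v"
    moreover have "frechet_derivative ?\<psi> (at x) = (\<lambda>z. a \<bullet> z)" by (simp add: fun_eq_iff center(2))
    ultimately show "h * deriv_norm (g c) ?\<psi> x < (\<Sum>i<m. hessian (g c) ?\<psi> x (v i) (v i))"
      using tq(8) by (simp add: deriv_norm_eq hessian_eq center(4))
  qed
  ultimately show ?thesis using smooth_closed_region_N by blast
qed

end
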